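(* There exists an FPTRAS for p-#Even Subgraph, and there also exists an FPTRAS for p-#Odd Subgraph.
   Context: All graphs are finite and simple. p-#Even Subgraph (respectively p-#Odd Subgraph): the input is a graph $G=(V,E)$ and an integer $k$; the parameter is $k$; the output is the number of $k$-element subsets $U\subseteq V$ such that the induced subgraph $G[U]$ has an even (respectively odd) number of edges. A parameterised counting problem is a pair $(\Pi,\kappa)$ with $\Pi:\Sigma^*\to\mathbb{N}_0$ a function ($\Sigma$ a finite alphabet) and $\kappa:\Sigma^*\to\mathbb{N}$ a polynomial-time computable parameterisation. An FPTRAS for $(\Pi,\kappa)$ is a randomised approximation scheme that takes an instance $I$ of $\Pi$ (with $|I|=n$) and real numbers $\epsilon>0$ and $0<\delta<1$, and in time $f(\kappa(I))\cdot g(n,1/\epsilon,\log(1/\delta))$ (where $f$ is any function and $g$ is a polynomial in $n$, $1/\epsilon$ and $\log(1/\delta)$) outputs a rational number $z$ such that $$\mathbb{P}[(1-\epsilon)\Pi(I)\le z\le(1+\epsilon)\Pi(I)]\ge 1-\delta.$$ *)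

theory Defs
  imports "HOL-Probability.Probability" "HOL-Library.Log_Nat"
begin

section \<open>Counting even and odd induced subgraphs\<close>

definition simple_graph :: "'a set \<Rightarrow> 'a set set \<Rightarrow> bool" where
  "simple_graph V E \<longleftrightarrow> finite V \<and> (\<forall>e\<in>E. e \<subseteq> V \<and> card e = 2)"

definition induced_edges :: "'a set set \<Rightarrow> 'a set \<Rightarrow> 'a set set" where
  "induced_edges E U = {e \<in> E. e \<subseteq> U}"

definition num_even_subgraphs :: "'a set \<Rightarrow> 'a set set \<Rightarrow> nat \<Rightarrow> nat" where
  "num_even_subgraphs V E k =
     card {U. U \<subseteq> V \<and> card U = k \<and> even (card (induced_edges E U))}"

definition num_odd_subgraphs :: "'a set \<Rightarrow> 'a set set \<Rightarrow> nat \<Rightarrow> nat" where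
  "num_odd_subgraphs V E k =
     card {U. U \<subseteq> V \<and> card U = k \<and> odd (card (induced_edges E U))}"


section \<open>The machine model\<close>

text \<open>
  Algorithms are programs for a probabilistic random access machine with logarithmic cost, which
  simulates and is simulated by probabilistic Turing machines with polynomial overhead.  The data
  are: a read-only input word; a memory of cells, indexed by and containing natural numbers, all
  initially 0; fair coin flips; and read-only real arguments.

  A real argument \<open>r\<close> is an infinite object, of which a program only sees finite parts of the binary
  expansion: it may test \<open>a \<le> 2 ^ j * r\<close>, that is \<open>a \<le> \<lfloor>2 ^ j * r\<rfloor>\<close>, at a cost of \<open>j\<close> plus the
  length of \<open>a\<close>.
\<close>

type_synonym mem = "nat \<Rightarrow> nat"
type_synonym word = "nat list"

datatype aexp =
    Const nat
  | InputLength
  | Input aexp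
  | Mem aexp
  | Add aexp aexp
  | Sub aexp aexp
  | Mul aexp aexp
  | Div aexp aexp

datatype com =
    Skip
  | Store aexp aexp
  | Flip aexp
  | Query nat aexp aexp aexp
  | Seq com com
  | If aexp com com
  | While aexp com

primrec aval :: "word \<Rightarrow> aexp \<Rightarrow> mem \<Rightarrow> nat" where
  "aval w (Const c) m = c"
| "aval w InputLength m = length w"
| "aval w (Input a) m = (if aval w a m < length w then w ! aval w a m else 0)"
| "aval w (Mem a) m = m (aval w a m)"
| "aval w (Add a b) m = aval w a m + aval w b m"
| "aval w (Sub a b) m = aval w a m - aval w b m"
| "aval w (Mul a b) m = aval w a m * aval w b m"
| "aval w (Div a b) m = aval w a m div aval w b m"

text \<open>Every node of an expression costs 1 plus the number of binary digits of its value;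
  the cost of an address is that of the expression computing it.\<close>

primrec acost :: "word \<Rightarrow> aexp \<Rightarrow> mem \<Rightarrow> nat" where
  "acost w (Const c) m = 1 + floorlog 2 c"
| "acost w InputLength m = 1 + floorlog 2 (length w)"
| "acost w (Input a) m = 1 + floorlog 2 (aval w (Input a) m) + acost w a m"
| "acost w (Mem a) m = 1 + floorlog 2 (aval w (Mem a) m) + acost w a m"
| "acost w (Add a b) m = 1 + floorlog 2 (aval w (Add a b) m) + acost w a m + acost w b m"
| "acost w (Sub a b) m = 1 + floorlog 2 (aval w (Sub a b) m) + acost w a m + acost w b m"
| "acost w (Mul a b) m = 1 + floorlog 2 (aval w (Mul a b) m) + acost w a m + acost w b m"
| "acost w (Div a b) m = 1 + floorlog 2 (aval w (Div a b) m) + acost w a m + acost w b m"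

text \<open>The semantics of a program is the subdistribution of the pair of final memory and running
  time; the missing probability mass is that of nontermination.  Guards count as true when they
  are nonzero.\<close>

partial_function (spmf) loop ::
  "word \<Rightarrow> aexp \<Rightarrow> (mem \<Rightarrow> (mem \<times> nat) spmf) \<Rightarrow> mem \<Rightarrow> (mem \<times> nat) spmf" where
  "loop w a body m =
     (if aval w a m = 0 then return_spmf (m, 1 + acost w a m)
      else bind_spmf (body m) (\<lambda>(m1, t1).
           bind_spmf (loop w a body m1) (\<lambda>(m2, t2).
           return_spmf (m2, 1 + acost w a m + t1 + t2))))"

primrec exec :: "word \<Rightarrow> (nat \<Rightarrow> real) \<Rightarrow> com \<Rightarrow> mem \<Rightarrow> (mem \<times> nat) spmf" where
  "exec w r Skip = (\<lambda>m. return_spmf (m, 1))"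
| "exec w r (Store a b) =
     (\<lambda>m. return_spmf (m(aval w a m := aval w b m), 1 + acost w a m + acost w b m))"
| "exec w r (Flip a) =
     (\<lambda>m. map_spmf (\<lambda>c. (m(aval w a m := of_bool c), 1 + acost w a m)) coin_spmf)"
| "exec w r (Query i d a j) =
     (\<lambda>m. return_spmf
        (m(aval w d m := of_bool (real (aval w a m) \<le> 2 ^ aval w j m * r i)),
         1 + acost w d m + acost w a m + acost w j m + aval w j m))"
| "exec w r (Seq c1 c2) =
     (\<lambda>m. bind_spmf (exec w r c1 m) (\<lambda>(m1, t1).
          bind_spmf (exec w r c2 m1) (\<lambda>(m2, t2). return_spmf (m2, t1 + t2))))"
| "exec w r (If a c1 c2) =
     (\<lambda>m. map_spmf (\<lambda>(m', t). (m', 1 + acost w a m + t))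
            (if aval w a m \<noteq> 0 then exec w r c1 m else exec w r c2 m))"
| "exec w r (While a c) = loop w a (exec w r c)"

definition run :: "com \<Rightarrow> word \<Rightarrow> (nat \<Rightarrow> real) \<Rightarrow> (mem \<times> nat) spmf" where
  "run c w r = exec w r c (\<lambda>_. 0)"


section \<open>Parameterised counting problems and FPTRASes\<close>

text \<open>Alphabet, counting function and parameterisation.\<close>

type_synonym problem = "nat set \<times> (word \<Rightarrow> nat) \<times> (word \<Rightarrow> nat)"

definition poly_time_computable :: "nat set \<Rightarrow> (word \<Rightarrow> nat) \<Rightarrow> bool" where
  "poly_time_computable \<Sigma> F \<longleftrightarrow>
     (\<exists>(c :: com) (p :: real poly). \<forall>w\<in>lists \<Sigma>. \<exists>m t.
        run c w (\<lambda>_. 0) = return_spmf (m, t) \<and> m 0 = F w \<and> real t \<le> poly p (real (length w)))"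

fun param_counting_problem :: "problem \<Rightarrow> bool" where
  "param_counting_problem (\<Sigma>, F, \<kappa>) \<longleftrightarrow> finite \<Sigma> \<and> poly_time_computable \<Sigma> \<kappa>"

definition trivariate_polynomial :: "(real \<Rightarrow> real \<Rightarrow> real \<Rightarrow> real) \<Rightarrow> bool" where
  "trivariate_polynomial g \<longleftrightarrow>
     (\<exists>(d :: nat) (c :: nat \<Rightarrow> nat \<Rightarrow> nat \<Rightarrow> real). \<forall>x y z.
        g x y z = (\<Sum>i\<le>d. \<Sum>j\<le>d. \<Sum>l\<le>d. c i j l * x ^ i * y ^ j * z ^ l))"

text \<open>Cells 0 and 1 hold numerator and denominator of the output.\<close>

definition output_value :: "mem \<Rightarrow> rat" where
  "output_value m = of_nat (m 0) / of_nat (m 1)"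

text \<open>The running time is bounded for every outcome of the coin flips: every halting computation
  respects the bound, and a computation exceeding it without halting would have a prefix of
  positive probability without admissible continuation, contradicting losslessness.\<close>

fun is_FPTRAS :: "com \<Rightarrow> problem \<Rightarrow> bool" where
  "is_FPTRAS c (\<Sigma>, F, \<kappa>) \<longleftrightarrow>
     param_counting_problem (\<Sigma>, F, \<kappa>) \<and>
     (\<exists>(f :: nat \<Rightarrow> real) g. trivariate_polynomial g \<and>
       (\<forall>w\<in>lists \<Sigma>. \<forall>\<epsilon> \<delta> :: real. 0 < \<epsilon> \<longrightarrow> 0 < \<delta> \<longrightarrow> \<delta> < 1 \<longrightarrow>
         (let D = run c w (\<lambda>i. if i = 0 then \<epsilon> else \<delta>) in
            lossless_spmf D \<and>
            (\<forall>(m, t) \<in> set_spmf D. m 1 \<noteq> 0 \<and>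
               real t \<le> f (\<kappa> w) * g (real (length w)) (1 / \<epsilon>) (log 2 (1 / \<delta>))) \<and>
            measure (measure_spmf D)
              {(m, t). (1 - \<epsilon>) * real (F w) \<le> of_rat (output_value m) \<and>
                       of_rat (output_value m) \<le> (1 + \<epsilon>) * real (F w)} \<ge> 1 - \<delta>)))"


section \<open>The problems p-\#Even Subgraph and p-\#Odd Subgraph\<close>

text \<open>An instance consists of the number \<open>n\<close> of vertices, the edge set of a graph on
  \<open>{..<n}\<close>, and \<open>k\<close>.  It is coded over the alphabet \<open>{0, 1, 2}\<close> by the binary digits of \<open>k\<close>
  (least significant first), the separator 2, and the adjacency matrix row by row.\<close>

type_synonym graph_instance = "nat \<times> nat set set \<times> nat"

definition instances :: "graph_instance set" where
  "instances = {(n, E, k). simple_graph {..<n} E}"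

definition binary_digits :: "nat \<Rightarrow> word" where
  "binary_digits k = map (\<lambda>i. k div 2 ^ i mod 2) [0..<floorlog 2 k]"

fun encode :: "graph_instance \<Rightarrow> word" where
  "encode (n, E, k) =
     binary_digits k @ [2] @ concat (map (\<lambda>u. map (\<lambda>v. of_bool ({u, v} \<in> E)) [0..<n]) [0..<n])"

text \<open>Words that are not codes of instances are given the value 0.\<close>

definition on_codes :: "(graph_instance \<Rightarrow> nat) \<Rightarrow> word \<Rightarrow> nat" where
  "on_codes F w =
     (if w \<in> encode ` instances then F (inv_into instances encode w) else 0)"

definition p_even_subgraph :: problem where
  "p_even_subgraph =
     ({0, 1, 2}, on_codes (\<lambda>(n, E, k). num_even_subgraphs {..<n} E k), on_codes (\<lambda>(n, E, k). k))"

definition p_odd_subgraph :: problem where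
  "p_odd_subgraph =
     ({0, 1, 2}, on_codes (\<lambda>(n, E, k). num_odd_subgraphs {..<n} E k), on_codes (\<lambda>(n, E, k). k))"

lemma binary_no_sep: "2 \<notin> set (binary_digits k)"
  by (auto simp: binary_digits_def)

lemma binary_inj: "binary_digits k = binary_digits l \<Longrightarrow> k = l"
proof -
  have *: "k < 2 ^ floorlog 2 k" for k :: nat
    using floorlog_bounds[of k 2] by (cases "k = 0") auto
  assume eq: "binary_digits k = binary_digits l"
  then have len: "floorlog 2 k = floorlog 2 l"
    by (metis binary_digits_def diff_zero length_map length_upt)
  have "k div 2 ^ i mod 2 = l div 2 ^ i mod 2" for i
  proof (cases "i < floorlog 2 k")
    case True
    then have "binary_digits k ! i = k div 2 ^ i mod 2" "binary_digits l ! i = l div 2 ^ i mod 2"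
      using len by (simp_all add: binary_digits_def)
    then show ?thesis using eq by simp
  next
    case False
    then have "(2::nat) ^ floorlog 2 k \<le> 2 ^ i" by (intro power_increasing) auto
    then have "k < 2 ^ i" "l < 2 ^ i" using *[of k] *[of l] len by (simp_all add: less_le_trans)
    then show ?thesis by simp
  qed
  then have "bit k i = bit l i" for i by (metis bit_iff_odd odd_iff_mod_2_eq_one)
  then show "k = l" by (simp add: bit_eq_iff)
qed

lemma split_at_sep:
  assumes "xs @ [s] @ ys = xs' @ [s] @ ys'" "s \<notin> set xs" "s \<notin> set xs'"
  shows "xs = xs' \<and> ys = ys'"
  using assms by (induction xs arbitrary: xs') (auto simp: Cons_eq_append_conv)

lemma matrix_conv:
  fixes u v n m :: nat and h :: "nat \<Rightarrow> nat \<Rightarrow> 'b"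
  assumes "u < m" "v < n"
  shows "concat (map (\<lambda>u. map (\<lambda>v. h u v) [0..<n]) [0..<m]) ! (u * n + v) = h u v"
  using assms
proof (induction m)
  case (Suc m)
  have len: "length (concat (map (\<lambda>u. map (\<lambda>v. h u v) [0..<n]) [0..<m])) = m * n"
    by (simp add: length_concat comp_def sum_list_triv)
  show ?case
  proof (cases "u = m")
    case True
    then show ?thesis using len Suc.prems by (simp add: nth_append)
  next
    case False
    then have "u < m" using Suc.prems by simp
    then have "(u + 1) * n \<le> m * n" by (intro mult_right_mono) auto
    then have "u * n + v < m * n" using Suc.prems by simp
    then show ?thesis using Suc len \<open>u < m\<close> by (simp add: nth_append)
  qed
qed simp

lemma inj_on_encode: "inj_on encode instances"
proof (rule inj_onI)
  fix x y
  assume "x \<in> instances" "y \<in> instances" "encode x = encode y"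
  moreover obtain n E k n' E' k' where xy: "x = (n, E, k)" "y = (n', E', k')"
    by (metis prod_cases3)
  ultimately have I: "(n, E, k) \<in> instances" "(n', E', k') \<in> instances"
    and eq: "encode (n, E, k) = encode (n', E', k')"
    by simp_all
  let ?M = "\<lambda>n E. concat (map (\<lambda>u. map (\<lambda>v. of_bool ({u, v} \<in> E)) [0..<n]) [0..<n]) :: word"
  have "binary_digits k = binary_digits k' \<and> ?M n E = ?M n' E'"
    using eq by (intro split_at_sep[of _ 2]) (simp_all add: binary_no_sep)
  then have k: "k = k'" and M: "?M n E = ?M n' E'" by (auto dest: binary_inj)
  have "n * n = n' * n'"
    using arg_cong[OF M, of length] by (simp add: length_concat comp_def sum_list_triv)
  then have n: "n = n'" by (simp flip: power2_eq_square)
  have adj: "{u, v} \<in> E \<longleftrightarrow> {u, v} \<in> E'" if "u < n" "v < n" for u v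
  proof -
    have "?M n E ! (u * n + v) = ?M n' E' ! (u * n + v)" using M by simp
    then have "(of_bool ({u, v} \<in> E) :: nat) = of_bool ({u, v} \<in> E')"
      using that unfolding n by (simp add: matrix_conv)
    then show ?thesis by (simp only: of_bool_eq_iff)
  qed
  have "e \<in> E \<longleftrightarrow> e \<in> E'" for e
  proof (cases "e \<subseteq> {..<n} \<and> card e = 2")
    case True
    then obtain u v where "e = {u, v}" by (auto simp: card_2_iff)
    then show ?thesis using adj[of u v] True by auto
  next
    case False
    then show ?thesis using I n by (auto simp: instances_def simple_graph_def)
  qed
  then have "E = E'" by blast
  then show "x = y" using n k xy by simp
qed

lemma on_codes_encode: "x \<in> instances \<Longrightarrow> on_codes F (encode x) = F x"
  by (simp add: on_codes_def inj_on_encode)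

end

theory Submission
  imports Defs "HOL-Combinatorics.Multiset_Permutations"
begin

text \<open>
  The number \<open>F\<close> of \<open>k\<close>-sets of vertices that induce an even (odd) number of edges is either 0 or
  at least a fraction \<open>1 / (n + 1)\<^sup>2\<close> of all \<open>k\<close>-sets.  Indeed, the parity of the number of edges
  induced by \<open>U\<close> is a polynomial of degree 2 over the field with two elements in the coordinates of
  the indicator of \<open>U\<close>.  Comparing the values at \<open>S \<union> {i}\<close> and \<open>S \<union> {j}\<close> lowers the degree by 1, and
  a function that is not constant on the \<open>k\<close>-sets has some such difference that is not zero.  By
  induction on the degree, a function of degree \<open>d\<close> that is true somewhere is true on at least
  \<open>(n - 2 * d) choose (k - d)\<close> of the \<open>k\<close>-sets if \<open>d \<le> k \<le> n - d\<close> (\<open>low_degree_many_nonzeros\<close>, \<open>parity_density\<close>).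

  Therefore Monte Carlo sampling works.  A bounded number of fair coin flips does not in general
  produce an exactly uniform \<open>k\<close>-set, but it produces a uniform \<open>k\<close>-tuple of numbers below \<open>2 ^ b\<close>,
  where \<open>b\<close> is least with \<open>n \<le> 2 ^ b\<close>.  Call the tuple a hit if it lists the elements of a set that
  is to be counted.  Every such set is listed by \<open>k!\<close> tuples (\<open>card_hits\<close>), so the probability of
  a hit is \<open>p = k! * F / 2 ^ (b * k)\<close>; and since \<open>2 ^ b \<le> 2 * n\<close> and \<open>(n / k) ^ k \<le> n choose k\<close>, it
  is either 0 or at least \<open>1 / ((2 * k) ^ k * (n + 1)\<^sup>2)\<close> (\<open>hit_probability_lower_bound\<close>).  With
  \<open>j\<close> and \<open>l\<close> least such that \<open>2 ^ -j \<le> \<epsilon>\<close> and \<open>2 ^ -l \<le> \<delta>\<close>, Hoeffding's inequality shows that the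
  frequency of hits among \<open>(2 * k) ^ (2 * k) * (n + 1) ^ 4 * 4 ^ j * (l + 1)\<close> samples has relative
  error at most \<open>\<epsilon>\<close> with probability at least \<open>1 - \<delta>\<close> (\<open>samples_suffice\<close>).  The number of samples
  is a function of \<open>k\<close> times a polynomial in \<open>n\<close>, \<open>1 / \<epsilon>\<close> and \<open>log (1 / \<delta>)\<close>.

  To turn this into a program, all coins are flipped first and collected in the binary digits of
  one number \<open>R\<close>.  The rest of the computation is a deterministic function of \<open>R\<close>, written in a small
  language of arithmetic expressions with bounded sums and products.  One theorem about its compiler
  (\<open>compile_correct\<close>) yields both correctness and running time: the time is polynomial in any number
  that bounds the lengths of all loops and the numbers of binary digits of all intermediate values.
  The analysis of running time thus reduces to bounding values.
\<close>

section \<open>Density of the sets of a given parity\<close>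

definition slice :: "'a set \<Rightarrow> nat \<Rightarrow> 'a set set" where
  "slice V k = {S. S \<subseteq> V \<and> card S = k}"

text \<open>
  The functions on \<open>k\<close>-sets that are given by polynomials of degree at most \<open>d\<close> over the field with
  two elements have this property: replacing the coordinates \<open>(x\<^sub>i, x\<^sub>j)\<close> by \<open>(1, 0)\<close> and by \<open>(0, 1)\<close>
  and subtracting cancels the monomials without \<open>x\<^sub>i\<close> and \<open>x\<^sub>j\<close> and those with both.
\<close>

primrec low_degree :: "nat \<Rightarrow> 'a set \<Rightarrow> nat \<Rightarrow> ('a set \<Rightarrow> bool) \<Rightarrow> bool" where
  "low_degree 0 V k f \<longleftrightarrow> (\<forall>S\<in>slice V k. \<forall>T\<in>slice V k. f S = f T)"
| "low_degree (Suc d) V k f \<longleftrightarrow>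
     (\<forall>i\<in>V. \<forall>j\<in>V. i \<noteq> j \<longrightarrow>
        low_degree d (V - {i, j}) (k - 1) (\<lambda>S. f (insert i S) \<noteq> f (insert j S)))"

lemma finite_slice: "finite V \<Longrightarrow> finite (slice V k)"
  by (auto simp: slice_def)

lemma card_slice: "finite V \<Longrightarrow> card (slice V k) = card V choose k"
  unfolding slice_def by (rule n_subsets)

text \<open>
  The set \<open>A\<close> can be turned into \<open>B\<close> by exchanging one element at a time, and some exchange on the
  way changes the value of \<open>f\<close>.
\<close>

lemma exchange_changes_value:
  assumes "finite V" "A \<in> slice V k" "B \<in> slice V k" "f A \<noteq> f B"
  obtains i j S where "i \<in> V" "j \<in> V" "i \<noteq> j" "S \<in> slice (V - {i, j}) (k - 1)"
    "f (insert i S) \<noteq> f (insert j S)"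
proof -
  have "\<exists>i\<in>V. \<exists>j\<in>V. i \<noteq> j \<and> (\<exists>S\<in>slice (V - {i, j}) (k - 1). f (insert i S) \<noteq> f (insert j S))"
    using assms(2,4)
  proof (induction "card (A - B)" arbitrary: A rule: less_induct)
    case less
    have fin: "finite A" "finite B" and sub: "A \<subseteq> V" "B \<subseteq> V" and card: "card A = k" "card B = k"
      using less.prems assms(1,3) by (auto simp: slice_def intro: finite_subset)
    have "A \<noteq> B" using less.prems by blast
    then have "A - B \<noteq> {}" "B - A \<noteq> {}"
      using card fin card_subset_eq[of A B] card_subset_eq[of B A] by auto
    then obtain i j where ij: "i \<in> A" "i \<notin> B" "j \<in> B" "j \<notin> A" by blast
    let ?S = "A - {i}"
    have S: "?S \<in> slice (V - {i, j}) (k - 1)" "insert i ?S = A"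
      using ij sub card fin by (auto simp: slice_def)
    show ?case
    proof (cases "f A = f (insert j ?S)")
      case False
      then show ?thesis using ij sub S by (intro bexI[of _ i] bexI[of _ j] conjI bexI[of _ ?S]) auto
    next
      case True
      have "insert j ?S - B = (A - B) - {i}" using ij by auto
      then have "card (insert j ?S - B) < card (A - B)"
        using ij fin by (metis DiffI card_Diff1_less finite_Diff)
      moreover have "insert j ?S \<in> slice V k"
        using ij sub card fin card_Suc_Diff1[of A i] by (auto simp: slice_def)
      ultimately show ?thesis using less True by metis
    qed
  qed
  then show thesis using that by blast
qed

lemma binomial_step_le: "1 \<le> k \<Longrightarrow> 2 \<le> n \<Longrightarrow> (n - 2) choose (k - 1) \<le> n choose k"
proof -
  assume "1 \<le> k" "2 \<le> n"
  have "(n - 2) choose (k - 1) \<le> (n - 1) choose (k - 1)" by (intro binomial_right_mono) simp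
  also have "\<dots> \<le> n choose k" using \<open>1 \<le> k\<close> \<open>2 \<le> n\<close> by (cases n; cases k) auto
  finally show ?thesis .
qed

lemma binomial_le_binomial: "d \<le> k \<Longrightarrow> k + d \<le> n \<Longrightarrow> (n - 2 * d) choose (k - d) \<le> n choose k"
proof (induction d)
  case (Suc d)
  have "(n - 2 * d - 2) choose (k - d - 1) \<le> (n - 2 * d) choose (k - d)"
    using Suc.prems by (intro binomial_step_le) auto
  also have "\<dots> \<le> n choose k" using Suc by simp
  finally show ?case by (simp add: numeral_2_eq_2)
qed simp

text \<open>
  If \<open>f\<close> is constant, it is true on all \<open>k\<close>-sets.  Otherwise some difference of \<open>f\<close>, for a swap of \<open>i\<close>
  and \<open>j\<close>, is true somewhere.  It has degree \<open>d - 1\<close> and lives on the \<open>(k - 1)\<close>-subsets of a set with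
  two elements fewer, and wherever it is true at \<open>S\<close>, one of \<open>S \<union> {i}\<close> and \<open>S \<union> {j}\<close> satisfies \<open>f\<close>.
\<close>

theorem low_degree_many_nonzeros:
  assumes "finite V" "low_degree d V k f" "A \<in> slice V k" "f A" "d \<le> k" "k + d \<le> card V"
  shows "(card V - 2 * d) choose (k - d) \<le> card {S \<in> slice V k. f S}"
  using assms
proof (induction d arbitrary: V k f A)
  case 0
  then have "{S \<in> slice V k. f S} = slice V k" unfolding low_degree.simps by blast
  then show ?case using 0(1) by (simp add: card_slice)
next
  case (Suc d)
  show ?case
  proof (cases "\<exists>B\<in>slice V k. \<not> f B")
    case False
    then have "{S \<in> slice V k. f S} = slice V k" by auto
    then show ?thesis using Suc.prems(1,5,6) binomial_le_binomial[of "Suc d" k "card V"] by (simp add: card_slice)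
  next
    case True
    then obtain B where B: "B \<in> slice V k" "\<not> f B" by blast
    then have "f A \<noteq> f B" using Suc.prems(4) by simp
    then obtain i j S where ij: "i \<in> V" "j \<in> V" "i \<noteq> j" "S \<in> slice (V - {i, j}) (k - 1)"
      "f (insert i S) \<noteq> f (insert j S)"
      by (rule exchange_changes_value[OF Suc.prems(1,3) B(1)])
    let ?V = "V - {i, j}" and ?g = "\<lambda>S. f (insert i S) \<noteq> f (insert j S)"
    have cardV: "card ?V = card V - 2" using ij Suc.prems(1) by (simp add: card_Diff_subset)
    have "(card V - 2 * Suc d) choose (k - Suc d) = (card ?V - 2 * d) choose (k - 1 - d)"
      by (simp add: cardV)
    also have "\<dots> \<le> card {S \<in> slice ?V (k - 1). ?g S}"
    proof (rule Suc.IH)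
      show "low_degree d ?V (k - 1) ?g" using Suc.prems(2) ij(1-3) by simp
      show "k - 1 + d \<le> card ?V" using Suc.prems(5,6) cardV by linarith
    qed (use Suc.prems(1,5) ij(4,5) in auto)
    also have "\<dots> \<le> card {S \<in> slice V k. f S}"
    proof (rule card_inj_on_le)
      \<comment> \<open>Removing \<open>i\<close> and \<open>j\<close> recovers \<open>S\<close> from its image.\<close>
      let ?h = "\<lambda>S. if f (insert i S) then insert i S else insert j S"
      show "inj_on ?h {S \<in> slice ?V (k - 1). ?g S}"
      proof (rule inj_on_inverseI[where g = "\<lambda>S. S - {i, j}"])
        show "?h S - {i, j} = S" if "S \<in> {S \<in> slice ?V (k - 1). ?g S}" for S
          using that by (auto simp: slice_def)
      qed
      show "?h ` {S \<in> slice ?V (k - 1). ?g S} \<subseteq> {S \<in> slice V k. f S}"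
      proof (rule image_subsetI)
        fix S assume "S \<in> {S \<in> slice ?V (k - 1). ?g S}"
        then have S: "S \<in> slice ?V (k - 1)" "?g S" by auto
        then have "finite S" "i \<notin> S" "j \<notin> S" "S \<subseteq> V" "card S = k - 1"
          using Suc.prems(1) by (auto simp: slice_def intro: finite_subset)
        then show "?h S \<in> {S \<in> slice V k. f S}"
          using ij S(2) Suc.prems(5) by (auto simp: slice_def)
      qed
      show "finite {S \<in> slice V k. f S}" using Suc.prems(1) by (simp add: finite_slice)
    qed
    finally show ?thesis .
  qed
qed

lemma induced_edges_insert:
  assumes "simple_graph V E" "U \<subseteq> V" "i \<in> V" "i \<notin> U"
  shows "card (induced_edges E (insert i U)) = card (induced_edges E U) + card {v \<in> U. {i, v} \<in> E}"
proof -
  have fin: "finite U" "finite E"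
    using assms by (auto simp: simple_graph_def intro: finite_subset[of _ V] finite_subset[of E "Pow V"])
  have split: "induced_edges E (insert i U) = induced_edges E U \<union> (\<lambda>v. {i, v}) ` {v \<in> U. {i, v} \<in> E}"
  proof (intro equalityI subsetI)
    fix e assume e: "e \<in> induced_edges E (insert i U)"
    then obtain x y where "e = {x, y}" "x \<noteq> y" "e \<in> E" "e \<subseteq> insert i U"
      using assms(1) by (auto simp: induced_edges_def simple_graph_def card_2_iff)
    then show "e \<in> induced_edges E U \<union> (\<lambda>v. {i, v}) ` {v \<in> U. {i, v} \<in> E}"
      by (auto simp: induced_edges_def image_iff doubleton_eq_iff insert_commute)
  qed (auto simp: induced_edges_def)
  have "inj_on (\<lambda>v. {i, v}) {v \<in> U. {i, v} \<in> E}" by (auto simp: inj_on_def doubleton_eq_iff)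
  moreover have "induced_edges E U \<inter> (\<lambda>v. {i, v}) ` {v \<in> U. {i, v} \<in> E} = {}"
    using assms(4) by (auto simp: induced_edges_def)
  ultimately show ?thesis
    unfolding split using fin by (subst card_Un_disjoint) (auto simp: card_image induced_edges_def)
qed

text \<open>
  The first difference for \<open>i\<close> and \<open>j\<close> is the parity of the number of neighbours of \<open>i\<close> in \<open>S\<close> plus
  that of \<open>j\<close>; the second difference for \<open>a\<close> and \<open>b\<close> depends only on which of \<open>i\<close>, \<open>j\<close> are adjacent
  to which of \<open>a\<close>, \<open>b\<close>.
\<close>

lemma parity_low_degree:
  assumes "simple_graph V E" "2 \<le> k"
  shows "low_degree 2 V k (\<lambda>U. even (card (induced_edges E U)) = q)"
proof -
  let ?f = "\<lambda>U. even (card (induced_edges E U)) = q"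
  define N where "N i S = card {v \<in> S. {i, v} \<in> E}" for i S
  have N_insert: "N i (insert a S) = N i S + of_bool ({i, a} \<in> E)" if "finite S" "a \<notin> S" for i a S
  proof -
    have "{v \<in> insert a S. {i, v} \<in> E} = (if {i, a} \<in> E then insert a else id) {v \<in> S. {i, v} \<in> E}"
      by auto
    then show ?thesis using that by (simp add: N_def)
  qed
  have diff: "(?f (insert i S) \<noteq> ?f (insert j S)) \<longleftrightarrow> odd (N i S + N j S)"
    if "S \<subseteq> V - {i, j}" "i \<in> V" "j \<in> V" for i j S
  proof -
    have "S \<subseteq> V" "i \<notin> S" "j \<notin> S" using that by auto
    then have "card (induced_edges E (insert i S)) = card (induced_edges E S) + N i S"
      "card (induced_edges E (insert j S)) = card (induced_edges E S) + N j S"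
      unfolding N_def using that by (intro induced_edges_insert[OF assms(1)]; simp)+
    then show ?thesis by (simp only:) auto
  qed
  have "low_degree 0 (V - {i, j} - {a, b}) (k - 1 - 1)
     (\<lambda>T. (?f (insert i (insert a T)) \<noteq> ?f (insert j (insert a T))) \<noteq>
          (?f (insert i (insert b T)) \<noteq> ?f (insert j (insert b T))))" (is "low_degree 0 ?W _ ?g")
    if "i \<in> V" "j \<in> V" "i \<noteq> j" "a \<in> V - {i, j}" "b \<in> V - {i, j}" "a \<noteq> b" for i j a b
  proof -
    have "?g T \<longleftrightarrow> odd (of_bool ({i, a} \<in> E) + of_bool ({j, a} \<in> E) +
                          of_bool ({i, b} \<in> E) + of_bool ({j, b} \<in> E) :: nat)"
      if T: "T \<subseteq> ?W" for T
    proof -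
      have "finite T" "a \<notin> T" "b \<notin> T"
        using T assms(1) by (auto simp: simple_graph_def intro: finite_subset)
      note N = N_insert[OF this(1,2)] N_insert[OF this(1,3)]
      have T': "insert a T \<subseteq> V - {i, j}" "insert b T \<subseteq> V - {i, j}"
        using T \<open>a \<in> _\<close> \<open>b \<in> _\<close> by auto
      have parity: "(odd (x + p + (y + q)) \<noteq> odd (x + r + (y + s))) \<longleftrightarrow> odd (p + q + r + s)"
        for x y p q r s :: nat
        by presburger
      show ?thesis
        unfolding diff[OF T'(1) \<open>i \<in> V\<close> \<open>j \<in> V\<close>] diff[OF T'(2) \<open>i \<in> V\<close> \<open>j \<in> V\<close>] N
        by (rule parity)
    qed
    then show ?thesis by (simp add: slice_def)
  qed
  then show ?thesis unfolding numeral_2_eq_2 low_degree.simps(2) by blast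
qed

text \<open>
  This is \<open>k * (n - k) * (n choose k) = n * (n - 1) * ((n - 2) choose (k - 1))\<close> together with
  \<open>n - 1 \<le> k * (n - k)\<close>.
\<close>

lemma binomial_le_mult_binomial:
  assumes "1 \<le> k" "k < n"
  shows "n choose k \<le> n * ((n - 2) choose (k - 1))"
proof -
  obtain l p where lp: "k = Suc l" "n = Suc (Suc (l + p))"
    using assms by (metis One_nat_def Suc_le_D add_Suc less_iff_Suc_add)
  let ?C = "Suc (l + p) choose l"
  have "Suc (l + p) * (n choose k) \<le> (Suc l * Suc p) * (n choose k)"
    by (intro mult_right_mono) auto
  also have "\<dots> = Suc p * (Suc l * (n choose k))" by (simp only: mult_ac)
  also have "Suc l * (n choose k) = n * ?C"
    unfolding lp by (rule Suc_times_binomial)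
  also have "Suc p * (n * ?C) = n * (Suc p * ?C)" by (simp only: mult_ac)
  also have "Suc p * ?C = Suc (l + p) * ((l + p) choose l)"
    using binomial_absorb_comp[of "Suc (l + p)" l] by (simp add: Suc_diff_le)
  also have "n * \<dots> = Suc (l + p) * (n * ((l + p) choose l))" by (simp only: mult_ac)
  finally have "n choose k \<le> n * ((l + p) choose l)" by (subst (asm) Suc_mult_le_cancel1)
  then show ?thesis by (simp add: lp)
qed

text \<open>
  For \<open>2 \<le> k \<le> n - 2\<close> the bound for degree 2 is compared with \<open>n choose k\<close> by applying the previous
  lemma twice; in the remaining cases \<open>n choose k\<close> is at most \<open>n + 1\<close>, and one set suffices.
\<close>

theorem parity_density:
  assumes G: "simple_graph V E" and U: "U \<in> slice V k" "even (card (induced_edges E U)) = q"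
  shows "card V choose k \<le> (card V + 1) ^ 2 * card {S \<in> slice V k. even (card (induced_edges E S)) = q}"
    (is "_ \<le> _ * card ?F")
proof -
  let ?n = "card V"
  have fin: "finite V" using G by (simp add: simple_graph_def)
  have "k \<le> ?n" using U fin by (auto simp: slice_def intro: card_mono)
  show ?thesis
  proof (cases "2 \<le> k \<and> k + 2 \<le> ?n")
    case True
    have "?n choose k \<le> ?n * ((?n - 2) choose (k - 1))"
      using True by (intro binomial_le_mult_binomial) auto
    also have "\<dots> \<le> ?n * ((?n - 2) * ((?n - 2 - 2) choose (k - 1 - 1)))"
      using True by (intro mult_left_mono binomial_le_mult_binomial) auto
    also have "\<dots> \<le> (?n + 1) ^ 2 * ((?n - 2 * 2) choose (k - 2))"
    proof -
      have "?n * (?n - 2) \<le> (?n + 1) ^ 2" unfolding power2_eq_square by (intro mult_le_mono) auto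
      then have "?n * (?n - 2) * ((?n - 2 - 2) choose (k - 1 - 1)) \<le>
        (?n + 1) ^ 2 * ((?n - 2 - 2) choose (k - 1 - 1))"
        by (rule mult_right_mono) simp
      moreover have "?n - 2 - 2 = ?n - 2 * 2" "k - 1 - 1 = k - 2" by simp_all
      ultimately show ?thesis by (simp only: mult.assoc)
    qed
    also have "\<dots> \<le> (?n + 1) ^ 2 * card ?F"
      using True low_degree_many_nonzeros[OF fin parity_low_degree[OF G] U]
      by (intro mult_left_mono) auto
    finally show ?thesis .
  next
    case False
    have "?n choose k \<le> ?n + 1"
    proof -
      have "k = 0 \<or> k = 1 \<or> ?n - k = 0 \<or> ?n - k = 1" using False \<open>k \<le> ?n\<close> by linarith
      then show ?thesis using binomial_symmetric[OF \<open>k \<le> ?n\<close>] by auto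
    qed
    also have "\<dots> \<le> (?n + 1) ^ 2" by (simp add: power2_eq_square)
    also have "\<dots> \<le> (?n + 1) ^ 2 * card ?F"
    proof -
      have "0 < card ?F" using U fin by (auto simp: card_gt_0_iff finite_slice)
      then show ?thesis by simp
    qed
    finally show ?thesis .
  qed
qed


section \<open>Total correctness with a time bound\<close>

definition achieves ::
  "word \<Rightarrow> (nat \<Rightarrow> real) \<Rightarrow> com \<Rightarrow> mem \<Rightarrow> nat \<Rightarrow> (mem \<Rightarrow> bool) \<Rightarrow> bool" where
  "achieves w r c m T Q \<longleftrightarrow> (\<exists>m' t. exec w r c m = return_spmf (m', t) \<and> t \<le> T \<and> Q m')"

lemma achievesE:
  assumes "achieves w r c m T Q"
  obtains m' t where "exec w r c m = return_spmf (m', t)" "t \<le> T" "Q m'"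
  using assms by (auto simp: achieves_def)

lemma achieves_weaken:
  assumes "achieves w r c m T Q" "T \<le> T'" "\<And>m'. Q m' \<Longrightarrow> Q' m'"
  shows "achieves w r c m T' Q'"
  using assms by (fastforce simp: achieves_def)

lemma achieves_Store:
  assumes "1 + acost w a m + acost w b m \<le> T" "Q (m(aval w a m := aval w b m))"
  shows "achieves w r (Store a b) m T Q"
  using assms by (simp add: achieves_def)

lemma achieves_Query:
  assumes "1 + acost w d m + acost w a m + acost w j m + aval w j m \<le> T"
    and "Q (m(aval w d m := of_bool (real (aval w a m) \<le> 2 ^ aval w j m * r i)))"
  shows "achieves w r (Query i d a j) m T Q"
  using assms by (simp add: achieves_def)

lemma achieves_Seq:
  assumes "achieves w r c1 m S P" "\<And>m1. P m1 \<Longrightarrow> achieves w r c2 m1 S' Q" "S + S' \<le> T"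
  shows "achieves w r (Seq c1 c2) m T Q"
proof -
  obtain m1 t1 where 1: "exec w r c1 m = return_spmf (m1, t1)" "t1 \<le> S" "P m1"
    using assms(1) by (elim achievesE)
  obtain m2 t2 where 2: "exec w r c2 m1 = return_spmf (m2, t2)" "t2 \<le> S'" "Q m2"
    using assms(2)[OF 1(3)] by (elim achievesE)
  show ?thesis using 1 2 assms(3) by (auto simp: achieves_def)
qed

text \<open>
  The invariant is indexed by the number of completed iterations.  It may leave open the contents of
  cells that the loop uses as scratch space.
\<close>

lemma achieves_While:
  assumes step: "\<And>i m. i < n \<Longrightarrow> P i m \<Longrightarrow> aval w a m \<noteq> 0 \<and> achieves w r c m T (P (Suc i))"
    and stop: "\<And>m. P n m \<Longrightarrow> aval w a m = 0"
    and guard: "\<And>i m. i \<le> n \<Longrightarrow> P i m \<Longrightarrow> acost w a m \<le> G"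
    and init: "P 0 m"
  shows "achieves w r (While a c) m (Suc n * (1 + G + T)) (P n)"
proof -
  have "achieves w r (While a c) m (Suc (n - i) * (1 + G + T)) (P n)" if "P i m" "i \<le> n" for i m
    using that
  proof (induction "n - i" arbitrary: i m)
    case 0
    then have "i = n" by simp
    with 0 stop[of m] guard[of n m] show ?case
      by (subst achieves_def) (simp add: loop.simps)
  next
    case (Suc l)
    then have i: "i < n" by simp
    obtain m1 t1 where 1: "exec w r c m = return_spmf (m1, t1)" "t1 \<le> T" "P (Suc i) m1"
      using step[OF i Suc.prems(1)] unfolding achieves_def by blast
    have "achieves w r (While a c) m1 (Suc (n - Suc i) * (1 + G + T)) (P n)"
      using Suc i 1 by (intro Suc.hyps(1)) auto
    then obtain m2 t2 where 2: "exec w r (While a c) m1 = return_spmf (m2, t2)"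
      "t2 \<le> Suc (n - Suc i) * (1 + G + T)" "P n m2"
      by (elim achievesE)
    have "exec w r (While a c) m = return_spmf (m2, 1 + acost w a m + t1 + t2)"
      using step[OF i Suc.prems(1)] 1 2 by (simp add: loop.simps[of _ _ _ m])
    moreover have "1 + acost w a m + t1 + t2 \<le> Suc (n - i) * (1 + G + T)"
      using guard[OF Suc.prems(2,1)] 1 2 Suc_diff_Suc[OF i, symmetric] by simp
    ultimately show ?case using 2 by (auto simp: achieves_def)
  qed
  from this[of 0 m] init show ?thesis by simp
qed


section \<open>Polynomially bounded functions\<close>

definition poly_bounded :: "(nat \<Rightarrow> nat) \<Rightarrow> bool" where
  "poly_bounded T \<longleftrightarrow> (\<exists>C d. \<forall>B. T B \<le> C * (B + 1) ^ d)"

lemma poly_bounded_const: "poly_bounded (\<lambda>_. c)"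
  unfolding poly_bounded_def by (intro exI[of _ c] exI[of _ 0]) simp

lemma poly_bounded_id: "poly_bounded (\<lambda>B. B)"
  unfolding poly_bounded_def by (intro exI[of _ 1]) simp

lemma poly_bounded_add:
  assumes "poly_bounded S" "poly_bounded T"
  shows "poly_bounded (\<lambda>B. S B + T B)"
proof -
  obtain C d C' d' where "\<forall>B. S B \<le> C * (B + 1) ^ d" "\<forall>B. T B \<le> C' * (B + 1) ^ d'"
    using assms by (auto simp: poly_bounded_def)
  moreover have "C * (B + 1) ^ d \<le> C * (B + 1) ^ (d + d')"
    "C' * (B + 1) ^ d' \<le> C' * (B + 1) ^ (d + d')" for B :: nat
    by (intro mult_left_mono power_increasing; simp)+
  ultimately have "S B + T B \<le> (C + C') * (B + 1) ^ (d + d')" for B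
    unfolding distrib_right by (meson add_mono order_trans)
  then show ?thesis by (auto simp: poly_bounded_def)
qed

lemma poly_bounded_mult:
  assumes "poly_bounded S" "poly_bounded T"
  shows "poly_bounded (\<lambda>B. S B * T B)"
proof -
  obtain C d C' d' where "\<forall>B. S B \<le> C * (B + 1) ^ d" "\<forall>B. T B \<le> C' * (B + 1) ^ d'"
    using assms by (auto simp: poly_bounded_def)
  then have "S B * T B \<le> (C * (B + 1) ^ d) * (C' * (B + 1) ^ d')" for B
    by (meson mult_le_mono)
  then have "S B * T B \<le> (C * C') * (B + 1) ^ (d + d')" for B
    by (simp add: power_add algebra_simps)
  then show ?thesis unfolding poly_bounded_def by blast
qed

lemmas poly_bounded_intros =
  poly_bounded_const poly_bounded_id poly_bounded_add poly_bounded_mult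


section \<open>A language of bounded sums and products\<close>

datatype bop = Plus | Minus | Times | Over

primrec op_val :: "bop \<Rightarrow> nat \<Rightarrow> nat \<Rightarrow> nat" where
  "op_val Plus = (+)"
| "op_val Minus = (-)"
| "op_val Times = (*)"
| "op_val Over = (div)"

primrec op_aexp :: "bop \<Rightarrow> aexp \<Rightarrow> aexp \<Rightarrow> aexp" where
  "op_aexp Plus = Add"
| "op_aexp Minus = Sub"
| "op_aexp Times = Mul"
| "op_aexp Over = Div"

lemma aval_op_aexp [simp]: "aval w (op_aexp f a b) m = op_val f (aval w a m) (aval w b m)"
  by (cases f) simp_all

lemma acost_op_aexp [simp]:
  "acost w (op_aexp f a b) m =
     1 + floorlog 2 (op_val f (aval w a m) (aval w b m)) + acost w a m + acost w b m"
  by (cases f) simp_all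

text \<open>
  Variables are de Bruijn indices: \<open>Var 0\<close> is the index of the innermost enclosing sum or product.
  The real arguments are accessible only through \<open>Places i\<close>, the least \<open>j\<close> for which argument \<open>i\<close>
  is at least \<open>2 ^ -j\<close>; this is all that the choice of a sample size needs, and it can be found by
  testing \<open>1 \<le> 2 ^ j * r i\<close> for increasing \<open>j\<close>.
\<close>

datatype expr =
    Num nat
  | Var nat
  | Len
  | Sym expr
  | Bin bop expr expr
  | Sum expr expr
  | Prod expr expr
  | Places nat

primrec eval :: "word \<Rightarrow> (nat \<Rightarrow> real) \<Rightarrow> expr \<Rightarrow> nat list \<Rightarrow> nat" where
  "eval w r (Num c) env = c"
| "eval w r (Var j) env = env ! j"
| "eval w r Len env = length w"
| "eval w r (Sym a) env = (if eval w r a env < length w then w ! eval w r a env else 0)"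
| "eval w r (Bin f a b) env = op_val f (eval w r a env) (eval w r b env)"
| "eval w r (Sum a e) env = (\<Sum>i<eval w r a env. eval w r e (i # env))"
| "eval w r (Prod a e) env = (\<Prod>i<eval w r a env. eval w r e (i # env))"
| "eval w r (Places i) env = (LEAST j. 1 \<le> 2 ^ j * r i)"

text \<open>
  A single number \<open>B\<close> bounds the lengths of loops and the numbers of binary digits of values.  For sums
  and products the partial results are bounded as well, because they occur in the accumulator; a
  partial product can exceed the final one if a later factor is 0.
\<close>

primrec fits :: "nat \<Rightarrow> word \<Rightarrow> (nat \<Rightarrow> real) \<Rightarrow> expr \<Rightarrow> nat list \<Rightarrow> bool" where
  "fits B w r (Num c) env \<longleftrightarrow> c < 2 ^ B"
| "fits B w r (Var j) env \<longleftrightarrow> j < length env \<and> env ! j < 2 ^ B"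
| "fits B w r Len env \<longleftrightarrow> length w < 2 ^ B"
| "fits B w r (Sym a) env \<longleftrightarrow> fits B w r a env \<and> eval w r (Sym a) env < 2 ^ B"
| "fits B w r (Bin f a b) env \<longleftrightarrow>
     fits B w r a env \<and> fits B w r b env \<and> eval w r (Bin f a b) env < 2 ^ B"
| "fits B w r (Sum a e) env \<longleftrightarrow>
     fits B w r a env \<and> eval w r a env \<le> B \<and> (\<forall>i<eval w r a env. fits B w r e (i # env)) \<and>
     (\<forall>n\<le>eval w r a env. (\<Sum>i<n. eval w r e (i # env)) < 2 ^ B)"
| "fits B w r (Prod a e) env \<longleftrightarrow>
     fits B w r a env \<and> eval w r a env \<le> B \<and> (\<forall>i<eval w r a env. fits B w r e (i # env)) \<and>
     (\<forall>n\<le>eval w r a env. (\<Prod>i<n. eval w r e (i # env)) < 2 ^ B)"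
| "fits B w r (Places i) env \<longleftrightarrow> 0 < r i \<and> eval w r (Places i) env \<le> B"

lemma fits_less: "fits B w r e env \<Longrightarrow> eval w r e env < 2 ^ B"
  by (cases e) (auto intro: le_less_trans less_exp)

text \<open>
  Cell \<open>d\<close> is the accumulator, cell \<open>d + 1\<close> the loop index and cell \<open>d + 2\<close> the number of iterations;
  the body leaves its value in cell \<open>d + 3\<close>.
\<close>

definition fold_com :: "bop \<Rightarrow> nat \<Rightarrow> com \<Rightarrow> com \<Rightarrow> nat \<Rightarrow> com" where
  "fold_com f u cn ce d =
     Seq cn
    (Seq (Store (Const d) (Const u))
    (Seq (Store (Const (d + 1)) (Const 0))
         (While (Sub (Mem (Const (d + 2))) (Mem (Const (d + 1))))
           (Seq ce
           (Seq (Store (Const d) (op_aexp f (Mem (Const d)) (Mem (Const (d + 3)))))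
                (Store (Const (d + 1)) (Add (Mem (Const (d + 1))) (Const 1))))))))"

definition places_com :: "nat \<Rightarrow> nat \<Rightarrow> com" where
  "places_com i d =
     Seq (Store (Const d) (Const 0))
    (Seq (Query i (Const (d + 1)) (Const 1) (Mem (Const d)))
         (While (Sub (Const 1) (Mem (Const (d + 1))))
           (Seq (Store (Const d) (Add (Mem (Const d)) (Const 1)))
                (Query i (Const (d + 1)) (Const 1) (Mem (Const d))))))"

text \<open>
  The list \<open>\<rho>\<close> holds the cells in which the variables live, cells from \<open>d\<close> on are free, and the
  result is left in cell \<open>d\<close>.
\<close>

primrec compile :: "expr \<Rightarrow> nat list \<Rightarrow> nat \<Rightarrow> com" where
  "compile (Num c) \<rho> d = Store (Const d) (Const c)"
| "compile (Var j) \<rho> d = Store (Const d) (Mem (Const (\<rho> ! j)))"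
| "compile Len \<rho> d = Store (Const d) InputLength"
| "compile (Sym a) \<rho> d = Seq (compile a \<rho> d) (Store (Const d) (Input (Mem (Const d))))"
| "compile (Bin f a b) \<rho> d =
     Seq (compile a \<rho> d) (Seq (compile b \<rho> (d + 1))
       (Store (Const d) (op_aexp f (Mem (Const d)) (Mem (Const (d + 1))))))"
| "compile (Sum a e) \<rho> d =
     fold_com Plus 0 (compile a \<rho> (d + 2)) (compile e ((d + 1) # \<rho>) (d + 3)) d"
| "compile (Prod a e) \<rho> d =
     fold_com Times 1 (compile a \<rho> (d + 2)) (compile e ((d + 1) # \<rho>) (d + 3)) d"
| "compile (Places i) \<rho> d = places_com i d"

definition computes ::
  "word \<Rightarrow> (nat \<Rightarrow> real) \<Rightarrow> com \<Rightarrow> mem \<Rightarrow> nat \<Rightarrow> nat \<Rightarrow> nat \<Rightarrow> bool" where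
  "computes w r c m T d v \<longleftrightarrow> achieves w r c m T (\<lambda>m'. m' d = v \<and> (\<forall>j<d. m' j = m j))"

lemma floorlog_le_self: "floorlog 2 d \<le> d"
  by (simp add: floorlog_le_iff)

lemma floorlog_le_bits: "x < 2 ^ B \<Longrightarrow> floorlog 2 x \<le> B"
  by (simp add: floorlog_le_iff)

text \<open>
  The constants are generous: every elementary command of the loop costs at most a small multiple of
  \<open>B + d + 4\<close>, where \<open>d + 3\<close> is the largest address used.
\<close>

lemma computes_fold:
  assumes cn: "computes w r cn m T1 (d + 2) n"
    and ce: "\<And>i m'. i < n \<Longrightarrow> (\<forall>j<d. m' j = m j) \<Longrightarrow> m' (d + 1) = i \<Longrightarrow>
               computes w r ce m' T2 (d + 3) (g i)"
    and acc: "acc 0 = u" "\<And>i. acc (Suc i) = op_val f (acc i) (g i)"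
    and small: "\<And>i. i \<le> n \<Longrightarrow> acc i < 2 ^ B" "\<And>i. i < n \<Longrightarrow> g i < 2 ^ B" "n \<le> B"
  shows "computes w r (fold_com f u cn ce d) m
           (T1 + (B + 1) * (T2 + 20 * (B + d + 4)) + u + 20 * (B + d + 4)) d (acc n)"
proof -
  note flog = floorlog_le_self[of d] floorlog_le_self[of "d + 1"] floorlog_le_self[of "d + 2"]
    floorlog_le_self[of "d + 3"] floorlog_le_self[of u]
  have fl1: "floorlog 2 (Suc 0) \<le> 1" "floorlog 2 0 = 0" by (simp_all add: floorlog_le_iff floorlog_eq_zero_iff)
  let ?P = "\<lambda>i m'. (\<forall>j<d. m' j = m j) \<and> m' d = acc i \<and> m' (d + 1) = i \<and> m' (d + 2) = n"
  let ?body = "Seq ce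
           (Seq (Store (Const d) (op_aexp f (Mem (Const d)) (Mem (Const (d + 3)))))
                (Store (Const (d + 1)) (Add (Mem (Const (d + 1))) (Const 1))))"
  let ?loop = "While (Sub (Mem (Const (d + 2))) (Mem (Const (d + 1)))) ?body"
  have body: "achieves w r ?body m' (T2 + 14 * (B + d + 4)) (?P (Suc i))" if "i < n" "?P i m'" for i m'
  proof (rule achieves_Seq[where S' = "14 * (B + d + 4)"])
    show "achieves w r ce m' T2 (\<lambda>m1. m1 (d + 3) = g i \<and> (\<forall>j<d + 3. m1 j = m' j))"
      using ce[of i m'] that by (simp add: computes_def)
    fix m1 assume m1: "m1 (d + 3) = g i \<and> (\<forall>j<d + 3. m1 j = m' j)"
    then have m1': "?P i m1" using that by simp
    have fl: "floorlog 2 (acc i) \<le> B" "floorlog 2 (acc (Suc i)) \<le> B" "floorlog 2 (g i) \<le> B"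
      "floorlog 2 (Suc i) \<le> B" "floorlog 2 i \<le> B"
      using that small(1)[of i] small(1)[of "Suc i"] small(2)[of i] small(3) floorlog_le_self[of "Suc i"]
        floorlog_le_self[of i]
      by (auto intro!: floorlog_le_bits)
    show "achieves w r (Seq (Store (Const d) (op_aexp f (Mem (Const d)) (Mem (Const (d + 3)))))
                (Store (Const (d + 1)) (Add (Mem (Const (d + 1))) (Const 1)))) m1
         (14 * (B + d + 4)) (?P (Suc i))"
    proof (rule achieves_Seq)
      show "achieves w r (Store (Const d) (op_aexp f (Mem (Const d)) (Mem (Const (d + 3))))) m1
          (7 * (B + d + 4)) (\<lambda>m2. (\<forall>j<d. m2 j = m j) \<and> m2 d = acc (Suc i) \<and> m2 (d + 1) = i \<and> m2 (d + 2) = n)"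
        using m1 m1' fl flog acc(2)[of i]
        by (intro achieves_Store) (auto)
      show "achieves w r (Store (Const (d + 1)) (Add (Mem (Const (d + 1))) (Const 1))) m2
          (7 * (B + d + 4)) (?P (Suc i))"
        if "(\<forall>j<d. m2 j = m j) \<and> m2 d = acc (Suc i) \<and> m2 (d + 1) = i \<and> m2 (d + 2) = n" for m2
        using that fl flog fl1
        by (intro achieves_Store) (auto)
    qed simp
  qed simp
  have loop: "achieves w r ?loop m' (Suc n * (1 + (3 * (B + d + 4)) + (T2 + 14 * (B + d + 4)))) (?P n)"
    if "?P 0 m'" for m'
  proof (rule achieves_While[where P = ?P])
    show "aval w (Sub (Mem (Const (d + 2))) (Mem (Const (d + 1)))) m1 \<noteq> 0 \<and>
        achieves w r ?body m1 (T2 + 14 * (B + d + 4)) (?P (Suc i))" if "i < n" "?P i m1" for i m1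
      using that body[OF that] by simp
    show "acost w (Sub (Mem (Const (d + 2))) (Mem (Const (d + 1)))) m1 \<le> 3 * (B + d + 4)"
      if "i \<le> n" "?P i m1" for i m1
    proof -
      have "floorlog 2 i \<le> B" "floorlog 2 n \<le> B" "floorlog 2 (n - i) \<le> B"
        using that small(3) floorlog_le_self[of i] floorlog_le_self[of n] floorlog_le_self[of "n - i"] by linarith+
      then show ?thesis using that flog by simp
    qed
  qed (use that in auto)
  have le: "Suc n * (1 + (3 * (B + d + 4)) + (T2 + 14 * (B + d + 4))) \<le> (B + 1) * (T2 + 20 * (B + d + 4))"
    using small(3) by (intro mult_le_mono) auto
  show ?thesis
    unfolding computes_def fold_com_def
  proof (rule achieves_Seq[where S' = "(B + 1) * (T2 + 20 * (B + d + 4)) + u + 20 * (B + d + 4)"])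
    show "achieves w r cn m T1 (\<lambda>m1. m1 (d + 2) = n \<and> (\<forall>j<d+2. m1 j = m j))"
      using cn by (simp add: computes_def)
    fix m1 assume m1: "m1 (d + 2) = n \<and> (\<forall>j<d+2. m1 j = m j)"
    show "achieves w r (Seq (Store (Const d) (Const u)) (Seq (Store (Const (d + 1)) (Const 0)) ?loop)) m1
       ((B + 1) * (T2 + 20 * (B + d + 4)) + u + 20 * (B + d + 4)) (\<lambda>m'. m' d = acc n \<and> (\<forall>j<d. m' j = m j))"
    proof (rule achieves_Seq)
      show "achieves w r (Store (Const d) (Const u)) m1 (3 + d + u)
         (\<lambda>m2. (\<forall>j<d. m2 j = m j) \<and> m2 d = u \<and> m2 (d + 2) = n)"
        using m1 flog by (intro achieves_Store) auto
      fix m2 assume m2: "(\<forall>j<d. m2 j = m j) \<and> m2 d = u \<and> m2 (d + 2) = n"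
      show "achieves w r (Seq (Store (Const (d + 1)) (Const 0)) ?loop) m2
        ((4 + d) + (B + 1) * (T2 + 20 * (B + d + 4))) (\<lambda>m'. m' d = acc n \<and> (\<forall>j<d. m' j = m j))"
      proof (rule achieves_Seq)
        show "achieves w r (Store (Const (d + 1)) (Const 0)) m2 (4 + d) (?P 0)"
          using m2 flog fl1 acc(1) by (intro achieves_Store) auto
        show "achieves w r ?loop m3 ((B + 1) * (T2 + 20 * (B + d + 4)))
           (\<lambda>m'. m' d = acc n \<and> (\<forall>j<d. m' j = m j))" if "?P 0 m3" for m3
          by (rule achieves_weaken[OF loop[OF that] le]) auto
      qed simp
    qed simp
  qed simp
qed

lemma computes_places:
  assumes "0 < r i" "(LEAST j. 1 \<le> 2 ^ j * r i) \<le> B"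
  shows "computes w r (places_com i d) m ((B + 1) * (40 * (B + d + 4)) + 40 * (B + d + 4)) d
           (LEAST j. 1 \<le> 2 ^ j * r i)"
proof -
  let ?Q = "\<lambda>j. 1 \<le> 2 ^ j * r i"
  define n where "n = (LEAST j. ?Q j)"
  have "\<exists>j. ?Q j"
  proof -
    obtain j :: nat where "1 / r i < 2 ^ j" using real_arch_pow[of 2 "1 / r i"] by auto
    then show ?thesis using assms(1) by (intro exI[of _ j]) (simp add: field_simps)
  qed
  then have Qn: "?Q n" unfolding n_def by (rule LeastI_ex)
  have Qi: "\<not> ?Q j" if "j < n" for j using that not_less_Least unfolding n_def by blast
  have nB: "n \<le> B" using assms(2) by (simp add: n_def)
  note flog = floorlog_le_self[of d] floorlog_le_self[of "d + 1"]
  have fl1: "floorlog 2 (Suc 0) \<le> 1" "floorlog 2 0 = 0"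
    by (simp_all add: floorlog_le_iff floorlog_eq_zero_iff)
  let ?P = "\<lambda>j m'. (\<forall>j<d. m' j = m j) \<and> m' d = j \<and> m' (d + 1) = of_bool (?Q j)"
  let ?q = "Query i (Const (d + 1)) (Const 1) (Mem (Const d))"
  have q: "achieves w r ?q m' (20 * (B + d + 4)) (?P j)"
    if "j \<le> n" "(\<forall>j<d. m' j = m j)" "m' d = j" for j m'
  proof (rule achieves_Query)
    show "?P j (m'(aval w (Const (d + 1)) m' :=
       of_bool (real (aval w (Const 1) m') \<le> 2 ^ aval w (Mem (Const d)) m' * r i)))"
      using that by (auto simp: algebra_simps)
    show "1 + acost w (Const (d + 1)) m' + acost w (Const 1) m' + acost w (Mem (Const d)) m' +
       aval w (Mem (Const d)) m' \<le> 20 * (B + d + 4)"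
      using that fl1 flog floorlog_le_self[of j] nB by simp
  qed
  let ?body = "Seq (Store (Const d) (Add (Mem (Const d)) (Const 1))) ?q"
  let ?loop = "While (Sub (Const 1) (Mem (Const (d + 1)))) ?body"
  have loop: "achieves w r ?loop m' (Suc n * (1 + 5 * (d + 4) + 30 * (B + d + 4))) (?P n)" if "?P 0 m'" for m'
  proof (rule achieves_While[where P = ?P])
    fix j m1 assume j: "j < n" "?P j m1"
    have "achieves w r ?body m1 (30 * (B + d + 4)) (?P (Suc j))"
    proof (rule achieves_Seq)
      show "achieves w r (Store (Const d) (Add (Mem (Const d)) (Const 1))) m1 (10 * (B + d + 4))
        (\<lambda>m'. (\<forall>j<d. m' j = m j) \<and> m' d = Suc j)"
        using j fl1 flog floorlog_le_self[of j] floorlog_le_self[of "Suc j"] nB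
        by (intro achieves_Store) auto
      show "achieves w r ?q m2 (20 * (B + d + 4)) (?P (Suc j))"
        if "(\<forall>j<d. m2 j = m j) \<and> m2 d = Suc j" for m2
        using that j by (intro q) auto
    qed simp
    then show "aval w (Sub (Const 1) (Mem (Const (d + 1)))) m1 \<noteq> 0 \<and>
      achieves w r ?body m1 (30 * (B + d + 4)) (?P (Suc j))"
      using j Qi[of j] by simp
  next
    fix j m1 assume j: "j \<le> n" "?P j m1"
    have "floorlog 2 (of_bool b) \<le> 1" "floorlog 2 (Suc 0 - of_bool b) \<le> 1" for b using fl1 by (cases b; simp)+
    from this[of "?Q j"] show "acost w (Sub (Const 1) (Mem (Const (d + 1)))) m1 \<le> 5 * (d + 4)"
      using j fl1 flog by simp
  qed (use that Qn in auto)
  have le: "Suc n * (1 + 5 * (d + 4) + 30 * (B + d + 4)) \<le> (B + 1) * (40 * (B + d + 4))"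
    using nB by (intro mult_le_mono) auto
  show ?thesis
    unfolding computes_def places_com_def n_def[symmetric]
  proof (rule achieves_Seq)
    show "achieves w r (Store (Const d) (Const 0)) m (3 + d) (\<lambda>m'. (\<forall>j<d. m' j = m j) \<and> m' d = 0)"
      using flog fl1 by (intro achieves_Store) auto
    fix m1 assume m1: "(\<forall>j<d. m1 j = m j) \<and> m1 d = 0"
    show "achieves w r (Seq ?q ?loop) m1 (20 * (B + d + 4) + (B + 1) * (40 * (B + d + 4)))
      (\<lambda>m'. m' d = n \<and> (\<forall>j<d. m' j = m j))"
    proof (rule achieves_Seq)
      show "achieves w r ?q m1 (20 * (B + d + 4)) (?P 0)"
        using m1 by (intro q) auto
      show "achieves w r ?loop m2 ((B + 1) * (40 * (B + d + 4))) (\<lambda>m'. m' d = n \<and> (\<forall>j<d. m' j = m j))"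
        if "?P 0 m2" for m2
        by (rule achieves_weaken[OF loop[OF that] le]) auto
    qed simp
  qed simp
qed

text \<open>
  The bound \<open>T\<close> depends on the expression and on the position of the free cells, but not on the input
  word, the real arguments or the values of the variables.
\<close>

theorem compile_correct:
  "\<exists>T. poly_bounded T \<and>
     (\<forall>w r B \<rho> env m. fits B w r e env \<longrightarrow> map m \<rho> = env \<longrightarrow> (\<forall>x\<in>set \<rho>. x < d) \<longrightarrow>
        computes w r (compile e \<rho> d) m (T B) d (eval w r e env))"
proof (induction e arbitrary: d)
  case (Num c)
  have "computes w r (compile (Num c) \<rho> d) m (3 + d + c) d (eval w r (Num c) env)" for w r \<rho> env m
    unfolding computes_def
    using floorlog_le_self[of d] floorlog_le_self[of c] by (auto intro!: achieves_Store)
  moreover have "poly_bounded (\<lambda>_. 3 + d + c)"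
    by (intro poly_bounded_intros)
  ultimately show ?case by blast
next
  case (Var x)
  have "computes w r (compile (Var x) \<rho> d) m (4 + d + d + B) d (eval w r (Var x) env)"
    if "fits B w r (Var x) env" "map m \<rho> = env" "\<forall>x\<in>set \<rho>. x < d" for w r \<rho> env m B
  proof -
    have x: "x < length \<rho>" "m (\<rho> ! x) < 2 ^ B" "env ! x = m (\<rho> ! x)" "\<rho> ! x < d"
      using that by auto
    then show ?thesis
      unfolding computes_def
      using floorlog_le_self[of d] floorlog_le_self[of "\<rho> ! x"] floorlog_le_bits[of "m (\<rho> ! x)" B]
      by (auto intro!: achieves_Store)
  qed
  moreover have "poly_bounded (\<lambda>B. 4 + d + d + B)"
    by (intro poly_bounded_intros)
  ultimately show ?case by blast
next
  case Len
  have "computes w r (compile Len \<rho> d) m (3 + d + B) d (eval w r Len env)"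
    if "fits B w r Len env" for w r \<rho> env m B
    unfolding computes_def
    using that floorlog_le_self[of d] floorlog_le_bits[of "length w" B] by (auto intro!: achieves_Store)
  moreover have "poly_bounded (\<lambda>B. 3 + d + B)"
    by (intro poly_bounded_intros)
  ultimately show ?case by blast
next
  case (Sym a)
  obtain T where T: "poly_bounded T" "\<And>w r B \<rho> env m. fits B w r a env \<Longrightarrow> map m \<rho> = env \<Longrightarrow>
      (\<forall>x\<in>set \<rho>. x < d) \<Longrightarrow> computes w r (compile a \<rho> d) m (T B) d (eval w r a env)"
    using Sym[of d] by blast
  have "computes w r (compile (Sym a) \<rho> d) m (T B + (5 + d + d + B + B)) d (eval w r (Sym a) env)"
    if *: "fits B w r (Sym a) env" "map m \<rho> = env" "\<forall>x\<in>set \<rho>. x < d" for w r \<rho> env m B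
    unfolding computes_def compile.simps
  proof (rule achieves_Seq)
    show "achieves w r (compile a \<rho> d) m (T B) (\<lambda>m'. m' d = eval w r a env \<and> (\<forall>j<d. m' j = m j))"
      using T(2)[of B w r env m \<rho>] * by (simp add: computes_def)
    fix m1 assume "m1 d = eval w r a env \<and> (\<forall>j<d. m1 j = m j)"
    then show "achieves w r (Store (Const d) (Input (Mem (Const d)))) m1 (5 + d + d + B + B)
       (\<lambda>m'. m' d = eval w r (Sym a) env \<and> (\<forall>j<d. m' j = m j))"
      using floorlog_le_self[of d] floorlog_le_bits[OF fits_less[OF *(1)]]
        floorlog_le_bits[OF fits_less[of B w r a env]] *
      by (intro achieves_Store) auto
  qed simp
  moreover have "poly_bounded (\<lambda>B. T B + (5 + d + d + B + B))"
    by (intro poly_bounded_intros T(1))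
  ultimately show ?case by blast
next
  case (Bin f a b)
  obtain T where T: "poly_bounded T" "\<And>w r B \<rho> env m. fits B w r a env \<Longrightarrow> map m \<rho> = env \<Longrightarrow>
      (\<forall>x\<in>set \<rho>. x < d) \<Longrightarrow> computes w r (compile a \<rho> d) m (T B) d (eval w r a env)"
    using Bin(1)[of d] by blast
  obtain T' where T': "poly_bounded T'" "\<And>w r B \<rho> env m. fits B w r b env \<Longrightarrow> map m \<rho> = env \<Longrightarrow>
      (\<forall>x\<in>set \<rho>. x < d + 1) \<Longrightarrow> computes w r (compile b \<rho> (d + 1)) m (T' B) (d + 1) (eval w r b env)"
    using Bin(2)[of "d + 1"] by blast
  have "computes w r (compile (Bin f a b) \<rho> d) m (T B + (T' B + 10 * (d + B + 1))) d (eval w r (Bin f a b) env)"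
    if *: "fits B w r (Bin f a b) env" "map m \<rho> = env" "\<forall>x\<in>set \<rho>. x < d" for w r \<rho> env m B
    unfolding computes_def compile.simps
  proof (rule achieves_Seq)
    show "achieves w r (compile a \<rho> d) m (T B) (\<lambda>m'. m' d = eval w r a env \<and> (\<forall>j<d. m' j = m j))"
      using T(2)[of B w r env m \<rho>] * by (simp add: computes_def)
    fix m1 assume m1: "m1 d = eval w r a env \<and> (\<forall>j<d. m1 j = m j)"
    have env: "map m1 \<rho> = env" using m1 * by auto
    show "achieves w r (Seq (compile b \<rho> (d + 1))
       (Store (Const d) (op_aexp f (Mem (Const d)) (Mem (Const (d + 1)))))) m1 (T' B + 10 * (d + B + 1))
       (\<lambda>m'. m' d = eval w r (Bin f a b) env \<and> (\<forall>j<d. m' j = m j))"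
    proof (rule achieves_Seq)
      show "achieves w r (compile b \<rho> (d + 1)) m1 (T' B)
         (\<lambda>m'. m' (d + 1) = eval w r b env \<and> (\<forall>j<d + 1. m' j = m1 j))"
        using T'(2)[of B w r env m1 \<rho>] * env by (fastforce simp: computes_def)
      fix m2 assume m2: "m2 (d + 1) = eval w r b env \<and> (\<forall>j<d + 1. m2 j = m1 j)"
      show "achieves w r (Store (Const d) (op_aexp f (Mem (Const d)) (Mem (Const (d + 1))))) m2
          (10 * (d + B + 1)) (\<lambda>m'. m' d = eval w r (Bin f a b) env \<and> (\<forall>j<d. m' j = m j))"
        using m1 m2 floorlog_le_self[of d] floorlog_le_self[of "d + 1"] floorlog_le_bits[OF fits_less[OF *(1)]]
          floorlog_le_bits[OF fits_less[of B w r a env]] floorlog_le_bits[OF fits_less[of B w r b env]] *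
        by (intro achieves_Store) auto
    qed simp
  qed simp
  moreover have "poly_bounded (\<lambda>B. T B + (T' B + 10 * (d + B + 1)))"
    by (intro poly_bounded_intros T(1) T'(1))
  ultimately show ?case by blast
next
  case (Sum a e)
  obtain T where T: "poly_bounded T" "\<And>w r B \<rho> env m. fits B w r a env \<Longrightarrow> map m \<rho> = env \<Longrightarrow>
      (\<forall>x\<in>set \<rho>. x < d + 2) \<Longrightarrow> computes w r (compile a \<rho> (d + 2)) m (T B) (d + 2) (eval w r a env)"
    using Sum(1)[of "d + 2"] by blast
  obtain T' where T': "poly_bounded T'" "\<And>w r B \<rho> env m. fits B w r e env \<Longrightarrow> map m \<rho> = env \<Longrightarrow>
      (\<forall>x\<in>set \<rho>. x < d + 3) \<Longrightarrow> computes w r (compile e \<rho> (d + 3)) m (T' B) (d + 3) (eval w r e env)"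
    using Sum(2)[of "d + 3"] by blast
  have "computes w r (compile (Sum a e) \<rho> d) m
          (T B + (B + 1) * (T' B + 20 * (B + d + 4)) + 0 + 20 * (B + d + 4)) d (eval w r (Sum a e) env)"
    if *: "fits B w r (Sum a e) env" "map m \<rho> = env" "\<forall>x\<in>set \<rho>. x < d" for w r \<rho> env m B
    unfolding compile.simps eval.simps
  proof (rule computes_fold[where g = "\<lambda>i. eval w r e (i # env)" and acc = "\<lambda>n. \<Sum>i<n. eval w r e (i # env)"])
    show "computes w r (compile a \<rho> (d + 2)) m (T B) (d + 2) (eval w r a env)"
      using * by (intro T) (auto simp: trans_less_add1)
    show "computes w r (compile e ((d + 1) # \<rho>) (d + 3)) m1 (T' B) (d + 3) (eval w r e (i # env))"
      if "i < eval w r a env" "\<forall>j<d. m1 j = m j" "m1 (d + 1) = i" for i m1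
      using * that by (intro T') (auto simp: trans_less_add1)
  qed (use * in \<open>auto intro: fits_less\<close>)
  moreover have "poly_bounded (\<lambda>B. T B + (B + 1) * (T' B + 20 * (B + d + 4)) + 0 + 20 * (B + d + 4))"
    by (intro poly_bounded_intros T(1) T'(1))
  ultimately show ?case by blast
next
  case (Prod a e)
  obtain T where T: "poly_bounded T" "\<And>w r B \<rho> env m. fits B w r a env \<Longrightarrow> map m \<rho> = env \<Longrightarrow>
      (\<forall>x\<in>set \<rho>. x < d + 2) \<Longrightarrow> computes w r (compile a \<rho> (d + 2)) m (T B) (d + 2) (eval w r a env)"
    using Prod(1)[of "d + 2"] by blast
  obtain T' where T': "poly_bounded T'" "\<And>w r B \<rho> env m. fits B w r e env \<Longrightarrow> map m \<rho> = env \<Longrightarrow>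
      (\<forall>x\<in>set \<rho>. x < d + 3) \<Longrightarrow> computes w r (compile e \<rho> (d + 3)) m (T' B) (d + 3) (eval w r e env)"
    using Prod(2)[of "d + 3"] by blast
  have "computes w r (compile (Prod a e) \<rho> d) m
          (T B + (B + 1) * (T' B + 20 * (B + d + 4)) + 1 + 20 * (B + d + 4)) d (eval w r (Prod a e) env)"
    if *: "fits B w r (Prod a e) env" "map m \<rho> = env" "\<forall>x\<in>set \<rho>. x < d" for w r \<rho> env m B
    unfolding compile.simps eval.simps
  proof (rule computes_fold[where g = "\<lambda>i. eval w r e (i # env)" and acc = "\<lambda>n. \<Prod>i<n. eval w r e (i # env)"])
    show "computes w r (compile a \<rho> (d + 2)) m (T B) (d + 2) (eval w r a env)"
      using * by (intro T) (auto simp: trans_less_add1)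
    show "computes w r (compile e ((d + 1) # \<rho>) (d + 3)) m1 (T' B) (d + 3) (eval w r e (i # env))"
      if "i < eval w r a env" "\<forall>j<d. m1 j = m j" "m1 (d + 1) = i" for i m1
      using * that by (intro T') (auto simp: trans_less_add1)
  qed (use * in \<open>auto intro: fits_less\<close>)
  moreover have "poly_bounded (\<lambda>B. T B + (B + 1) * (T' B + 20 * (B + d + 4)) + 1 + 20 * (B + d + 4))"
    by (intro poly_bounded_intros T(1) T'(1))
  ultimately show ?case by blast
next
  case (Places i)
  have "computes w r (compile (Places i) \<rho> d) m ((B + 1) * (40 * (B + d + 4)) + 40 * (B + d + 4)) d
     (eval w r (Places i) env)" if "fits B w r (Places i) env" for w r \<rho> env m B
    using that computes_places[of r i B w d m] by simp
  moreover have "poly_bounded (\<lambda>B. (B + 1) * (40 * (B + d + 4)) + 40 * (B + d + 4))"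
    by (intro poly_bounded_intros)
  ultimately show ?case by blast
qed


section \<open>Programs that flip all their coins first\<close>

text \<open>
  Cell 0 counts the remaining flips, cell 2 receives the coin, and cell 1 collects the binary digits.
\<close>

definition flip_body :: com where
  "flip_body =
     Seq (Flip (Const 2))
    (Seq (Store (Const 1) (Add (Mul (Const 2) (Mem (Const 1))) (Mem (Const 2))))
         (Store (Const 0) (Sub (Mem (Const 0)) (Const 1))))"

definition flip_com :: com where
  "flip_com = While (Mem (Const 0)) flip_body"

text \<open>
  The output of \<open>compile bits [] 0\<close> in cell 0 is the number of flips.  After them, the random number in
  cell 1 is the only variable of the expressions for numerator and denominator.
\<close>

definition sampler :: "expr \<Rightarrow> expr \<Rightarrow> expr \<Rightarrow> com" where
  "sampler bits num den =
     Seq (Seq (compile bits [] 0) (Store (Const 1) (Const 0)))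
    (Seq flip_com
    (Seq (compile num [1] 2)
    (Seq (compile den [1] 3)
    (Seq (Store (Const 0) (Mem (Const 2)))
         (Store (Const 1) (Mem (Const 3)))))))"

lemma spmf_of_set_Times:
  assumes "finite A" "finite B"
  shows "spmf_of_set (A \<times> B) = pair_spmf (spmf_of_set A) (spmf_of_set B)"
proof (rule spmf_eqI)
  fix x :: "'a \<times> 'b"
  obtain a b where "x = (a, b)" by (cases x)
  then show "spmf (spmf_of_set (A \<times> B)) x = spmf (pair_spmf (spmf_of_set A) (spmf_of_set B)) x"
    using assms by (simp add: spmf_of_set card_cartesian_product indicator_times)
qed

text \<open>
  Quotient and remainder modulo \<open>b\<close> of a uniform number below \<open>a * b\<close> are independent and uniform.  The
  case \<open>a = 2\<close> describes one more coin flip, the case \<open>b = Q\<close> one more sample.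
\<close>

lemma spmf_of_set_lessThan_mult:
  fixes a b :: nat
  assumes "0 < a" "0 < b"
  shows "bind_spmf (spmf_of_set {..<a}) (\<lambda>x. map_spmf (\<lambda>y. x * b + y) (spmf_of_set {..<b})) =
           spmf_of_set {..<a * b}"
proof -
  let ?f = "\<lambda>(x, y). x * b + y"
  have inj: "inj_on ?f ({..<a} \<times> {..<b})"
  proof (rule inj_onI)
    fix p q assume "p \<in> {..<a} \<times> {..<b}" "q \<in> {..<a} \<times> {..<b}" "?f p = ?f q"
    then show "p = q"
      by (cases p; cases q) (auto dest: arg_cong[of _ _ "\<lambda>x. x div b"], metis add.commute add_right_cancel assms(2) div_less div_mult_self1 add_0 less_not_refl)
  qed
  have "?f ` ({..<a} \<times> {..<b}) = {..<a * b}"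
  proof (intro equalityI subsetI)
    fix z assume "z \<in> ?f ` ({..<a} \<times> {..<b})"
    then obtain x y where xy: "z = x * b + y" "x < a" "y < b" by auto
    then have "(x + 1) * b \<le> a * b" by (intro mult_right_mono) auto
    then show "z \<in> {..<a * b}" using xy by simp
  next
    fix z assume "z \<in> {..<a * b}"
    then have "z = ?f (z div b, z mod b)" "(z div b, z mod b) \<in> {..<a} \<times> {..<b}"
      using assms by (auto simp: less_mult_imp_div_less)
    then show "z \<in> ?f ` ({..<a} \<times> {..<b})" by (rule image_eqI)
  qed
  then have "spmf_of_set {..<a * b} = map_spmf ?f (pair_spmf (spmf_of_set {..<a}) (spmf_of_set {..<b}))"
    using inj by (simp flip: spmf_of_set_Times)
  then show ?thesis
    by (simp add: pair_spmf_alt_def map_spmf_bind_spmf o_def map_spmf_conv_bind_spmf)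
qed

lemma coin_spmf_conv_lessThan: "map_spmf of_bool coin_spmf = spmf_of_set {..<2::nat}"
proof -
  have "of_bool ` UNIV = {..<2::nat}" by (auto simp: UNIV_bool)
  then show ?thesis by (simp add: inj_on_def)
qed

definition flipped :: "mem \<Rightarrow> bool \<Rightarrow> mem" where
  "flipped m c = m(2 := of_bool c, 1 := 2 * m 1 + of_bool c, 0 := m 0 - 1)"

lemma exec_flip_body:
  assumes "m 0 \<le> B" "m 1 < 2 ^ n" "n < B"
  shows "\<exists>t. exec w r flip_body m = map_spmf (\<lambda>c. (flipped m c, t c)) coin_spmf \<and>
             (\<forall>c. t c \<le> 10 * (B + 5))"
proof -
  let ?m1 = "\<lambda>c. m(2 := of_bool c)"
  let ?m2 = "\<lambda>c. m(2 := of_bool c, 1 := 2 * m 1 + of_bool c)"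
  let ?s1 = "\<lambda>c. 1 + acost w (Const 1) (?m1 c) +
               acost w (Add (Mul (Const 2) (Mem (Const 1))) (Mem (Const 2))) (?m1 c)"
  let ?s2 = "\<lambda>c. 1 + acost w (Const 0) (?m2 c) + acost w (Sub (Mem (Const 0)) (Const 1)) (?m2 c)"
  let ?t = "\<lambda>c. (1 + acost w (Const 2) m) + (?s1 c + ?s2 c)"
  have 1: "exec w r flip_body m = map_spmf (\<lambda>c. (flipped m c, ?t c)) coin_spmf"
    by (simp add: flip_body_def bind_map_spmf o_def map_spmf_conv_bind_spmf flipped_def)
  have small: "floorlog 2 (Suc 0) \<le> 1" "floorlog 2 0 = 0" "floorlog 2 2 \<le> 2" "floorlog 2 (m 0) \<le> B"
      "floorlog 2 (m 0 - Suc 0) \<le> B" "floorlog 2 (m 1) \<le> B" "floorlog 2 (2 * m 1) \<le> B"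
      "floorlog 2 (2 * m 1 + of_bool c) \<le> B" "floorlog 2 (of_bool c) \<le> 1" for c
  proof -
    have "m 0 < 2 ^ B" using assms(1) by (meson le_less_trans less_exp)
    moreover have "2 * m 1 + of_bool c < 2 ^ Suc n" using assms(2) by (cases c) auto
    moreover have "(2::nat) ^ Suc n \<le> 2 ^ B" using assms(3) by (intro power_increasing) auto
    ultimately show "floorlog 2 (Suc 0) \<le> 1" "floorlog 2 0 = 0" "floorlog 2 2 \<le> 2" "floorlog 2 (m 0) \<le> B"
      "floorlog 2 (m 0 - Suc 0) \<le> B" "floorlog 2 (m 1) \<le> B" "floorlog 2 (2 * m 1) \<le> B"
      "floorlog 2 (2 * m 1 + of_bool c) \<le> B" "floorlog 2 (of_bool c) \<le> 1"
      by (cases c; auto simp: floorlog_le_iff floorlog_eq_zero_iff)+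
  qed
  have 2: "?t c \<le> 10 * (B + 5)" for c
    using small(1-7) small(8,9)[of c] by simp
  show ?thesis using 1 2 by (intro exI[of _ ?t]) simp
qed

text \<open>
  Only the distribution of cell 1 is described, and separately a bound on the time that holds for every
  outcome: the later computation depends on nothing else.  The number \<open>i\<close> is that of the coins flipped
  before, so that \<open>i + n \<le> B\<close> bounds the number of digits collected.
\<close>

lemma exec_flip_com:
  assumes "m 0 = n" "m 1 < 2 ^ i" "i + n \<le> B"
  shows "map_spmf (\<lambda>(m', t). m' 1) (exec w r flip_com m) =
           map_spmf (\<lambda>x. m 1 * 2 ^ n + x) (spmf_of_set {..<2 ^ n}) \<and>
         (\<forall>(m', t) \<in> set_spmf (exec w r flip_com m). t \<le> Suc n * (20 * (B + 5)))"
  using assms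
proof (induction n arbitrary: m i)
  case 0
  then have "spmf_of_set {..<2 ^ 0 :: nat} = return_spmf 0"
    by (simp add: lessThan_Suc flip: spmf_of_set_singleton)
  moreover have "floorlog 2 0 = 0" by (simp add: floorlog_eq_zero_iff)
  ultimately show ?case using 0 by (simp add: flip_com_def loop.simps)
next
  case (Suc n)
  obtain t where t: "exec w r flip_body m = map_spmf (\<lambda>c. (flipped m c, t c)) coin_spmf"
    "\<And>c. t c \<le> 10 * (B + 5)"
    using exec_flip_body[of m B i w r] Suc.prems by auto
  define g where "g = 1 + acost w (Mem (Const 0)) m"
  have "m 0 < 2 ^ B" using Suc.prems by (auto intro!: le_less_trans[OF _ less_exp])
  then have g: "g \<le> 10 * (B + 5)"
    using floorlog_le_bits[of "m 0" B] floorlog_le_self[of 0] by (simp add: g_def)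
  have unfold: "exec w r flip_com m =
     bind_spmf coin_spmf (\<lambda>c. map_spmf (\<lambda>(m2, t2). (m2, g + t c + t2)) (exec w r flip_com (flipped m c)))"
    using Suc.prems unfolding flip_com_def
    by (simp add: loop.simps[of _ _ _ m] t(1) bind_map_spmf o_def map_spmf_conv_bind_spmf g_def case_prod_unfold)
  have fl: "flipped m c 0 = n" "flipped m c 1 = 2 * m 1 + of_bool c" "flipped m c 1 < 2 ^ Suc i" for c
    using Suc.prems by (auto simp: flipped_def)
  have IH: "map_spmf (\<lambda>(m', t). m' 1) (exec w r flip_com (flipped m c)) =
           map_spmf (\<lambda>x. flipped m c 1 * 2 ^ n + x) (spmf_of_set {..<2 ^ n})"
    "\<forall>(m', t) \<in> set_spmf (exec w r flip_com (flipped m c)). t \<le> Suc n * (20 * (B + 5))" for c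
    using Suc.IH[of "flipped m c" "Suc i"] fl Suc.prems by auto
  have "map_spmf (\<lambda>(m', t). m' 1) (exec w r flip_com m) =
     bind_spmf coin_spmf (\<lambda>c. map_spmf (\<lambda>(m', t). m' 1) (exec w r flip_com (flipped m c)))"
    by (simp add: unfold map_spmf_bind_spmf o_def spmf.map_comp case_prod_unfold)
  also have "\<dots> = bind_spmf coin_spmf (\<lambda>c. map_spmf (\<lambda>x. m 1 * 2 ^ Suc n + (of_bool c * 2 ^ n + x))
                     (spmf_of_set {..<2 ^ n}))"
    unfolding IH fl by (simp add: algebra_simps)
  also have "\<dots> = map_spmf (\<lambda>x. m 1 * 2 ^ Suc n + x)
       (bind_spmf (map_spmf of_bool coin_spmf) (\<lambda>c. map_spmf (\<lambda>x. c * 2 ^ n + x) (spmf_of_set {..<2 ^ n})))"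
    by (simp add: map_spmf_bind_spmf bind_map_spmf o_def spmf.map_comp del: map_spmf_of_set_inj_on)
  also have "\<dots> = map_spmf (\<lambda>x. m 1 * 2 ^ Suc n + x) (spmf_of_set {..<2 ^ Suc n})"
    unfolding coin_spmf_conv_lessThan by (subst spmf_of_set_lessThan_mult) simp_all
  finally have "map_spmf (\<lambda>(m', t). m' 1) (exec w r flip_com m) =
     map_spmf (\<lambda>x. m 1 * 2 ^ Suc n + x) (spmf_of_set {..<2 ^ Suc n})" .
  moreover have "t' \<le> Suc (Suc n) * (20 * (B + 5))" if "(m', t') \<in> set_spmf (exec w r flip_com m)" for m' t'
  proof -
    from that obtain c t2 where "(m', t2) \<in> set_spmf (exec w r flip_com (flipped m c))" "t' = g + t c + t2"
      unfolding unfold by (auto simp: set_bind_spmf)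
    then show ?thesis using IH(2)[of c] t(2)[of c] g by auto
  qed
  ultimately show ?case by auto
qed

theorem sampler_correct:
  "\<exists>T. poly_bounded T \<and>
     (\<forall>w r B M. M = eval w r bits [] \<longrightarrow> M \<le> B \<longrightarrow> fits B w r bits [] \<longrightarrow>
        (\<forall>R<2 ^ M. fits B w r num [R] \<and> fits B w r den [R]) \<longrightarrow>
        map_spmf (\<lambda>(m, t). (m 0, m 1)) (run (sampler bits num den) w r) =
          map_spmf (\<lambda>R. (eval w r num [R], eval w r den [R])) (spmf_of_set {..<2 ^ M}) \<and>
        (\<forall>(m, t) \<in> set_spmf (run (sampler bits num den) w r). t \<le> T B))"
proof -
  obtain T1 where T1: "poly_bounded T1" "\<And>w r B \<rho> env m. fits B w r bits env \<Longrightarrow> map m \<rho> = env \<Longrightarrow>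
      (\<forall>x\<in>set \<rho>. x < 0) \<Longrightarrow> computes w r (compile bits \<rho> 0) m (T1 B) 0 (eval w r bits env)"
    using compile_correct[of bits 0] by blast
  obtain T2 where T2: "poly_bounded T2" "\<And>w r B \<rho> env m. fits B w r num env \<Longrightarrow> map m \<rho> = env \<Longrightarrow>
      (\<forall>x\<in>set \<rho>. x < 2) \<Longrightarrow> computes w r (compile num \<rho> 2) m (T2 B) 2 (eval w r num env)"
    using compile_correct[of num 2] by blast
  obtain T3 where T3: "poly_bounded T3" "\<And>w r B \<rho> env m. fits B w r den env \<Longrightarrow> map m \<rho> = env \<Longrightarrow>
      (\<forall>x\<in>set \<rho>. x < 3) \<Longrightarrow> computes w r (compile den \<rho> 3) m (T3 B) 3 (eval w r den env)"
    using compile_correct[of den 3] by blast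
  define T where "T = (\<lambda>B. (T1 B + 10) + (B + 1) * (20 * (B + 5)) + (T2 B + (T3 B + (2 * B + 40))))"
  have "poly_bounded T"
    unfolding T_def by (intro poly_bounded_intros T1(1) T2(1) T3(1))
  moreover have "map_spmf (\<lambda>(m, t). (m 0, m 1)) (run (sampler bits num den) w r) =
          map_spmf (\<lambda>R. (eval w r num [R], eval w r den [R])) (spmf_of_set {..<2 ^ M}) \<and>
        (\<forall>(m, t) \<in> set_spmf (run (sampler bits num den) w r). t \<le> T B)"
    if M: "M = eval w r bits []" "M \<le> B" "fits B w r bits []"
      and fits: "\<forall>R<2 ^ M. fits B w r num [R] \<and> fits B w r den [R]" for w r B M
  proof -
    let ?init = "Seq (compile bits [] 0) (Store (Const 1) (Const 0))"
    have "achieves w r ?init (\<lambda>_. 0) (T1 B + 10) (\<lambda>m. m 0 = M \<and> m 1 = 0)"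
    proof (rule achieves_Seq)
      show "achieves w r (compile bits [] 0) (\<lambda>_. 0) (T1 B) (\<lambda>m. m 0 = M)"
        using T1(2)[of B w r "[]" "\<lambda>_. 0" "[]"] M by (simp add: computes_def)
      show "achieves w r (Store (Const 1) (Const 0)) m 10 (\<lambda>m. m 0 = M \<and> m 1 = 0)" if "m 0 = M" for m :: mem
        using that floorlog_le_self[of 1] floorlog_le_self[of 0] by (intro achieves_Store) auto
    qed simp
    then obtain m0 t0 where init: "exec w r ?init (\<lambda>_. 0) = return_spmf (m0, t0)" "t0 \<le> T1 B + 10"
      "m0 0 = M" "m0 1 = 0"
      by (auto elim: achievesE)
    let ?D = "exec w r flip_com m0"
    let ?U = "spmf_of_set {..<2 ^ M} :: nat spmf"
    have flip: "map_spmf (\<lambda>(m, t). m 1) ?D = ?U"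
      "\<And>m t. (m, t) \<in> set_spmf ?D \<Longrightarrow> t \<le> (B + 1) * (20 * (B + 5))"
    proof -
      note * = exec_flip_com[of m0 M 0 B w r]
      show "map_spmf (\<lambda>(m, t). m 1) ?D = ?U" using * init M by simp
      fix m t assume "(m, t) \<in> set_spmf ?D"
      then have "t \<le> Suc M * (20 * (B + 5))" using * init M by auto
      also have "\<dots> \<le> (B + 1) * (20 * (B + 5))" using M by (intro mult_right_mono) auto
      finally show "t \<le> (B + 1) * (20 * (B + 5))" .
    qed
    let ?rest = "Seq (compile num [1] 2) (Seq (compile den [1] 3)
      (Seq (Store (Const 0) (Mem (Const 2))) (Store (Const 1) (Mem (Const 3)))))"
    have rest: "achieves w r ?rest m (T2 B + (T3 B + (2 * B + 40)))
        (\<lambda>m'. m' 0 = eval w r num [m 1] \<and> m' 1 = eval w r den [m 1])" if "m 1 < 2 ^ M" for m :: mem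
    proof (rule achieves_Seq)
      have R: "fits B w r num [m 1]" "fits B w r den [m 1]" using fits that by auto
      show "achieves w r (compile num [1] 2) m (T2 B) (\<lambda>m'. m' 2 = eval w r num [m 1] \<and> m' 1 = m 1)"
        using T2(2)[OF R(1), of m "[1]"] by (auto simp: computes_def elim!: achieves_weaken)
      fix m1 :: mem assume m1: "m1 2 = eval w r num [m 1] \<and> m1 1 = m 1"
      show "achieves w r (Seq (compile den [1] 3)
           (Seq (Store (Const 0) (Mem (Const 2))) (Store (Const 1) (Mem (Const 3))))) m1 (T3 B + (2 * B + 40))
           (\<lambda>m'. m' 0 = eval w r num [m 1] \<and> m' 1 = eval w r den [m 1])"
      proof (rule achieves_Seq)
        show "achieves w r (compile den [1] 3) m1 (T3 B)
            (\<lambda>m'. m' 3 = eval w r den [m 1] \<and> m' 2 = eval w r num [m 1])"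
          using T3(2)[OF R(2), of m1 "[1]"] m1 by (auto simp: computes_def elim!: achieves_weaken)
        fix m2 :: mem assume m2: "m2 3 = eval w r den [m 1] \<and> m2 2 = eval w r num [m 1]"
        show "achieves w r (Seq (Store (Const 0) (Mem (Const 2))) (Store (Const 1) (Mem (Const 3)))) m2
           (2 * B + 40) (\<lambda>m'. m' 0 = eval w r num [m 1] \<and> m' 1 = eval w r den [m 1])"
        proof (rule achieves_Seq)
          show "achieves w r (Store (Const 0) (Mem (Const 2))) m2 (B + 20)
            (\<lambda>m'. m' 0 = eval w r num [m 1] \<and> m' 3 = eval w r den [m 1])"
            using m2 floorlog_le_bits[OF fits_less[OF R(1)]] floorlog_le_self[of 0] floorlog_le_self[of 2]
            by (intro achieves_Store) auto
          show "achieves w r (Store (Const 1) (Mem (Const 3))) m3 (B + 20)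
            (\<lambda>m'. m' 0 = eval w r num [m 1] \<and> m' 1 = eval w r den [m 1])"
            if "m3 0 = eval w r num [m 1] \<and> m3 3 = eval w r den [m 1]" for m3
            using that floorlog_le_bits[OF fits_less[OF R(2)]] floorlog_le_self[of 1] floorlog_le_self[of 3]
            by (intro achieves_Store) auto
        qed simp
      qed simp
    qed simp
    have run: "run (sampler bits num den) w r = bind_spmf ?D (\<lambda>(m1, t1).
       map_spmf (\<lambda>(m2, t2). (m2, t0 + t1 + t2)) (exec w r ?rest m1))"
      unfolding run_def sampler_def
      by (subst exec.simps, subst exec.simps, subst init(1))
         (simp add: map_spmf_conv_bind_spmf case_prod_unfold add.assoc del: exec.simps(2-))
    have mem: "m 1 < 2 ^ M" if "(m, t) \<in> set_spmf ?D" for m t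
    proof -
      have "m 1 \<in> set_spmf ?U" unfolding flip(1)[symmetric] using that by force
      then show ?thesis by simp
    qed
    have "map_spmf (\<lambda>(m, t). (m 0, m 1)) (run (sampler bits num den) w r) =
       bind_spmf ?D (\<lambda>(m1, t1). map_spmf (\<lambda>(m, t). (m 0, m 1)) (exec w r ?rest m1))"
      by (simp add: run map_spmf_bind_spmf o_def case_prod_unfold spmf.map_comp del: exec.simps)
    also have "\<dots> = bind_spmf ?D (\<lambda>(m1, t1). return_spmf (eval w r num [m1 1], eval w r den [m1 1]))"
    proof (intro bind_spmf_cong refl)
      fix x assume "x \<in> set_spmf ?D"
      then have "fst x 1 < 2 ^ M" by (intro mem[of _ "snd x"]) simp
      from rest[of "fst x", OF this] show "(case x of (m1, t1) \<Rightarrow> map_spmf (\<lambda>(m, t). (m 0, m 1)) (exec w r ?rest m1)) =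
          (case x of (m1, t1) \<Rightarrow> return_spmf (eval w r num [m1 1], eval w r den [m1 1]))"
        by (cases x) (auto elim!: achievesE simp del: exec.simps)
    qed
    also have "\<dots> = map_spmf (\<lambda>R. (eval w r num [R], eval w r den [R])) ?U"
      by (simp add: flip(1)[symmetric] map_spmf_conv_bind_spmf case_prod_unfold)
    finally have "map_spmf (\<lambda>(m, t). (m 0, m 1)) (run (sampler bits num den) w r) =
       map_spmf (\<lambda>R. (eval w r num [R], eval w r den [R])) ?U" .
    moreover have "t \<le> T B" if "(m, t) \<in> set_spmf (run (sampler bits num den) w r)" for m t
    proof -
      from that obtain m1 t1 t2 where *: "(m1, t1) \<in> set_spmf ?D" "(m, t2) \<in> set_spmf (exec w r ?rest m1)"
        "t = t0 + t1 + t2"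
        unfolding run by (fastforce simp: set_bind_spmf simp del: exec.simps)
      have "t2 \<le> T2 B + (T3 B + (2 * B + 40))"
        using rest[of m1, OF mem[OF *(1)]] *(2) by (auto elim!: achievesE simp del: exec.simps)
      then show ?thesis
        using * flip(2)[OF *(1)] init(2) by (simp add: T_def)
    qed
    ultimately show ?thesis by blast
  qed
  ultimately show ?thesis by blast
qed


section \<open>Positional notation\<close>

lemma sum_digits:
  fixes q R :: nat
  shows "(\<Sum>j<k. R div q ^ j mod q * q ^ j) = R mod q ^ k"
proof (induction k)
  case (Suc k)
  have "R mod q ^ Suc k = q ^ k * (R div q ^ k mod q) + R mod q ^ k"
    using mod_mult2_eq[of R "q ^ k" q] by (simp add: mult.commute)
  then show ?case using Suc by simp
qed simp

text \<open>
  Removing the least significant digit reduces the claim to the preceding place and to the sequence of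
  digits shifted by one.
\<close>

lemma digit_of_sum:
  fixes q :: nat
  assumes "\<And>i. i < s \<Longrightarrow> d i < q" "j < s"
  shows "(\<Sum>i<s. d i * q ^ i) div q ^ j mod q = d j"
  using assms
proof (induction s arbitrary: d j)
  case (Suc s)
  have split: "(\<Sum>i<Suc s. d i * q ^ i) = d 0 + q * (\<Sum>i<s. d (Suc i) * q ^ i)"
    by (subst sum.lessThan_Suc_shift) (simp add: sum_distrib_left mult_ac)
  have d0: "d 0 < q" using Suc.prems by simp
  show ?case
  proof (cases j)
    case 0
    then show ?thesis using split d0 by simp
  next
    case (Suc j')
    have "(\<Sum>i<Suc s. d i * q ^ i) div q ^ j = (\<Sum>i<Suc s. d i * q ^ i) div q div q ^ j'"
      by (simp add: Suc div_mult2_eq)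
    also have "\<dots> = (\<Sum>i<s. d (Suc i) * q ^ i) div q ^ j'"
      unfolding split using d0 by simp
    finally show ?thesis
      using Suc.IH[of "\<lambda>i. d (Suc i)" j'] Suc.prems Suc by simp
  qed
qed simp

lemma sum_digits_less:
  fixes q :: nat
  assumes "\<And>i. i < s \<Longrightarrow> d i < q"
  shows "(\<Sum>i<s. d i * q ^ i) < q ^ s"
  using assms
proof (induction s)
  case (Suc s)
  have "(\<Sum>i<Suc s. d i * q ^ i) < q ^ s + d s * q ^ s" using Suc by simp
  also have "\<dots> = (d s + 1) * q ^ s" by simp
  also have "\<dots> \<le> q * q ^ s" using Suc.prems[of s] by (intro mult_right_mono) auto
  finally show ?case by simp
qed simp

text \<open>
  A uniform number below \<open>q ^ k\<close> is thus the same as a uniform list of \<open>k\<close> numbers below \<open>q\<close>.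
\<close>

lemma bij_betw_digits:
  fixes q :: nat
  assumes "0 < q"
  shows "bij_betw (\<lambda>R. map (\<lambda>j. R div q ^ j mod q) [0..<k]) {..<q ^ k}
           {xs. set xs \<subseteq> {..<q} \<and> length xs = k}"
proof (rule bij_betw_byWitness[where f' = "\<lambda>xs. \<Sum>j<k. xs ! j * q ^ j"])
  show "\<forall>R\<in>{..<q ^ k}. (\<Sum>j<k. map (\<lambda>j. R div q ^ j mod q) [0..<k] ! j * q ^ j) = R"
    by (simp add: sum_digits)
  show "\<forall>xs\<in>{xs. set xs \<subseteq> {..<q} \<and> length xs = k}.
      map (\<lambda>j. (\<Sum>j<k. xs ! j * q ^ j) div q ^ j mod q) [0..<k] = xs"
    by (auto intro!: nth_equalityI digit_of_sum) (meson lessThan_iff nth_mem subsetD)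
  show "(\<lambda>R. map (\<lambda>j. R div q ^ j mod q) [0..<k]) ` {..<q ^ k} \<subseteq> {xs. set xs \<subseteq> {..<q} \<and> length xs = k}"
    using assms by auto
  show "(\<lambda>xs. \<Sum>j<k. xs ! j * q ^ j) ` {xs. set xs \<subseteq> {..<q} \<and> length xs = k} \<subseteq> {..<q ^ k}"
    by (auto intro!: sum_digits_less) (meson lessThan_iff nth_mem subsetD)
qed


section \<open>Parsing codes of instances\<close>

text \<open>
  The following functions extract the components of an instance from its code, and are total: on words
  that are not codes they have some value, to be discarded by \<open>wellformed\<close>.
\<close>

definition sep :: "word \<Rightarrow> nat" where
  "sep w = length (takeWhile (\<lambda>a. a \<noteq> 2) w)"

definition param :: "word \<Rightarrow> nat" where
  "param w = (\<Sum>i<sep w. w ! i * 2 ^ i)"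

text \<open>
  This is the integer square root of the length of the part after the separator.
\<close>

definition num_vertices :: "word \<Rightarrow> nat" where
  "num_vertices w = card {i. i < length w \<and> (i + 1) * (i + 1) \<le> length w - (sep w + 1)}"

definition entry :: "word \<Rightarrow> nat \<Rightarrow> nat \<Rightarrow> nat" where
  "entry w u v =
     (if sep w + 1 + u * num_vertices w + v < length w then w ! (sep w + 1 + u * num_vertices w + v) else 0)"

text \<open>
  On ternary words this characterises the codes: there is a separator, the most significant digit of the
  parameter is 1, and the rest is the matrix of a symmetric irreflexive relation.
\<close>

definition wellformed :: "word \<Rightarrow> bool" where
  "wellformed w \<longleftrightarrow>
     sep w < length w \<and> (sep w = 0 \<or> w ! (sep w - 1) = 1) \<and>
     num_vertices w * num_vertices w = length w - (sep w + 1) \<and>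
     (\<forall>u<num_vertices w. entry w u u = 0 \<and> (\<forall>v<num_vertices w. entry w u v \<le> 1 \<and> entry w u v \<le> entry w v u))"

definition edges :: "word \<Rightarrow> nat set set" where
  "edges w = {{u, v} |u v. u < num_vertices w \<and> v < num_vertices w \<and> entry w u v = 1}"

lemma num_vertices_le: "num_vertices w \<le> length w"
proof -
  have "num_vertices w \<le> card {..<length w}" unfolding num_vertices_def by (intro card_mono) auto
  then show ?thesis by simp
qed

lemma num_vertices_eq:
  assumes "length w - (sep w + 1) = n * n"
  shows "num_vertices w = n"
proof -
  have "n \<le> length w" using assms by (cases n) auto
  have "(i + 1) * (i + 1) \<le> n * n \<longleftrightarrow> i + 1 \<le> n" for i
    using power2_nat_le_eq_le[of "i + 1" n] unfolding power2_eq_square .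
  then have "{i. i < length w \<and> (i + 1) * (i + 1) \<le> length w - (sep w + 1)} =
      {i. i < length w \<and> i + 1 \<le> n}"
    unfolding assms by (rule Collect_cong[OF conj_cong[OF refl]])
  also have "\<dots> = {..<n}" using \<open>n \<le> length w\<close> by auto
  finally have "{i. i < length w \<and> (i + 1) * (i + 1) \<le> length w - (sep w + 1)} = {..<n}" .
  then show ?thesis by (simp add: num_vertices_def)
qed

lemma edge_iff_entry:
  assumes "wellformed w" "u < num_vertices w" "v < num_vertices w"
  shows "{u, v} \<in> edges w \<longleftrightarrow> entry w u v = 1"
proof -
  have "entry w u v = entry w v u" using assms unfolding wellformed_def by (meson le_antisym)
  then show ?thesis using assms by (auto simp: edges_def doubleton_eq_iff)
qed

lemma length_matrix: "length (concat (map (\<lambda>u. map (\<lambda>v. h u v) [0..<n]) [0..<m])) = m * n"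
  by (simp add: length_concat comp_def sum_list_triv)

lemma parse_encode:
  assumes "(n, E, k) \<in> instances"
  defines "w \<equiv> encode (n, E, k)"
  shows "wellformed w" "num_vertices w = n" "param w = k" "edges w = E"
proof -
  let ?M = "concat (map (\<lambda>u. map (\<lambda>v. of_bool ({u, v} \<in> E)) [0..<n]) [0..<n]) :: word"
  have w: "w = binary_digits k @ 2 # ?M" by (simp add: w_def)
  have len: "length (binary_digits k) = floorlog 2 k" by (simp add: binary_digits_def)
  have sep: "sep w = floorlog 2 k"
    unfolding sep_def w using binary_no_sep[of k]
    by (subst takeWhile_append2) (auto simp: len)
  have ltw: "length w = floorlog 2 k + 1 + n * n" by (simp add: w len length_matrix)
  show ord: "num_vertices w = n" using num_vertices_eq[of w n] sep ltw by simp
  have dig: "w ! i = k div 2 ^ i mod 2" if "i < floorlog 2 k" for i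
    using that by (simp add: w nth_append len) (simp add: binary_digits_def)
  have k: "k < 2 ^ floorlog 2 k"
    using floorlog_bounds[of k 2] by (cases "k = 0") auto
  show "param w = k"
    using sum_digits[of k 2 "floorlog 2 k"] k by (simp add: param_def sep dig)
  have ent: "entry w u v = of_bool ({u, v} \<in> E)" if "u < n" "v < n" for u v
  proof -
    have "(u + 1) * n \<le> n * n" using that by (intro mult_right_mono) auto
    then have "u * n + v < n * n" using that by simp
    then show ?thesis
      using matrix_conv[OF that, of "\<lambda>u v. of_bool ({u, v} \<in> E) :: nat"]
      by (simp add: entry_def sep ord ltw) (simp add: w nth_append len)
  qed
  have E: "e \<subseteq> {..<n} \<and> card e = 2" if "e \<in> E" for e
    using assms that by (auto simp: instances_def simple_graph_def)
  have "sep w = 0 \<or> w ! (sep w - 1) = 1"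
  proof (cases "k = 0")
    case False
    let ?l = "floorlog 2 k - 1"
    have pos: "0 < floorlog 2 k" using False by (simp add: floorlog_def)
    have "2 ^ ?l \<le> k" "k < 2 ^ ?l * 2"
      using floorlog_bounds[of k 2] False pos by (auto simp flip: power_Suc2)
    then have "k div 2 ^ ?l = 1" by (intro div_nat_eqI) auto
    then show ?thesis using dig[of ?l] pos sep by simp
  qed (simp add: sep floorlog_def)
  moreover have "{u} \<notin> E" for u using E[of "{u}"] by auto
  ultimately show "wellformed w"
    by (auto simp: wellformed_def ord ent sep ltw insert_commute)
  have "e \<in> edges w \<longleftrightarrow> e \<in> E" for e
  proof
    assume "e \<in> edges w"
    then show "e \<in> E" by (auto simp: edges_def ord ent of_bool_def split: if_splits)
  next
    assume e: "e \<in> E"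
    then obtain u v where uv: "e = {u, v}" using E[OF e] by (auto simp: card_2_iff)
    then have b: "u < n" "v < n" using E[OF e] by auto
    then have "entry w u v = 1" using e uv by (simp add: ent)
    then show "e \<in> edges w" unfolding edges_def ord uv using b by blast
  qed
  then show "edges w = E" by blast
qed

lemma encode_parse:
  assumes "w \<in> lists {0, 1, 2}" "wellformed w"
  shows "(num_vertices w, edges w, param w) \<in> instances" "encode (num_vertices w, edges w, param w) = w"
proof -
  let ?n = "num_vertices w"
  have wf: "sep w < length w" "sep w = 0 \<or> w ! (sep w - 1) = 1" "?n * ?n = length w - (sep w + 1)"
    "\<And>u. u < ?n \<Longrightarrow> entry w u u = 0" "\<And>u v. u < ?n \<Longrightarrow> v < ?n \<Longrightarrow> entry w u v \<le> 1"
    using assms(2) by (auto simp: wellformed_def)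
  show "(num_vertices w, edges w, param w) \<in> instances"
  proof -
    have "e \<subseteq> {..<?n} \<and> card e = 2" if "e \<in> edges w" for e
      using that wf(4) by (fastforce simp: edges_def card_2_iff)
    then show ?thesis by (simp add: instances_def simple_graph_def)
  qed
  have at_sep: "w ! sep w = 2"
    using wf(1) nth_length_takeWhile[of "\<lambda>a. a \<noteq> 2" w] by (simp add: sep_def)
  have bit: "w ! i < 2" if "i < sep w" for i
  proof -
    have "w ! i \<noteq> 2"
      using that nth_mem[of i "takeWhile (\<lambda>a. a \<noteq> 2) w"]
      by (auto simp: sep_def takeWhile_nth dest: set_takeWhileD)
    moreover have "w ! i \<in> {0, 1, 2}" using assms(1) that wf(1) by (auto simp: in_lists_conv_set)
    ultimately show ?thesis by auto
  qed
  have dig: "param w div 2 ^ i mod 2 = w ! i" if "i < sep w" for i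
    unfolding param_def using bit that by (intro digit_of_sum) auto
  have len: "floorlog 2 (param w) = sep w"
  proof (cases "sep w")
    case 0
    then show ?thesis by (simp add: param_def floorlog_def)
  next
    case (Suc s)
    have "param w < 2 ^ sep w" unfolding param_def using bit by (intro sum_digits_less)
    moreover have "2 ^ s \<le> param w" using wf(2) Suc by (simp add: param_def)
    ultimately show ?thesis
      using floorlog_leI[of "param w" 2 "sep w"] floorlog_ge_SucI[of 2 s "param w"] Suc by simp
  qed
  have digs: "binary_digits (param w) = take (sep w) w"
    using wf(1) dig by (intro nth_equalityI) (auto simp: binary_digits_def len)
  have mat: "concat (map (\<lambda>u. map (\<lambda>v. of_bool ({u, v} \<in> edges w)) [0..<?n]) [0..<?n]) =
      drop (sep w + 1) w" (is "?M = _")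
  proof (rule nth_equalityI)
    show "length ?M = length (drop (sep w + 1) w)" using wf(3) by (simp add: length_matrix)
    fix i assume "i < length ?M"
    then have i: "i < ?n * ?n" by (simp add: length_matrix)
    then have n: "0 < ?n" by (cases ?n) auto
    define u v where uv: "u = i div ?n" "v = i mod ?n"
    then have b: "u < ?n" "v < ?n" and iuv: "i = u * ?n + v"
      using i n by (auto simp: less_mult_imp_div_less)
    have "?M ! i = of_bool ({u, v} \<in> edges w)" unfolding iuv by (rule matrix_conv[OF b])
    also have "\<dots> = entry w u v"
      using wf(5)[OF b] edge_iff_entry[OF assms(2) b] by (cases "entry w u v") auto
    also have "\<dots> = drop (sep w + 1) w ! i"
      using i wf(1,3) by (simp add: entry_def iuv add.assoc)
    finally show "?M ! i = drop (sep w + 1) w ! i" .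
  qed
  show "encode (num_vertices w, edges w, param w) = w"
    unfolding encode.simps digs mat using id_take_nth_drop[OF wf(1)] at_sep by simp
qed

theorem on_codes_parse:
  assumes "w \<in> lists {0, 1, 2}"
  shows "on_codes F w = (if wellformed w then F (num_vertices w, edges w, param w) else 0)"
proof (cases "wellformed w")
  case True
  then show ?thesis using encode_parse[OF assms] on_codes_encode[of "(num_vertices w, edges w, param w)" F] by simp
next
  case False
  then have "w \<notin> encode ` instances" using parse_encode(1) by (auto simp del: encode.simps)
  then show ?thesis using False by (simp add: on_codes_def)
qed


section \<open>Tuples of vertices\<close>

text \<open>
  The least \<open>b\<close> with \<open>n \<le> 2 ^ b\<close>, in a form that an expression can compute.
\<close>

definition width :: "nat \<Rightarrow> nat" where
  "width n = card {i. i < n \<and> 2 ^ i < n}"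

lemma width_le: "width n \<le> n"
proof -
  have "width n \<le> card {..<n}" unfolding width_def by (intro card_mono) auto
  then show ?thesis by simp
qed

lemma width_bounds: "n \<le> 2 ^ width n" "0 < n \<Longrightarrow> 2 ^ width n \<le> 2 * n"
proof -
  define b where "b = (LEAST b. n \<le> 2 ^ b)"
  have b: "n \<le> 2 ^ b"
    unfolding b_def by (rule LeastI[of _ n]) (simp add: less_imp_le)
  have min: "2 ^ i < n" if "i < b" for i
    using not_less_Least that unfolding b_def by (metis not_less)
  have "i < n \<and> 2 ^ i < n \<longleftrightarrow> i < b" for i
  proof
    assume "i < n \<and> 2 ^ i < n"
    then have "(2::nat) ^ i < 2 ^ b" using b by linarith
    then show "i < b" by simp
  next
    assume "i < b"
    then show "i < n \<and> 2 ^ i < n" using min[of i] less_exp[of i] by linarith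
  qed
  then have w: "width n = b" by (simp add: width_def)
  show "n \<le> 2 ^ width n" using b w by simp
  assume "0 < n"
  then show "2 ^ width n \<le> 2 * n" using min[of "b - 1"] w by (cases b) auto
qed

text \<open>
  The parameter is 0 on words that are not codes, so that the factor of the running time that depends
  on the parameter is constant on them, although their digits may denote a large number.
\<close>

definition kappa :: "word \<Rightarrow> nat" where
  "kappa w = of_bool (wellformed w) * param w"

definition vert :: "word \<Rightarrow> nat \<Rightarrow> nat \<Rightarrow> nat" where
  "vert w x j = x div 2 ^ (width (num_vertices w) * j) mod 2 ^ width (num_vertices w)"

text \<open>
  The numbers \<open>vert w x j\<close> for \<open>j < kappa w\<close> are the digits of \<open>x\<close> in base \<open>2 ^ width\<close>, that is the
  tuple coded by \<open>x\<close>.  If it consists of distinct vertices, the double sum counts the edges among them.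
\<close>

definition hit :: "bool \<Rightarrow> word \<Rightarrow> nat \<Rightarrow> bool" where
  "hit q w x \<longleftrightarrow>
     (\<forall>j<kappa w. vert w x j < num_vertices w \<and> (\<forall>i<j. vert w x j \<noteq> vert w x i)) \<and>
     even (\<Sum>j<kappa w. \<Sum>i<j. entry w (vert w x j) (vert w x i)) = q"

definition parity_sets :: "bool \<Rightarrow> word \<Rightarrow> nat set set" where
  "parity_sets q w = {S \<in> slice {..<num_vertices w} (kappa w). even (card (induced_edges (edges w) S)) = q}"

lemma simple_graph_edges:
  assumes "wellformed w"
  shows "simple_graph {..<num_vertices w} (edges w)"
proof -
  have "e \<subseteq> {..<num_vertices w} \<and> card e = 2" if "e \<in> edges w" for e
    using that assms by (fastforce simp: edges_def card_2_iff wellformed_def)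
  then show ?thesis by (simp add: simple_graph_def)
qed

text \<open>
  By induction on the list: a new last vertex contributes its neighbours among the earlier ones.
\<close>

lemma card_induced_edges_list:
  assumes "simple_graph V E" "distinct xs" "set xs \<subseteq> V"
  shows "(\<Sum>j<length xs. \<Sum>i<j. of_bool ({xs ! j, xs ! i} \<in> E)) = card (induced_edges E (set xs))"
  using assms(2,3)
proof (induction xs rule: rev_induct)
  case Nil
  have "{} \<notin> E" using assms(1) by (auto simp: simple_graph_def)
  then show ?case by (auto simp: induced_edges_def)
next
  case (snoc a xs)
  have "(\<Sum>j<length (xs @ [a]). \<Sum>i<j. of_bool ({(xs @ [a]) ! j, (xs @ [a]) ! i} \<in> E)) =
      (\<Sum>j<length xs. \<Sum>i<j. of_bool ({xs ! j, xs ! i} \<in> E)) +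
      (\<Sum>i<length xs. of_bool ({a, xs ! i} \<in> E) :: nat)"
    by (simp add: nth_append)
  also have "(\<Sum>i<length xs. of_bool ({a, xs ! i} \<in> E)) = (\<Sum>v\<in>set xs. of_bool ({a, v} \<in> E) :: nat)"
    using snoc.prems by (intro sum.reindex_bij_betw bij_betw_nth) auto
  also have "\<dots> = card {v \<in> set xs. {a, v} \<in> E}"
    by (simp add: Int_def)
  also have "(\<Sum>j<length xs. \<Sum>i<j. of_bool ({xs ! j, xs ! i} \<in> E)) = card (induced_edges E (set xs))"
    using snoc by simp
  finally show ?case
    using snoc.prems induced_edges_insert[OF assms(1), of "set xs" a] by simp
qed

lemma hit_iff:
  fixes x w
  defines "xs \<equiv> map (vert w x) [0..<kappa w]"
  assumes "wellformed w"
  shows "hit q w x \<longleftrightarrow> set xs \<subseteq> {..<num_vertices w} \<and> distinct xs \<and>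
           even (card (induced_edges (edges w) (set xs))) = q"
proof -
  have xs: "length xs = kappa w" "\<And>j. j < kappa w \<Longrightarrow> xs ! j = vert w x j"
    by (simp_all add: xs_def)
  have sub: "set xs \<subseteq> {..<num_vertices w} \<longleftrightarrow> (\<forall>j<kappa w. vert w x j < num_vertices w)"
    by (simp add: xs_def image_subset_iff Ball_def)
  have dist: "distinct xs \<longleftrightarrow> (\<forall>j<kappa w. \<forall>i<j. vert w x j \<noteq> vert w x i)"
    unfolding distinct_conv_nth xs(1)
  proof (intro iffI allI impI)
    fix j i assume *: "\<forall>i<kappa w. \<forall>j<kappa w. i \<noteq> j \<longrightarrow> xs ! i \<noteq> xs ! j" "j < kappa w" "i < j"
    then have i: "i < kappa w" "i \<noteq> j" by auto
    then have "xs ! j \<noteq> xs ! i" using * by metis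
    then show "vert w x j \<noteq> vert w x i" unfolding xs(2)[OF *(2)] xs(2)[OF i(1)] .
  next
    fix j i assume *: "\<forall>j<kappa w. \<forall>i<j. vert w x j \<noteq> vert w x i" "j < kappa w" "i < kappa w" "i \<noteq> j"
    then show "xs ! i \<noteq> xs ! j" unfolding xs(2)[OF *(2)] xs(2)[OF *(3)]
      by (metis linorder_neqE_nat)
  qed
  show ?thesis
  proof (cases "set xs \<subseteq> {..<num_vertices w} \<and> distinct xs")
    case True
    \<comment> \<open>Only for a tuple of vertices do the entries that are read belong to the matrix.\<close>
    have "(\<Sum>j<kappa w. \<Sum>i<j. entry w (vert w x j) (vert w x i)) =
        (\<Sum>j<length xs. \<Sum>i<j. of_bool ({xs ! j, xs ! i} \<in> edges w))"
    proof (unfold xs(1), intro sum.cong refl)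
      fix j i assume "j \<in> {..<kappa w}" "i \<in> {..<j}"
      then have ji: "j < kappa w" "i < kappa w" by auto
      then have b: "vert w x j < num_vertices w" "vert w x i < num_vertices w" using True sub by auto
      then have "entry w (vert w x j) (vert w x i) \<le> 1"
        using assms(2) by (auto simp: wellformed_def)
      then show "entry w (vert w x j) (vert w x i) = of_bool ({xs ! j, xs ! i} \<in> edges w)"
        using edge_iff_entry[OF assms(2) b] xs(2)[OF ji(1)] xs(2)[OF ji(2)]
        by (cases "entry w (vert w x j) (vert w x i)") auto
    qed
    also have "\<dots> = card (induced_edges (edges w) (set xs))"
      using card_induced_edges_list[OF simple_graph_edges[OF assms(2)]] True by blast
    finally show ?thesis using True sub dist by (simp add: hit_def)
  next
    case False
    then show ?thesis using sub dist unfolding hit_def by blast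
  qed
qed

lemma card_filter_bij_betw:
  assumes "bij_betw f A B"
  shows "card {x \<in> A. P (f x)} = card {y \<in> B. P y}"
proof -
  have "f ` {x \<in> A. P (f x)} = {y \<in> B. P y}" using assms by (auto simp: bij_betw_def)
  moreover have "inj_on f {x \<in> A. P (f x)}"
    using assms by (auto simp: bij_betw_def intro: inj_on_subset)
  ultimately show ?thesis using card_image by fastforce
qed

text \<open>
  The hits are the codes of the lists without repetition whose set of elements is counted, and a set of
  \<open>k\<close> elements has \<open>k!\<close> such lists.
\<close>

theorem card_hits:
  assumes "wellformed w"
  shows "card {x. x < 2 ^ (width (num_vertices w) * kappa w) \<and> hit q w x} =
           fact (kappa w) * card (parity_sets q w)"
proof -
  let ?n = "num_vertices w" and ?k = "kappa w"
  define Q :: nat where "Q = 2 ^ width ?n"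
  let ?tuple = "\<lambda>x. map (vert w x) [0..<?k]"
  define good where "good xs \<longleftrightarrow> set xs \<subseteq> {..<?n} \<and> distinct xs \<and>
    even (card (induced_edges (edges w) (set xs))) = q" for xs
  have bij: "bij_betw ?tuple {..<Q ^ ?k} {xs. set xs \<subseteq> {..<Q} \<and> length xs = ?k}"
    using bij_betw_digits[of Q ?k] by (simp add: Q_def vert_def[abs_def] power_mult)
  have "card {x \<in> {..<Q ^ ?k}. good (?tuple x)} =
      card {xs \<in> {xs. set xs \<subseteq> {..<Q} \<and> length xs = ?k}. good xs}"
    by (rule card_filter_bij_betw[OF bij])
  also have "{xs \<in> {xs. set xs \<subseteq> {..<Q} \<and> length xs = ?k}. good xs} =
      (\<Union>S\<in>parity_sets q w. permutations_of_set S)"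
  proof -
    have "{..<?n} \<subseteq> {..<Q}" using width_bounds(1)[of ?n] by (simp add: Q_def)
    then show ?thesis
      by (auto simp: good_def parity_sets_def slice_def permutations_of_set_def distinct_card)
  qed
  also have "card \<dots> = (\<Sum>S\<in>parity_sets q w. card (permutations_of_set S))"
  proof (rule card_UN_disjoint)
    show "finite (parity_sets q w)" by (simp add: parity_sets_def finite_slice)
    show "\<forall>S\<in>parity_sets q w. \<forall>T\<in>parity_sets q w. S \<noteq> T \<longrightarrow> permutations_of_set S \<inter> permutations_of_set T = {}"
      by (auto simp: permutations_of_set_def)
  qed simp
  also have "\<dots> = (\<Sum>S\<in>parity_sets q w. fact ?k)"
    by (intro sum.cong refl, subst card_permutations_of_set)
       (auto simp: parity_sets_def slice_def intro: finite_subset)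
  finally show ?thesis
    using hit_iff[OF assms] by (simp add: good_def Q_def power_mult)
qed

definition hit_probability :: "bool \<Rightarrow> word \<Rightarrow> real" where
  "hit_probability q w =
     card {x. x < 2 ^ (width (num_vertices w) * kappa w) \<and> hit q w x} / 2 ^ (width (num_vertices w) * kappa w)"

text \<open>
  Passing from \<open>k\<close>-sets to \<open>k\<close>-tuples loses the factor \<open>(2 * k) ^ k\<close> and no power of \<open>n\<close>: since
  \<open>2 ^ width n \<le> 2 * n\<close>, the number of tuples is at most \<open>(2 * n) ^ k = (2 * k) ^ k * (n / k) ^ k\<close>, and
  \<open>(n / k) ^ k \<le> n choose k\<close>.
\<close>

theorem hit_probability_lower_bound:
  assumes "wellformed w" "parity_sets q w \<noteq> {}"
  shows "1 \<le> hit_probability q w * ((2 * real (kappa w)) ^ kappa w * (real (num_vertices w) + 1) ^ 2)"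
proof -
  let ?n = "num_vertices w" and ?k = "kappa w" and ?F = "card (parity_sets q w)"
  define Q :: real where "Q = 2 ^ width ?n"
  obtain U where U: "U \<in> slice {..<?n} ?k" "even (card (induced_edges (edges w) U)) = q"
    using assms(2) by (auto simp: parity_sets_def)
  have "?k \<le> ?n" using U card_mono[of "{..<?n}" U] by (auto simp: slice_def)
  have dens: "real (?n choose ?k) \<le> (real ?n + 1) ^ 2 * ?F"
  proof -
    have "?n choose ?k \<le> (?n + 1) ^ 2 * ?F"
      using parity_density[OF simple_graph_edges[OF assms(1)] U] unfolding parity_sets_def card_lessThan .
    then have "real (?n choose ?k) \<le> real ((?n + 1) ^ 2 * ?F)" by (rule of_nat_mono)
    then show ?thesis by (simp add: add.commute)
  qed
  have Qk: "Q ^ ?k \<le> (2 * real ?k) ^ ?k * real (?n choose ?k)"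
  proof (cases "?k = 0")
    case False
    then have "0 < ?n" using \<open>?k \<le> ?n\<close> by simp
    have "real (2 ^ width ?n) \<le> real (2 * ?n)"
      using width_bounds(2)[OF \<open>0 < ?n\<close>] by (rule of_nat_mono)
    then have "Q ^ ?k \<le> (2 * real ?n) ^ ?k" unfolding Q_def by (intro power_mono) auto
    also have "\<dots> = (2 * real ?k) ^ ?k * (real ?n / real ?k) ^ ?k"
      unfolding power_mult_distrib[symmetric] using False by simp
    also have "\<dots> \<le> (2 * real ?k) ^ ?k * real (?n choose ?k)"
      using binomial_ge_n_over_k_pow_k[OF \<open>?k \<le> ?n\<close>, where 'a = real] by (intro mult_left_mono) auto
    finally show ?thesis .
  qed simp
  have p: "hit_probability q w = fact ?k * ?F / Q ^ ?k"
    using card_hits[OF assms(1), of q] by (simp add: hit_probability_def Q_def flip: power_mult)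
  have "Q ^ ?k \<le> (2 * real ?k) ^ ?k * ((real ?n + 1) ^ 2 * ?F)"
    by (rule order_trans[OF Qk mult_left_mono[OF dens]]) simp
  also have "\<dots> \<le> fact ?k * ((2 * real ?k) ^ ?k * ((real ?n + 1) ^ 2 * ?F))"
  proof -
    have "(1::real) * ((2 * real ?k) ^ ?k * ((real ?n + 1) ^ 2 * ?F)) \<le>
        fact ?k * ((2 * real ?k) ^ ?k * ((real ?n + 1) ^ 2 * ?F))"
      by (intro mult_right_mono) (auto simp: fact_ge_1)
    then show ?thesis by simp
  qed
  finally have "1 \<le> fact ?k * ((2 * real ?k) ^ ?k * ((real ?n + 1) ^ 2 * ?F)) / Q ^ ?k"
    by (subst le_divide_eq_1_pos) (simp_all add: Q_def)
  then show ?thesis unfolding p of_nat_mult of_nat_fact by (simp only: mult_ac times_divide_eq_left times_divide_eq_right)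
qed


section \<open>Derived expressions\<close>

abbreviation plusE (infixl "\<oplus>" 65) where "a \<oplus> b \<equiv> Bin Plus a b"
abbreviation minusE (infixl "\<ominus>" 65) where "a \<ominus> b \<equiv> Bin Minus a b"
abbreviation timesE (infixl "\<otimes>" 70) where "a \<otimes> b \<equiv> Bin Times a b"
abbreviation divE (infixl "\<oslash>" 70) where "a \<oslash> b \<equiv> Bin Over a b"

definition notE :: "expr \<Rightarrow> expr" where "notE a = Num 1 \<ominus> a"
definition leE :: "expr \<Rightarrow> expr \<Rightarrow> expr" where "leE a b = Num 1 \<ominus> (a \<ominus> b)"
definition eqE :: "expr \<Rightarrow> expr \<Rightarrow> expr" where "eqE a b = leE a b \<otimes> leE b a"
definition modE :: "expr \<Rightarrow> expr \<Rightarrow> expr" where "modE a b = a \<ominus> a \<oslash> b \<otimes> b"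
definition parityE :: "bool \<Rightarrow> expr \<Rightarrow> expr" where
  "parityE q a = (if q then notE (modE a (Num 2)) else modE a (Num 2))"

lemma eval_derived [simp]:
  "eval w r (leE a b) env = of_bool (eval w r a env \<le> eval w r b env)"
  "eval w r (notE (leE a b)) env = of_bool (eval w r b env < eval w r a env)"
  "eval w r (eqE a b) env = of_bool (eval w r a env = eval w r b env)"
  "eval w r (modE a b) env = eval w r a env mod eval w r b env"
  "eval w r (parityE q a) env = of_bool (even (eval w r a env) = q)"
  by (auto simp: notE_def leE_def eqE_def modE_def parityE_def minus_div_mult_eq_mod
      odd_iff_mod_2_eq_one)

lemma eval_not_eqE [simp]:
  "eval w r (notE (eqE a b)) env = of_bool (eval w r a env \<noteq> eval w r b env)"
  unfolding notE_def eval.simps(5) eval_derived by simp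

lemma fits_Bin [simp]:
  "fits B w r (a \<oplus> b) env \<longleftrightarrow>
     fits B w r a env \<and> fits B w r b env \<and> eval w r a env + eval w r b env < 2 ^ B"
  "fits B w r (a \<otimes> b) env \<longleftrightarrow>
     fits B w r a env \<and> fits B w r b env \<and> eval w r a env * eval w r b env < 2 ^ B"
  "fits B w r (a \<ominus> b) env \<longleftrightarrow> fits B w r a env \<and> fits B w r b env"
  "fits B w r (a \<oslash> b) env \<longleftrightarrow> fits B w r a env \<and> fits B w r b env"
  using fits_less[of B w r a env] by (auto intro: le_less_trans[OF div_le_dividend] le_less_trans)

declare fits.simps(5) [simp del]

lemma fits_derived [simp]:
  assumes "0 < B"
  shows "fits B w r (notE a) env \<longleftrightarrow> fits B w r a env"
    "fits B w r (leE a b) env \<longleftrightarrow> fits B w r a env \<and> fits B w r b env"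
    "fits B w r (eqE a b) env \<longleftrightarrow> fits B w r a env \<and> fits B w r b env"
    "fits B w r (modE a b) env \<longleftrightarrow> fits B w r a env \<and> fits B w r b env"
proof -
  have B: "Suc 0 < 2 ^ B" using one_less_power[of "2::nat" B] assms by simp
  have le: "fits B w r (leE a b) env \<longleftrightarrow> fits B w r a env \<and> fits B w r b env" for a b
    using B by (simp add: leE_def)
  show "fits B w r (notE a) env \<longleftrightarrow> fits B w r a env"
    "fits B w r (leE a b) env \<longleftrightarrow> fits B w r a env \<and> fits B w r b env"
    using B le by (simp_all add: notE_def)
  show "fits B w r (eqE a b) env \<longleftrightarrow> fits B w r a env \<and> fits B w r b env"
    using B by (auto simp: eqE_def le)
  show "fits B w r (modE a b) env \<longleftrightarrow> fits B w r a env \<and> fits B w r b env"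
    using fits_less[of B w r a env]
    by (auto simp: modE_def intro: le_less_trans[OF div_times_less_eq_dividend])
qed

lemma fits_parityE [simp]: "1 < B \<Longrightarrow> fits B w r (parityE q a) env \<longleftrightarrow> fits B w r a env"
  using power_strict_increasing[of 1 B "2::nat"] by (auto simp: parityE_def)

text \<open>
  The summands are natural numbers, so that the total bounds the partial sums.
\<close>

lemma fits_SumI:
  assumes "fits B w r a env" "eval w r a env \<le> B" "\<And>i. i < eval w r a env \<Longrightarrow> fits B w r e (i # env)"
    and "eval w r (Sum a e) env < 2 ^ B"
  shows "fits B w r (Sum a e) env"
proof -
  have "(\<Sum>i<n. eval w r e (i # env)) < 2 ^ B" if "n \<le> eval w r a env" for n
  proof -
    have "(\<Sum>i<n. eval w r e (i # env)) \<le> eval w r (Sum a e) env"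
      using that by (auto intro!: sum_mono2)
    then show ?thesis using assms(4) by simp
  qed
  then show ?thesis using assms by simp
qed

lemma fits_ProdI:
  assumes "fits B w r a env" "eval w r a env \<le> B" "\<And>i. i < eval w r a env \<Longrightarrow> fits B w r e (i # env)"
    and "\<And>i. i < eval w r a env \<Longrightarrow> eval w r e (i # env) \<le> c" "0 < c" "c ^ eval w r a env < 2 ^ B"
  shows "fits B w r (Prod a e) env"
proof -
  have "(\<Prod>i<n. eval w r e (i # env)) < 2 ^ B" if "n \<le> eval w r a env" for n
  proof -
    have "(\<Prod>i<n. eval w r e (i # env)) \<le> (\<Prod>i<n. c)"
      using that assms(4) by (intro prod_mono) auto
    also have "\<dots> \<le> c ^ eval w r a env" using that assms(5) by (simp add: power_increasing)
    finally show ?thesis using assms(6) by simp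
  qed
  then show ?thesis using assms by simp
qed

lemma prod_of_bool:
  fixes n :: nat
  shows "(\<Prod>i<n. of_bool (P i)) = (of_bool (\<forall>i<n. P i) :: nat)"
  by (induction n) (auto simp: less_Suc_eq)

text \<open>
  The expressions mirror the functions of the same name; truncated subtraction provides the boolean
  connectives, and a product of truth values is a bounded universal quantifier.
\<close>

definition sepE :: expr where
  "sepE = Sum Len (Prod (Var 0 \<oplus> Num 1) (notE (eqE (Sym (Var 0)) (Num 2))))"

definition paramE :: expr where
  "paramE = Sum sepE (Sym (Var 0) \<otimes> Prod (Var 0) (Num 2))"

definition restE :: expr where
  "restE = Len \<ominus> (sepE \<oplus> Num 1)"

definition num_verticesE :: expr where
  "num_verticesE = Sum Len (leE ((Var 0 \<oplus> Num 1) \<otimes> (Var 0 \<oplus> Num 1)) restE)"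

definition entryE :: "expr \<Rightarrow> expr \<Rightarrow> expr" where
  "entryE a b = Sym (sepE \<oplus> Num 1 \<oplus> a \<otimes> num_verticesE \<oplus> b)"

text \<open>
  The second factor expresses that the digit before the separator is 1 or there is none: the summand
  \<open>1 - sep\<close> takes care of the latter.
\<close>

definition wellformedE :: expr where
  "wellformedE =
     leE (sepE \<oplus> Num 1) Len \<otimes>
     leE (Num 1) (Sym (sepE \<ominus> Num 1) \<oplus> (Num 1 \<ominus> sepE)) \<otimes>
     eqE (num_verticesE \<otimes> num_verticesE) restE \<otimes>
     Prod num_verticesE
       (eqE (entryE (Var 0) (Var 0)) (Num 0) \<otimes>
        Prod num_verticesE
          (leE (entryE (Var 1) (Var 0)) (Num 1) \<otimes>
           leE (entryE (Var 1) (Var 0)) (entryE (Var 0) (Var 1))))"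

definition kappaE :: expr where
  "kappaE = wellformedE \<otimes> paramE"

definition widthE :: expr where
  "widthE = Sum num_verticesE (notE (leE num_verticesE (Prod (Var 0) (Num 2))))"

definition vertE :: "expr \<Rightarrow> expr \<Rightarrow> expr" where
  "vertE x j = modE (x \<oslash> Prod (widthE \<otimes> j) (Num 2)) (Prod widthE (Num 2))"

definition tuple_bitsE :: expr where
  "tuple_bitsE = widthE \<otimes> kappaE"

definition blockE :: "expr \<Rightarrow> expr \<Rightarrow> expr" where
  "blockE R i = modE (R \<oslash> Prod (tuple_bitsE \<otimes> i) (Num 2)) (Prod tuple_bitsE (Num 2))"

text \<open>
  The environment is \<open>[i, R]\<close>: the number of the sample and the random number.  Each enclosing sum or
  product shifts their indices by 1.
\<close>

definition hitE :: "bool \<Rightarrow> expr" where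
  "hitE q =
     Prod kappaE
       (notE (leE num_verticesE (vertE (blockE (Var 2) (Var 1)) (Var 0))) \<otimes>
        Prod (Var 0)
          (notE (eqE (vertE (blockE (Var 3) (Var 2)) (Var 1)) (vertE (blockE (Var 3) (Var 2)) (Var 0))))) \<otimes>
     parityE q
       (Sum kappaE (Sum (Var 0)
          (entryE (vertE (blockE (Var 3) (Var 2)) (Var 1)) (vertE (blockE (Var 3) (Var 2)) (Var 0)))))"

definition samplesE :: expr where
  "samplesE =
     Prod (Num 2 \<otimes> kappaE) (Num 2 \<otimes> kappaE) \<otimes> Prod (Num 4) (num_verticesE \<oplus> Num 1) \<otimes>
     Prod (Places 0) (Num 4) \<otimes> (Places 1 \<oplus> Num 1)"

definition bitsE :: expr where
  "bitsE = samplesE \<otimes> tuple_bitsE"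

definition numE :: "bool \<Rightarrow> expr" where
  "numE q = wellformedE \<otimes> (Sum samplesE (hitE q) \<otimes> Prod tuple_bitsE (Num 2))"

definition denE :: expr where
  "denE = samplesE \<otimes> Prod kappaE (Var 0 \<oplus> Num 1)"


section \<open>What the expressions compute\<close>

definition places :: "(nat \<Rightarrow> real) \<Rightarrow> nat \<Rightarrow> nat" where
  "places r i = (LEAST j. 1 \<le> 2 ^ j * r i)"

definition samples :: "word \<Rightarrow> (nat \<Rightarrow> real) \<Rightarrow> nat" where
  "samples w r =
     (2 * kappa w) ^ (2 * kappa w) * (num_vertices w + 1) ^ 4 * 4 ^ places r 0 * (places r 1 + 1)"

definition tuple_bits :: "word \<Rightarrow> nat" where
  "tuple_bits w = width (num_vertices w) * kappa w"

definition block :: "word \<Rightarrow> nat \<Rightarrow> nat \<Rightarrow> nat" where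
  "block w R i = R div 2 ^ (tuple_bits w * i) mod 2 ^ tuple_bits w"

lemma sep_le: "sep w \<le> length w"
  by (simp add: sep_def length_takeWhile_le)

lemma less_sep_iff: "i < length w \<Longrightarrow> i < sep w \<longleftrightarrow> (\<forall>j<Suc i. w ! j \<noteq> 2)"
proof
  assume i: "i < sep w"
  show "\<forall>j<Suc i. w ! j \<noteq> 2"
  proof (intro allI impI)
    fix j assume "j < Suc i"
    then show "w ! j \<noteq> 2"
      using i nth_mem[of j "takeWhile (\<lambda>a. a \<noteq> 2) w"]
      by (auto simp: sep_def takeWhile_nth dest: set_takeWhileD)
  qed
next
  assume i: "i < length w" and *: "\<forall>j<Suc i. w ! j \<noteq> 2"
  show "i < sep w"
  proof (rule ccontr)
    assume "\<not> i < sep w"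
    then have "sep w < Suc i" "sep w < length w" using i by auto
    then show False using * nth_length_takeWhile[of "\<lambda>a. a \<noteq> 2" w] by (simp add: sep_def)
  qed
qed

lemma sum_of_bool:
  fixes n :: nat
  shows "(\<Sum>i<n. of_bool (P i)) = card {i. i < n \<and> P i}"
proof -
  have "{..<n} \<inter> {i. P i} = {i. i < n \<and> P i}" by auto
  then show ?thesis by simp
qed

text \<open>
  A constant of its own protects the set \<open>{0, 1, 2}\<close> from the rewriting of \<open>1\<close> to \<open>Suc 0\<close>, which would
  keep the conditional evaluation rules below from applying.
\<close>

definition ternary :: "word \<Rightarrow> bool" where
  "ternary w \<longleftrightarrow> w \<in> lists {0, 1, 2}"

lemma eval_sepE [simp]: "eval w r sepE env = sep w"
proof -
  have "eval w r sepE env = (\<Sum>i<length w. of_bool (\<forall>j<Suc i. w ! j \<noteq> 2))"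
    unfolding sepE_def eval.simps
  proof (intro sum.cong refl)
    fix i assume "i \<in> {..<length w}"
    then have "(\<Prod>j<op_val Plus ((i # env) ! 0) 1. eval w r (notE (eqE (Sym (Var 0)) (Num 2))) (j # i # env)) =
        (\<Prod>j<Suc i. of_bool (w ! j \<noteq> 2))"
      by (intro prod.cong) auto
    then show "(\<Prod>j<op_val Plus ((i # env) ! 0) 1. eval w r (notE (eqE (Sym (Var 0)) (Num 2))) (j # i # env)) =
        of_bool (\<forall>j<Suc i. w ! j \<noteq> 2)"
      by (simp only: prod_of_bool)
  qed
  also have "\<dots> = card {i. i < length w \<and> (\<forall>j<Suc i. w ! j \<noteq> 2)}" by (rule sum_of_bool)
  also have "{i. i < length w \<and> (\<forall>j<Suc i. w ! j \<noteq> 2)} = {..<sep w}"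
    using less_sep_iff[of _ w] sep_le[of w] unfolding lessThan_def
    by (intro Collect_cong) (meson less_le_trans)
  finally show ?thesis by simp
qed

lemma eval_restE [simp]: "eval w r restE env = length w - (sep w + 1)"
  by (simp add: restE_def)

lemma eval_paramE [simp]: "eval w r paramE env = param w"
  using sep_le[of w] by (auto simp: paramE_def param_def intro!: sum.cong)

lemma eval_num_verticesE [simp]: "eval w r num_verticesE env = num_vertices w"
  by (simp add: num_verticesE_def num_vertices_def sum_of_bool del: sum_of_bool_eq)

lemma eval_entryE [simp]: "eval w r (entryE a b) env = entry w (eval w r a env) (eval w r b env)"
  by (simp add: entryE_def entry_def)

lemma eval_wellformedE [simp]:
  assumes "ternary w"
  shows "eval w r wellformedE env = of_bool (wellformed w)"
proof -
  have 1: "eval w r (leE (sepE \<oplus> Num 1) Len) env = of_bool (sep w < length w)"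
    by (simp add: Suc_le_eq)
  have 2: "eval w r (leE (Num 1) (Sym (sepE \<ominus> Num 1) \<oplus> (Num 1 \<ominus> sepE))) env =
      of_bool (sep w = 0 \<or> w ! (sep w - 1) = 1)"
  proof (cases "sep w")
    case (Suc s)
    then have s: "s < sep w" "s < length w" using sep_le[of w] by auto
    then have "w ! s \<noteq> 2" using less_sep_iff[of s w] by auto
    moreover have "w ! s \<in> {0, 1, 2}" using assms s by (auto simp: ternary_def in_lists_conv_set)
    ultimately show ?thesis using Suc s by auto
  qed simp
  have 3: "eval w r (eqE (num_verticesE \<otimes> num_verticesE) restE) env =
      of_bool (num_vertices w * num_vertices w = length w - (sep w + 1))"
    by simp
  have 4: "eval w r (Prod num_verticesE
       (eqE (entryE (Var 0) (Var 0)) (Num 0) \<otimes>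
        Prod num_verticesE
          (leE (entryE (Var 1) (Var 0)) (Num 1) \<otimes>
           leE (entryE (Var 1) (Var 0)) (entryE (Var 0) (Var 1))))) env =
      of_bool (\<forall>u<num_vertices w. entry w u u = 0 \<and>
        (\<forall>v<num_vertices w. entry w u v \<le> 1 \<and> entry w u v \<le> entry w v u))"
    by (simp add: prod_of_bool flip: of_bool_conj)
  show ?thesis
    unfolding wellformedE_def eval.simps(5) op_val.simps 1 2 3 4 of_bool_conj[symmetric]
    by (simp only: wellformed_def conj_assoc)
qed

lemma eval_kappaE [simp]: "ternary w \<Longrightarrow> eval w r kappaE env = kappa w"
  by (simp add: kappaE_def kappa_def)

lemma eval_widthE [simp]: "eval w r widthE env = width (num_vertices w)"
proof -
  have "eval w r widthE env = (\<Sum>i<num_vertices w. of_bool (2 ^ i < num_vertices w))"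
    by (simp add: widthE_def del: sum_of_bool_eq)
  then show ?thesis by (simp add: width_def sum_of_bool del: sum_of_bool_eq)
qed

lemma eval_vertE [simp]: "eval w r (vertE x j) env = vert w (eval w r x env) (eval w r j env)"
  by (simp add: vertE_def vert_def)

lemma eval_tuple_bitsE [simp]: "ternary w \<Longrightarrow> eval w r tuple_bitsE env = tuple_bits w"
  by (simp add: tuple_bitsE_def tuple_bits_def)

lemma eval_blockE [simp]:
  "ternary w \<Longrightarrow> eval w r (blockE R i) env = block w (eval w r R env) (eval w r i env)"
  by (simp add: blockE_def block_def)

lemma eval_hitE [simp]:
  assumes "ternary w"
  shows "eval w r (hitE q) [i, R] = of_bool (hit q w (block w R i))"
  using assms
  by (simp add: hitE_def hit_def prod_of_bool numeral_3_eq_3 numeral_2_eq_2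
      flip: of_bool_conj)

lemma eval_samplesE [simp]: "ternary w \<Longrightarrow> eval w r samplesE env = samples w r"
  by (simp add: samplesE_def samples_def places_def)

lemma eval_bitsE [simp]: "ternary w \<Longrightarrow> eval w r bitsE env = samples w r * tuple_bits w"
  by (simp add: bitsE_def)

definition hits :: "bool \<Rightarrow> word \<Rightarrow> nat \<Rightarrow> nat \<Rightarrow> nat" where
  "hits q w N R = card {i. i < N \<and> hit q w (block w R i)}"

lemma eval_numE [simp]:
  "ternary w \<Longrightarrow>
     eval w r (numE q) [R] = of_bool (wellformed w) * (hits q w (samples w r) R * 2 ^ tuple_bits w)"
  by (simp add: numE_def hits_def sum_of_bool del: sum_of_bool_eq)

lemma eval_denE [simp]:
  "ternary w \<Longrightarrow> eval w r denE env = samples w r * fact (kappa w)"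
  by (simp add: denE_def fact_prod_Suc atLeast0LessThan)


section \<open>Bounds on the intermediate values\<close>

lemma less_two_power: "x \<le> B \<Longrightarrow> x < 2 ^ B" for x B :: nat
  by (rule le_less_trans[OF _ less_exp])

lemma Suc_le_two_power: "x < y \<Longrightarrow> Suc x \<le> 2 ^ y" for x y :: nat
  by (rule Suc_leI) (rule order.strict_trans[OF _ less_exp])

lemma code_bit:
  assumes "ternary w" "i < sep w"
  shows "w ! i < 2"
proof -
  have "i < length w" using assms sep_le[of w] by simp
  then have "w ! i \<in> {0, 1, 2}" "w ! i \<noteq> 2"
    using assms less_sep_iff[of i w] by (auto simp: ternary_def in_lists_conv_set)
  then show ?thesis by auto
qed

lemma code_symbol:
  fixes w :: word
  assumes "ternary w"
  shows "(if i < length w then w ! i else 0) \<le> 2"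
proof -
  have "w ! i \<in> {0, 1, 2}" if "i < length w" using assms that by (auto simp: ternary_def in_lists_conv_set)
  then show ?thesis by auto
qed

lemma self_power_le: "k ^ k \<le> (2 * k) ^ (2 * k)" for k :: nat
proof (cases "k = 0")
  case False
  have "k ^ k \<le> (2 * k) ^ k" by (intro power_mono) auto
  also have "\<dots> \<le> (2 * k) ^ (2 * k)" using False by (intro power_increasing) auto
  finally show ?thesis .
qed simp

lemma entry_le: "ternary w \<Longrightarrow> entry w u v \<le> 2"
  unfolding entry_def by (rule code_symbol)

lemma param_less: "ternary w \<Longrightarrow> param w < 2 ^ sep w"
  unfolding param_def by (intro sum_digits_less code_bit)

text \<open>
  The digits of a tuple may exceed the number of vertices, but not by much; hence the test of a tuple
  only reads entries at small positions, even before it is known to consist of vertices.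
\<close>

lemma vert_le: "vert w x j \<le> 2 * length w"
proof (cases "num_vertices w = 0")
  case True
  then have "width (num_vertices w) = 0" using width_le[of 0] by simp
  then show ?thesis by (simp add: vert_def)
next
  case False
  have "vert w x j < 2 ^ width (num_vertices w)" by (simp add: vert_def)
  also have "\<dots> \<le> 2 * num_vertices w" using False by (intro width_bounds) simp
  also have "\<dots> \<le> 2 * length w" using num_vertices_le[of w] by simp
  finally show ?thesis by simp
qed

context
  fixes w :: word and r :: "nat \<Rightarrow> real" and B :: nat
  assumes code: "ternary w" and B: "2 * length w + 8 \<le> B"
begin

lemma small [simp]: "x \<le> 2 * length w + 8 \<Longrightarrow> x < 2 ^ B"
  using B by (intro less_two_power) simp

lemma symbol_small: "i < length w \<Longrightarrow> w ! i < 2 ^ B"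
  using code_symbol[OF code, of i] B by (intro small) simp

text \<open>
  The exponent \<open>B\<close> is at least \<open>2 * length w + 8\<close>, which leaves room for quadratic functions of the length.
\<close>

lemma entry_index_small:
  assumes "a \<le> 2 * length w" "b \<le> 2 * length w"
  shows "sep w + 1 + a * num_vertices w + b < 2 ^ B"
proof -
  let ?l = "length w"
  have "a * num_vertices w \<le> (2 * ?l) * ?l" using assms num_vertices_le[of w] by (intro mult_le_mono)
  then have "sep w + 1 + a * num_vertices w + b \<le> ?l + 1 + 2 * (?l * ?l) + 2 * ?l"
    using assms sep_le[of w] by simp
  also have "\<dots> \<le> 2 * ((?l + 1) * (?l + 1))" by simp
  also have "\<dots> \<le> 2 * (2 ^ ?l * 2 ^ ?l)"
    using less_exp[of ?l] by (intro mult_le_mono) (simp_all add: Suc_le_eq)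
  also have "\<dots> = 2 ^ (2 * ?l + 1)" by (simp add: mult_2 power_add)
  also have "\<dots> < 2 ^ B" using B by (intro power_strict_increasing) auto
  finally show ?thesis .
qed

lemma B_pos [simp]: "0 < B" "Suc 0 < B" "8 \<le> B" "length w \<le> B"
  using B by auto

lemma two_power_small: "i < B \<Longrightarrow> (2::nat) ^ i < 2 ^ B"
  by simp

lemma fits_power2:
  assumes "fits B w r a env" "eval w r a env < B"
  shows "fits B w r (Prod a (Num 2)) env"
  using assms by (intro fits_ProdI[where c = 2]) auto

lemma fits_sepE [simp]: "fits B w r sepE env"
  unfolding sepE_def
proof (rule fits_SumI)
  fix i assume "i < eval w r Len env"
  then have i: "i < length w" by simp
  show "fits B w r (Prod (Var 0 \<oplus> Num 1) (notE (eqE (Sym (Var 0)) (Num 2)))) (i # env)"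
    using i B symbol_small by (intro fits_ProdI[where c = 1]) (auto intro: small)
qed (use sep_le[of w] eval_sepE[of w r env, unfolded sepE_def] in \<open>simp_all del: eval.simps(6)\<close>)

lemma fits_restE [simp]: "fits B w r restE env"
  using sep_le[of w] by (simp add: restE_def)

lemma fits_num_verticesE [simp]: "fits B w r num_verticesE env"
  unfolding num_verticesE_def
proof (rule fits_SumI)
  fix i assume "i < eval w r Len env"
  then have i: "i < length w" by simp
  have "(i + 1) * (i + 1) \<le> 2 ^ length w * 2 ^ length w"
    using Suc_le_two_power[OF i] by (intro mult_le_mono) simp_all
  also have "\<dots> = 2 ^ (2 * length w)" by (simp add: mult_2 power_add)
  also have "\<dots> < 2 ^ B" using B by (intro two_power_small) simp
  finally show "fits B w r (leE ((Var 0 \<oplus> Num 1) \<otimes> (Var 0 \<oplus> Num 1)) restE) (i # env)"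
    using i by (simp del: mult_Suc mult_Suc_right)
qed (use num_vertices_le[of w] eval_num_verticesE[of w r env, unfolded num_verticesE_def] in \<open>simp_all del: eval.simps(6)\<close>)

lemma fits_entryE:
  assumes "fits B w r a env" "fits B w r b env" "eval w r a env \<le> 2 * length w" "eval w r b env \<le> 2 * length w"
  shows "fits B w r (entryE a b) env"
  using assms sep_le[of w] entry_index_small[OF assms(3,4)]
  unfolding entryE_def
  by (auto intro: symbol_small small)

lemma fits_wellformedE [simp]: "fits B w r wellformedE env"
proof -
  have pairs: "fits B w r (entryE (Var i) (Var j)) env'"
    if "i < length env'" "j < length env'" "env' ! i < num_vertices w" "env' ! j < num_vertices w" for i j env'
    using that num_vertices_le[of w] by (intro fits_entryE) auto
  have inner: "fits B w r (Prod num_verticesE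
          (leE (entryE (Var 1) (Var 0)) (Num 1) \<otimes>
           leE (entryE (Var 1) (Var 0)) (entryE (Var 0) (Var 1)))) (u # env)"
    if "u < num_vertices w" for u
    using that num_vertices_le[of w] B by (intro fits_ProdI[where c = 1]) (auto intro!: pairs)
  have outer: "fits B w r (Prod num_verticesE
       (eqE (entryE (Var 0) (Var 0)) (Num 0) \<otimes>
        Prod num_verticesE
          (leE (entryE (Var 1) (Var 0)) (Num 1) \<otimes>
           leE (entryE (Var 1) (Var 0)) (entryE (Var 0) (Var 1))))) env"
    using num_vertices_le[of w] B inner
    by (intro fits_ProdI[where c = 1]) (auto intro!: pairs simp: prod_of_bool simp flip: of_bool_conj)
  have "fits B w r (num_verticesE \<otimes> num_verticesE) env"
    using entry_index_small[of "num_vertices w" 0] num_vertices_le[of w] by (auto)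
  moreover have "fits B w r (Sym (sepE \<ominus> Num 1) \<oplus> (Num 1 \<ominus> sepE)) env"
    using code_symbol[OF code, of "sep w - 1"] sep_le[of w] by (auto intro!: small)
  ultimately show ?thesis
    using sep_le[of w] outer code
    by (simp add: wellformedE_def)
qed

lemma fits_kappaE [simp]: "fits B w r kappaE env"
proof -
  have "fits B w r paramE env"
    unfolding paramE_def
  proof (rule fits_SumI)
    fix i assume "i < eval w r sepE env"
    then have i: "i < sep w" "i < length w" using sep_le[of w] by auto
    have "w ! i * 2 ^ i < 2 * 2 ^ i" using code_bit[OF code i(1)] by simp
    also have "\<dots> \<le> 2 ^ B" using i B by (metis B_pos(4) Suc_leI less_le_trans one_le_numeral power_Suc power_increasing)
    finally have "w ! i * 2 ^ i < 2 ^ B" .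
    then show "fits B w r (Sym (Var 0) \<otimes> Prod (Var 0) (Num 2)) (i # env)"
      using i B code_bit[OF code i(1)] fits_power2[of "Var 0" "i # env"] by (auto intro: small)
  next
    have "param w < 2 ^ sep w" using param_less[OF code] .
    also have "\<dots> \<le> 2 ^ B" using sep_le[of w] B by (intro power_increasing) auto
    finally show "eval w r (Sum sepE (Sym (Var 0) \<otimes> Prod (Var 0) (Num 2))) env < 2 ^ B"
      by (simp flip: paramE_def)
  qed (use sep_le[of w] B in auto)
  from this fits_less[OF this] show ?thesis
    unfolding kappaE_def by (simp add: code)
qed

lemma fits_widthE [simp]: "fits B w r widthE env"
  unfolding widthE_def
proof (rule fits_SumI)
  fix i assume "i < eval w r num_verticesE env"
  then have "i < B" using num_vertices_le[of w] B by simp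
  then show "fits B w r (notE (leE num_verticesE (Prod (Var 0) (Num 2)))) (i # env)"
    using fits_power2[of "Var 0" "i # env"] by (simp add: less_two_power)
qed (use width_le[of "num_vertices w"] num_vertices_le[of w] B eval_widthE[of w r env, unfolded widthE_def]
    in \<open>simp_all del: eval.simps(6)\<close>)

context
  fixes N L :: nat
  defines "N \<equiv> samples w r" and "L \<equiv> tuple_bits w"
  assumes pos: "0 < r 0" "0 < r 1" and B': "2 * N + N * L + 8 \<le> B"
begin

text \<open>
  Every factor of the number of samples is positive, so that all intermediate results in its computation
  are at most \<open>N\<close>, and so are the lengths of its loops.
\<close>

lemma N_ge:
  "0 < N" "(2 * kappa w) ^ (2 * kappa w) \<le> N" "(num_vertices w + 1) ^ 4 \<le> N" "4 ^ places r 0 \<le> N"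
  "places r 1 + 1 \<le> N"
  "(2 * kappa w) ^ (2 * kappa w) * (num_vertices w + 1) ^ 4 \<le> N"
  "(2 * kappa w) ^ (2 * kappa w) * (num_vertices w + 1) ^ 4 * 4 ^ places r 0 \<le> N"
proof -
  define a b c d where abcd: "a = (2 * kappa w) ^ (2 * kappa w)" "b = (num_vertices w + 1) ^ 4"
    "c = (4::nat) ^ places r 0" "d = places r 1 + 1"
  have N: "N = a * b * c * d" by (simp add: N_def samples_def abcd)
  have p: "0 < a" "0 < b" "0 < c" "0 < d" by (auto simp: abcd)
  show "0 < N" unfolding N using p by simp
  have 1: "a * b \<le> a * b * c * d" "a * b * c \<le> a * b * c * d" "a \<le> a * b" "b \<le> a * b" "c \<le> a * b * c"
    "d \<le> a * b * c * d"
    using p by (auto simp: mult.assoc)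
  then show "(2 * kappa w) ^ (2 * kappa w) \<le> N" "(num_vertices w + 1) ^ 4 \<le> N" "4 ^ places r 0 \<le> N"
    "places r 1 + 1 \<le> N"
    "(2 * kappa w) ^ (2 * kappa w) * (num_vertices w + 1) ^ 4 \<le> N"
    "(2 * kappa w) ^ (2 * kappa w) * (num_vertices w + 1) ^ 4 * 4 ^ places r 0 \<le> N"
    unfolding N abcd[symmetric] by linarith+
qed

lemma N_less [simp]: "x \<le> N \<Longrightarrow> x < 2 ^ B" "x \<le> N \<Longrightarrow> x \<le> B" "x \<le> 2 * N \<Longrightarrow> x \<le> B"
  using B' by (auto intro: less_two_power)

lemma two_kappa_le: "2 * kappa w \<le> N"
proof -
  have "2 * kappa w \<le> (2 * kappa w) ^ (2 * kappa w)"
  proof (cases "kappa w = 0")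
    case False
    then show ?thesis by (intro self_le_power) auto
  qed simp
  then show ?thesis using N_ge(2) by simp
qed

lemma places_le: "places r 0 \<le> N" "places r 1 \<le> N"
proof -
  have "places r 0 \<le> 2 ^ places r 0" by (rule less_imp_le) (rule less_exp)
  also have "\<dots> \<le> 4 ^ places r 0" by (intro power_mono) auto
  also note N_ge(4)
  finally show "places r 0 \<le> N" .
  show "places r 1 \<le> N" using N_ge(5) by simp
qed

lemma L_small: "L \<le> N * L" "L < B" "N * L < B" "N + L < B"
proof -
  show L: "L \<le> N * L" using N_ge(1) by simp
  show "L < B" "N * L < B" "N + L < B" using L B' N_ge(1) by linarith+
qed

lemma fits_samplesE: "fits B w r samplesE env"
proof -
  have "fits B w r (Prod (Num 2 \<otimes> kappaE) (Num 2 \<otimes> kappaE)) env"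
  proof (cases "kappa w = 0")
    case False
    then show ?thesis
      using two_kappa_le N_ge(2) code
      by (intro fits_ProdI[where c = "2 * kappa w"]) (auto intro: small)
  qed (simp add: code small)
  moreover have "fits B w r (Prod (Num 4) (num_verticesE \<oplus> Num 1)) env"
    using N_ge(3) num_vertices_le[of w] B
    by (intro fits_ProdI[where c = "num_vertices w + 1"]) (auto intro: small)
  moreover have "fits B w r (Prod (Places 0) (Num 4)) env"
    using N_ge(4) places_le(1) pos
    by (intro fits_ProdI[where c = 4]) (auto intro: small simp: places_def)
  moreover have "fits B w r (Places 1 \<oplus> Num 1) env"
    using N_ge(5) pos by (auto intro: small simp: places_def)
  ultimately show ?thesis
    using N_ge code
    unfolding samplesE_def
    by (simp add: N_def places_def samples_def del: mult_Suc_right mult_Suc power_Suc fits.simps(7))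
qed

lemma fits_tuple_bitsE [simp]: "fits B w r tuple_bitsE env"
  using L_small unfolding tuple_bitsE_def
  by (simp add: code less_two_power L_def tuple_bits_def)

lemma fits_vertE:
  assumes "fits B w r x env" "fits B w r j env" "eval w r j env < kappa w"
  shows "fits B w r (vertE x j) env"
proof -
  have "width (num_vertices w) * eval w r j env \<le> L"
    unfolding L_def tuple_bits_def using assms(3) by (intro mult_left_mono) auto
  then have "width (num_vertices w) * eval w r j env < B" using L_small by simp
  moreover have "width (num_vertices w) < B" using width_le[of "num_vertices w"] num_vertices_le[of w] B by simp
  ultimately show ?thesis
    using assms unfolding vertE_def
    by (simp add: fits_power2 less_two_power del: fits.simps(7))
qed

lemma fits_blockE:
  assumes "fits B w r R env" "fits B w r i env" "eval w r i env < N"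
  shows "fits B w r (blockE R i) env"
proof -
  have "L * eval w r i env \<le> N * L"
    using assms(3) by (subst mult.commute) (intro mult_right_mono, auto)
  then have "L * eval w r i env < B" using L_small(3) by (rule le_less_trans)
  then show ?thesis
    using assms L_small unfolding blockE_def
    by (simp add: fits_power2 less_two_power L_def code del: fits.simps(7))
qed

lemma fits_hitE:
  assumes "R < 2 ^ B" "i < N"
  shows "fits B w r (hitE q) [i, R]"
proof -
  have small_var: "x < 2 ^ B" if "x < kappa w \<or> x < N" for x
    using that two_kappa_le by (intro N_less) auto
  have v2: "fits B w r (vertE (blockE (Var 2) (Var 1)) (Var 0)) [j, i, R]" if "j < kappa w" for j
    using assms that by (intro fits_vertE fits_blockE) (auto simp: small_var)
  have v3: "fits B w r (vertE (blockE (Var 3) (Var 2)) (Var 1)) [j', j, i, R]"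
    "fits B w r (vertE (blockE (Var 3) (Var 2)) (Var 0)) [j', j, i, R]" if "j < kappa w" "j' < j" for j j'
    using assms that by (intro fits_vertE fits_blockE; auto simp: small_var)+
  have kB: "kappa w \<le> B" using two_kappa_le by (intro N_less) auto
  have inner: "fits B w r (Prod (Var 0)
          (notE (eqE (vertE (blockE (Var 3) (Var 2)) (Var 1)) (vertE (blockE (Var 3) (Var 2)) (Var 0)))))
      [j, i, R]" if "j < kappa w" for j
    using that kB v3[OF that]
    by (intro fits_ProdI[where c = 1]) (auto simp: small_var)
  have outer: "fits B w r (Prod kappaE
       (notE (leE num_verticesE (vertE (blockE (Var 2) (Var 1)) (Var 0))) \<otimes>
        Prod (Var 0)
          (notE (eqE (vertE (blockE (Var 3) (Var 2)) (Var 1)) (vertE (blockE (Var 3) (Var 2)) (Var 0))))))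
      [i, R]"
    using kB inner v2 code
    by (intro fits_ProdI[where c = 1])
      (auto simp: prod_of_bool simp del: fits.simps(7) simp flip: of_bool_conj)
  let ?e = "entryE (vertE (blockE (Var 3) (Var 2)) (Var 1)) (vertE (blockE (Var 3) (Var 2)) (Var 0))"
  have ent: "fits B w r ?e [j', j, i, R]" if "j < kappa w" "j' < j" for j j'
    using v3[OF that] by (intro fits_entryE) (auto simp: vert_le)
  have NN: "N * (2 * N) < 2 ^ B"
  proof -
    have "N * (2 * N) < 2 ^ N * (2 * 2 ^ N)"
      by (rule mult_strict_mono) auto
    also have "\<dots> = 2 ^ (2 * N + 1)" by (simp add: power_add mult_2 distrib_left)
    also have "\<dots> \<le> 2 ^ B" using B' by (intro power_increasing) auto
    finally show ?thesis .
  qed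
  have row: "eval w r (Sum (Var 0) ?e) [j, i, R] \<le> 2 * N" if "j < kappa w" for j
  proof -
    have "eval w r (Sum (Var 0) ?e) [j, i, R] \<le> (\<Sum>j'<j. 2)"
      unfolding eval.simps nth_Cons_0 by (intro sum_mono) (simp add: entry_le[OF code])
    then show ?thesis using that two_kappa_le by simp
  qed
  have sum1: "fits B w r (Sum (Var 0) ?e) [j, i, R]" if "j < kappa w" for j
    using that kB ent[OF that] row[OF that]
    by (intro fits_SumI) (auto simp: small_var intro!: less_two_power simp del: eval.simps(6))
  have "eval w r (Sum kappaE (Sum (Var 0) ?e)) [i, R] \<le> (\<Sum>j<kappa w. 2 * N)"
    unfolding eval.simps(6)[of w r kappaE] eval_kappaE[OF code] by (intro sum_mono row) simp
  also have "\<dots> \<le> N * (2 * N)" using two_kappa_le by (simp add: mult_right_mono)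
  also note NN
  finally have total: "eval w r (Sum kappaE (Sum (Var 0) ?e)) [i, R] < 2 ^ B" .
  have "fits B w r (Sum kappaE (Sum (Var 0) ?e)) [i, R]"
  proof (rule fits_SumI)
    show "fits B w r (Sum (Var 0) ?e) [j, i, R]" if "j < eval w r kappaE [i, R]" for j
      by (rule sum1) (use that code in simp)
  qed (use kB code total in simp_all)
  then show ?thesis
    using outer B unfolding hitE_def
    by (simp add: code prod_of_bool del: fits.simps(6,7) flip: of_bool_conj)
qed

lemma fits_bitsE: "fits B w r bitsE env"
  using fits_samplesE L_small unfolding bitsE_def
  by (simp add: code less_two_power flip: N_def L_def)

lemma hits_le: "hits q w N R \<le> N"
proof -
  have "hits q w N R \<le> card {..<N}" unfolding hits_def by (intro card_mono) auto
  then show ?thesis by simp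
qed

lemma fits_numE:
  assumes "R < 2 ^ B"
  shows "fits B w r (numE q) [R]"
proof -
  have "hits q w N R * 2 ^ L < 2 ^ N * 2 ^ L"
    by (intro mult_strict_right_mono le_less_trans[OF hits_le less_exp]) simp
  also have "\<dots> = 2 ^ (N + L)" by (simp add: power_add)
  also have "\<dots> \<le> 2 ^ B" using L_small by (intro power_increasing) auto
  finally have "hits q w N R * 2 ^ L < 2 ^ B" .
  moreover have "fits B w r (Sum samplesE (hitE q)) [R]"
  proof (rule fits_SumI)
    show "eval w r (Sum samplesE (hitE q)) [R] < 2 ^ B"
      using hits_le[of q R] by (simp add: code sum_of_bool hits_def del: sum_of_bool_eq flip: N_def)
  qed (use fits_samplesE fits_hitE[OF assms] in \<open>auto simp: code simp flip: N_def\<close>)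
  moreover have "eval w r (Sum samplesE (hitE q)) [R] = hits q w N R"
    by (simp add: code sum_of_bool hits_def del: sum_of_bool_eq flip: N_def)
  ultimately show ?thesis
    using L_small unfolding numE_def
    by (simp add: code fits_power2 flip: L_def del: fits.simps(6,7) eval.simps(6))
qed

lemma fits_denE: "fits B w r denE env"
proof -
  have "fits B w r (Prod kappaE (Var 0 \<oplus> Num 1)) env"
  proof (cases "kappa w = 0")
    case False
    with N_ge(2) self_power_le[of "kappa w"] have "kappa w ^ kappa w \<le> N" by simp
    then show ?thesis
      using False two_kappa_le code
      by (intro fits_ProdI[where c = "kappa w"]) auto
  qed (simp add: code small)
  moreover have "eval w r (Prod kappaE (Var 0 \<oplus> Num 1)) env = fact (kappa w)"
    by (simp add: code fact_prod_Suc atLeast0LessThan)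
  moreover have "N * fact (kappa w) < 2 ^ B"
  proof -
    have "fact (kappa w) \<le> kappa w ^ kappa w" using fact_le_power[of "kappa w", where 'a = nat] by simp
    also have "\<dots> \<le> (2 * kappa w) ^ (2 * kappa w)" by (rule self_power_le)
    finally have "fact (kappa w) \<le> N" using N_ge(2) by simp
    then have "N * fact (kappa w) \<le> N * N" by simp
    also have "\<dots> < 2 ^ N * 2 ^ N" by (rule mult_strict_mono) auto
    also have "\<dots> = 2 ^ (2 * N)" by (simp add: mult_2 power_add)
    also have "\<dots> \<le> 2 ^ B" using B' by (intro power_increasing) auto
    finally show ?thesis .
  qed
  ultimately show ?thesis
    using fits_samplesE unfolding denE_def
    by (simp add: code del: fits.simps(7) eval.simps(7) flip: N_def)
qed

end

end


section \<open>Concentration\<close>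

text \<open>
  The blocks of a uniform number below \<open>Q ^ N\<close> are \<open>N\<close> independent uniform numbers below \<open>Q\<close>, so
  that the number of blocks satisfying \<open>P\<close> is binomially distributed.
\<close>

lemma map_spmf_count_blocks:
  fixes P :: "nat \<Rightarrow> bool" and Q :: nat
  assumes Q: "0 < Q"
  defines "p \<equiv> card {x. x < Q \<and> P x} / Q"
  shows "map_spmf (\<lambda>R. card {i. i < N \<and> P (R div Q ^ i mod Q)}) (spmf_of_set {..<Q ^ N}) =
           spmf_of_pmf (binomial_pmf N p)"
proof (induction N)
  case 0
  have "p \<in> {0..1}"
  proof -
    have "card {x. x < Q \<and> P x} \<le> card {..<Q}" by (intro card_mono) auto
    then show ?thesis using Q by (simp add: p_def)
  qed
  then show ?case
    by (simp add: lessThan_Suc binomial_pmf_0 spmf_of_set_singleton)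
next
  case (Suc N)
  let ?U = "spmf_of_set {..<Q}" and ?V = "spmf_of_set {..<Q ^ N}"
  let ?c = "\<lambda>N R. card {i. i < N \<and> P (R div Q ^ i mod Q)}"
  have p: "p \<in> {0..1}"
  proof -
    have "card {x. x < Q \<and> P x} \<le> card {..<Q}" by (intro card_mono) auto
    then show ?thesis using Q by (simp add: p_def)
  qed
  have bern: "map_spmf P ?U = spmf_of_pmf (bernoulli_pmf p)"
  proof -
    have "{x. P x} \<inter> {..<Q} = {x. x < Q \<and> P x}" by auto
    then show ?thesis
      using map_mem_spmf_of_set[of "{..<Q}" "{x. P x}"] Q by (auto simp: p_def)
  qed
  have step: "?c (Suc N) (y * Q + x) = of_bool (P x) + ?c N y" if "x < Q" for x y
  proof -
    have "(y * Q + x) div Q ^ Suc i = y div Q ^ i" for i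
      using that Q by (simp add: div_mult2_eq)
    then show ?thesis
      using that by (simp only: sum_of_bool[symmetric] sum.lessThan_Suc_shift) simp
  qed
  have "map_spmf (?c (Suc N)) (spmf_of_set {..<Q ^ Suc N}) =
      map_spmf (?c (Suc N)) (bind_spmf ?V (\<lambda>y. map_spmf (\<lambda>x. y * Q + x) ?U))"
    using Q by (subst spmf_of_set_lessThan_mult) (simp_all add: mult.commute)
  also have "\<dots> = bind_spmf ?V (\<lambda>y. bind_spmf ?U (\<lambda>x. return_spmf (?c (Suc N) (y * Q + x))))"
    by (simp add: map_spmf_bind_spmf o_def spmf.map_comp map_spmf_conv_bind_spmf del: map_spmf_of_set_inj_on)
  also have "\<dots> = bind_spmf ?V (\<lambda>y. bind_spmf ?U (\<lambda>x. return_spmf (of_bool (P x) + ?c N y)))"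
    by (intro bind_spmf_cong refl) (simp add: step)
  also have "\<dots> = bind_spmf ?U (\<lambda>x. bind_spmf ?V (\<lambda>y. return_spmf (of_bool (P x) + ?c N y)))"
    by (rule bind_commute_spmf)
  also have "\<dots> = bind_spmf (map_spmf P ?U) (\<lambda>b. bind_spmf (map_spmf (?c N) ?V) (\<lambda>k. return_spmf (of_bool b + k)))"
    by (simp add: bind_map_spmf o_def)
  also have "\<dots> = bind_spmf (spmf_of_pmf (bernoulli_pmf p))
      (\<lambda>b. bind_spmf (spmf_of_pmf (binomial_pmf N p)) (\<lambda>k. return_spmf (of_bool b + k)))"
    unfolding Suc bern ..
  also have "\<dots> = spmf_of_pmf (binomial_pmf (Suc N) p)"
    by (simp add: binomial_pmf_Suc[OF p] spmf_of_pmf_bind of_bool_def)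
  finally show ?case .
qed

text \<open>
  Hoeffding's inequality for the absolute error \<open>\<epsilon> * p\<close>.  The estimate is exact if \<open>p = 0\<close>, where this
  absolute error is not positive.
\<close>

lemma binomial_relative_error:
  fixes p \<epsilon> \<delta> :: real
  assumes p: "p \<in> {0..1}" and N: "0 < N" and \<epsilon>: "0 < \<epsilon>" and \<delta>: "0 < \<delta>"
    and small: "p = 0 \<or> 2 * exp (-2 * N * (\<epsilon> * p)\<^sup>2) \<le> \<delta>"
  shows "1 - \<delta> \<le> measure_pmf.prob (binomial_pmf N p) {X. (1 - \<epsilon>) * p \<le> X / N \<and> X / N \<le> (1 + \<epsilon>) * p}"
    (is "_ \<le> measure_pmf.prob ?B ?A")
proof (cases "p = 0")
  case True
  have "?B = return_pmf 0" using True by (simp flip: set_pmf_subset_singleton)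
  then show ?thesis using \<delta> True by simp
next
  case False
  interpret binomial_distribution N p by unfold_locales (rule p)
  have "measure_pmf.prob ?B {x. \<bar>real x / N - p\<bar> \<ge> \<epsilon> * p} \<le> 2 * exp (-2 * N * (\<epsilon> * p)\<^sup>2)"
    using N \<epsilon> p by (intro prob_abs_ge') auto
  also have "\<dots> \<le> \<delta>" using small False by simp
  finally have "1 - \<delta> \<le> 1 - measure_pmf.prob ?B {x. \<bar>real x / N - p\<bar> \<ge> \<epsilon> * p}" by simp
  also have "\<dots> = measure_pmf.prob ?B (- {x. \<bar>real x / N - p\<bar> \<ge> \<epsilon> * p})"
    using measure_pmf.prob_compl[of "{x. \<bar>real x / N - p\<bar> \<ge> \<epsilon> * p}" ?B] by (simp add: Compl_eq_Diff_UNIV)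
  also have "\<dots> \<le> measure_pmf.prob ?B ?A"
    by (intro measure_pmf.finite_measure_mono) (auto simp: abs_if algebra_simps split: if_splits)
  finally show ?thesis .
qed

lemma places_bounds:
  fixes r :: "nat \<Rightarrow> real"
  assumes "0 < r i"
  shows "1 \<le> 2 ^ places r i * r i" "2 ^ places r i \<le> max 1 (2 / r i)"
proof -
  have "\<exists>j. 1 \<le> 2 ^ j * r i"
  proof -
    obtain j :: nat where "1 / r i < 2 ^ j" using real_arch_pow[of 2 "1 / r i"] by auto
    then show ?thesis using assms by (intro exI[of _ j]) (simp add: field_simps)
  qed
  then show "1 \<le> 2 ^ places r i * r i" unfolding places_def by (rule LeastI_ex)
  show "2 ^ places r i \<le> max 1 (2 / r i)"
  proof (cases "places r i")
    case (Suc j)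
    then have "\<not> 1 \<le> 2 ^ j * r i" unfolding places_def by (metis lessI not_less_Least)
    then have "2 ^ places r i \<le> 2 / r i" using assms Suc by (simp add: field_simps)
    then show ?thesis by simp
  qed simp
qed

lemma hit_probability_range: "hit_probability q w \<in> {0..1}"
proof -
  let ?L = "width (num_vertices w) * kappa w"
  have "card {x. x < 2 ^ ?L \<and> hit q w x} \<le> card {..<(2::nat) ^ ?L}" by (intro card_mono) auto
  then have "real (card {x. x < 2 ^ ?L \<and> hit q w x}) \<le> 2 ^ ?L"
    by (metis card_lessThan of_nat_le_iff of_nat_numeral of_nat_power)
  then show ?thesis by (simp add: hit_probability_def)
qed

lemma samples_pos: "0 < samples w r"
  by (auto simp: samples_def)

text \<open>
  Write \<open>W = (2 * k) ^ k * (n + 1)\<^sup>2\<close>, so that the number of samples is \<open>W\<^sup>2 * (2 ^ j)\<^sup>2 * (l + 1)\<close>.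
  As \<open>1 \<le> p * W\<close> and \<open>1 \<le> 2 ^ j * \<epsilon>\<close>, the exponent is at most \<open>-2 * (l + 1)\<close>, and
  \<open>2 * exp (-2 * (l + 1)) \<le> 2 ^ -l \<le> \<delta>\<close>.
\<close>

lemma samples_suffice:
  assumes "wellformed w" "0 < r 0" "0 < r 1"
  shows "hit_probability q w = 0 \<or>
         2 * exp (-2 * real (samples w r) * (r 0 * hit_probability q w)\<^sup>2) \<le> r 1"
proof (cases "parity_sets q w = {}")
  case True
  then show ?thesis by (simp add: hit_probability_def card_hits[OF assms(1)])
next
  case False
  define p W j l where "p = hit_probability q w" and
    "W = (2 * real (kappa w)) ^ kappa w * (real (num_vertices w) + 1) ^ 2" and
    "j = places r 0" and "l = places r 1"
  have pW: "1 \<le> p * W"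
    using hit_probability_lower_bound[OF assms(1) False] by (simp add: p_def W_def)
  have N: "real (samples w r) = W ^ 2 * (2 ^ j) ^ 2 * (l + 1)"
  proof -
    have "(4::real) ^ j = (2 ^ j) ^ 2" by (simp add: power2_eq_square flip: power_mult_distrib)
    moreover have "(2 * real (kappa w)) ^ (2 * kappa w) = ((2 * real (kappa w)) ^ kappa w) ^ 2"
      by (metis mult.commute power_mult)
    moreover have "(real (num_vertices w) + 1) ^ 4 = ((real (num_vertices w) + 1) ^ 2) ^ 2" by simp
    ultimately show ?thesis
      by (simp add: samples_def W_def power_mult_distrib j_def l_def add.commute distrib_left)
  qed
  \<comment> \<open>One factor \<open>W * 2 ^ j\<close> of the sample size compensates a small \<open>\<epsilon> * p\<close>; it occurs squared.\<close>
  have "1 * 1 \<le> (p * W) ^ 2 * (2 ^ j * r 0) ^ 2"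
    using pW places_bounds(1)[of r 0] assms(2) unfolding j_def by (intro mult_mono one_le_power) auto
  then have "1 * real (l + 1) \<le> (p * W) ^ 2 * (2 ^ j * r 0) ^ 2 * real (l + 1)"
    by (intro mult_right_mono) auto
  also have "\<dots> = real (samples w r) * (r 0 * p)\<^sup>2"
    unfolding N by (simp add: power_mult_distrib)
  finally have big: "real (l + 1) \<le> real (samples w r) * (r 0 * p)\<^sup>2" by simp
  have "2 * exp (-2 * real (samples w r) * (r 0 * p)\<^sup>2) \<le> 2 * exp (- 2 * real (l + 1))"
    using big by simp
  also have "\<dots> = 2 * (exp (-2)) ^ (l + 1)"
    by (simp only: exp_of_nat_mult[symmetric] mult.commute)
  also have "\<dots> \<le> 2 * (1 / 2) ^ (l + 1)"
  proof -
    have "2 \<le> exp (2::real)" using exp_ge_add_one_self[of "2::real"] by simp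
    then have "exp (-2) \<le> (1 / 2 :: real)" by (simp add: exp_minus field_simps)
    then show ?thesis by (intro mult_left_mono power_mono) auto
  qed
  also have "\<dots> = 1 / 2 ^ l" by (simp add: power_one_over)
  also have "\<dots> \<le> r 1"
    using places_bounds(1)[of r 1] assms(3) by (simp add: l_def field_simps)
  finally show ?thesis by (simp add: p_def)
qed


section \<open>Running time\<close>

text \<open>
  The summands bound the values that occur while the word is parsed, those made from the numbers of
  samples and hits, and the random number.
\<close>

definition word_bound :: "word \<Rightarrow> (nat \<Rightarrow> real) \<Rightarrow> nat" where
  "word_bound w r = 2 * length w + 8 + 2 * samples w r + samples w r * tuple_bits w"

text \<open>
  Up to constants, \<open>4 ^ j\<close> is at most \<open>(1 + 1 / \<epsilon>)\<^sup>2\<close>, and \<open>l + 1\<close> is at most \<open>1 + log (1 / \<delta>)\<close>.  A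
  fifth power of one product of linear factors is a convenient common majorant.
\<close>

lemma word_bound_le:
  fixes r :: "nat \<Rightarrow> real" and w :: word
  assumes "0 < r 0" "0 < r 1" "r 1 < 1"
  defines "a \<equiv> 9 + 8 * (2 * real (kappa w)) ^ (2 * kappa w) * (2 + real (kappa w))"
  shows "real (word_bound w r) + 1 \<le>
           a * ((1 + real (length w)) * (1 + 1 / r 0) * (1 + log 2 (1 / r 1))) ^ 5"
proof -
  define x y z where xyz: "x = 1 + real (length w)" "y = 1 + 1 / r 0" "z = 1 + log 2 (1 / r 1)"
  define c where "c = (2 * real (kappa w)) ^ (2 * kappa w)"
  have log: "0 < log 2 (1 / r 1)" using assms by simp
  have ge1: "1 \<le> x" "1 \<le> y" "1 \<le> z" "0 \<le> c" using assms log by (auto simp: xyz c_def)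
  have j: "(2::real) ^ places r 0 \<le> 2 * y"
  proof -
    have "0 < 2 / r 0" using assms by simp
    then have "max 1 (2 / r 0) \<le> 2 + 2 / r 0" by (intro max.boundedI) linarith+
    from order_trans[OF places_bounds(2)[of r 0, OF assms(1)] this] show ?thesis by (simp add: xyz distrib_left)
  qed
  have l: "real (places r 1) + 1 \<le> 2 * z"
  proof -
    have "1 \<le> 2 / r 1" using assms by simp
    then have "2 ^ places r 1 \<le> 2 / r 1"
      using places_bounds(2)[of r 1] assms by simp
    then have "log 2 (2 ^ places r 1) \<le> log 2 (2 / r 1)"
      using assms by (subst log_le_cancel_iff) auto
    also have "log 2 (2 / r 1) = 1 + log 2 (1 / r 1)"
      using assms by (simp add: log_divide)
    finally show ?thesis using log by (simp add: xyz)
  qed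
  have n: "real (num_vertices w) + 1 \<le> x" using num_vertices_le[of w] by (simp add: xyz)
  have L: "2 + real (tuple_bits w) \<le> (2 + real (kappa w)) * x"
  proof -
    have "width (num_vertices w) * kappa w \<le> length w * kappa w"
      using width_le[of "num_vertices w"] num_vertices_le[of w] by (intro mult_right_mono) auto
    then have "real (tuple_bits w) \<le> real (length w) * real (kappa w)"
      unfolding tuple_bits_def by (metis of_nat_le_iff of_nat_mult)
    then show ?thesis by (simp add: xyz algebra_simps)
  qed
  have N: "real (samples w r) \<le> c * x ^ 4 * (2 * y) ^ 2 * (2 * z)"
  proof -
    have "(4::real) ^ places r 0 = (2 ^ places r 0) ^ 2" by (simp add: power2_eq_square flip: power_mult_distrib)
    then have "real (samples w r) = c * (real (num_vertices w) + 1) ^ 4 * (2 ^ places r 0) ^ 2 * (real (places r 1) + 1)"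
      by (simp add: samples_def c_def add.commute distrib_left)
    also have "\<dots> \<le> c * x ^ 4 * (2 * y) ^ 2 * (2 * z)"
      using n j l ge1 by (intro mult_mono power_mono) auto
    finally show ?thesis .
  qed
  have "real (samples w r) * (2 + real (tuple_bits w)) \<le>
      (c * x ^ 4 * (2 * y) ^ 2 * (2 * z)) * ((2 + real (kappa w)) * x)"
    using N L ge1 by (intro mult_mono) auto
  also have "\<dots> = 8 * c * (2 + real (kappa w)) * (x ^ 5 * y ^ 2 * z)"
    by (simp add: power2_eq_square power_numeral_reduce)
  also have "\<dots> \<le> 8 * c * (2 + real (kappa w)) * (x ^ 5 * y ^ 5 * z ^ 5)"
    using ge1 self_le_power[of z 5] by (intro mult_left_mono mult_mono power_increasing) auto
  finally have 1: "real (samples w r) * (2 + real (tuple_bits w)) \<le>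
      8 * c * (2 + real (kappa w)) * (x * y * z) ^ 5"
    by (simp add: power_mult_distrib)
  have "1 * 1 * x \<le> y ^ 5 * z ^ 5 * x ^ 5"
    using ge1 self_le_power[of x 5] by (intro mult_mono one_le_power) auto
  then have "9 * x \<le> 9 * (x * y * z) ^ 5" by (simp add: power_mult_distrib mult_ac)
  moreover have "real (word_bound w r) + 1 \<le> 9 * x + real (samples w r) * (2 + real (tuple_bits w))"
    by (simp add: word_bound_def xyz algebra_simps)
  ultimately have "real (word_bound w r) + 1 \<le> 9 * (x * y * z) ^ 5 + 8 * c * (2 + real (kappa w)) * (x * y * z) ^ 5"
    using 1 by linarith
  also have "\<dots> = a * (x * y * z) ^ 5" by (simp add: a_def c_def algebra_simps)
  finally show ?thesis by (simp add: xyz)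
qed

text \<open>
  The binomial theorem for each of the three factors yields the coefficients.
\<close>

lemma trivariate_polynomial_power:
  "trivariate_polynomial (\<lambda>x y z. ((1 + x) * (1 + y) * (1 + z)) ^ d)"
  unfolding trivariate_polynomial_def
proof (intro exI allI)
  fix x y z :: real
  have pow: "(1 + u) ^ d = (\<Sum>i\<le>d. real (d choose i) * u ^ i)" for u :: real
    using binomial_ring[of u 1 d] by (simp add: add.commute)
  define A where "A u i = real (d choose i) * u ^ i" for u :: real and i
  have "((1 + x) * (1 + y) * (1 + z)) ^ d = (\<Sum>i\<le>d. A x i) * (\<Sum>j\<le>d. A y j) * (\<Sum>l\<le>d. A z l)"
    by (simp add: power_mult_distrib pow A_def)
  also have "\<dots> = (\<Sum>i\<le>d. \<Sum>j\<le>d. \<Sum>l\<le>d. A x i * A y j * A z l)"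
    by (simp only: sum_distrib_left[symmetric] sum_distrib_right[symmetric])
  finally show "((1 + x) * (1 + y) * (1 + z)) ^ d = (\<Sum>i\<le>d. \<Sum>j\<le>d. \<Sum>l\<le>d.
      (real (d choose i) * real (d choose j) * real (d choose l)) * x ^ i * y ^ j * z ^ l)"
    by (simp add: A_def mult_ac)
qed


section \<open>The approximation scheme\<close>

definition count_code :: "bool \<Rightarrow> word \<Rightarrow> nat" where
  "count_code q w = (if wellformed w then card (parity_sets q w) else 0)"

lemma on_codes_even:
  "w \<in> lists {0, 1, 2} \<Longrightarrow>
     on_codes (\<lambda>(n, E, k). num_even_subgraphs {..<n} E k) w = count_code True w"
  by (simp add: on_codes_parse count_code_def num_even_subgraphs_def parity_sets_def slice_def kappa_def conj_assoc)

lemma on_codes_odd: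
  "w \<in> lists {0, 1, 2} \<Longrightarrow>
     on_codes (\<lambda>(n, E, k). num_odd_subgraphs {..<n} E k) w = count_code False w"
  by (simp add: on_codes_parse count_code_def num_odd_subgraphs_def parity_sets_def slice_def kappa_def conj_assoc)

lemma on_codes_kappa:
  "w \<in> lists {0, 1, 2} \<Longrightarrow> on_codes (\<lambda>(n, E, k). k) w = kappa w"
  by (simp add: on_codes_parse kappa_def)

lemma kappa_poly_time: "poly_time_computable {0, 1, 2} (on_codes (\<lambda>(n, E, k). k))"
proof -
  obtain T where T: "poly_bounded T" "\<And>w r B \<rho> env m. fits B w r kappaE env \<Longrightarrow> map m \<rho> = env \<Longrightarrow>
      (\<forall>x\<in>set \<rho>. x < 0) \<Longrightarrow> computes w r (compile kappaE \<rho> 0) m (T B) 0 (eval w r kappaE env)"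
    using compile_correct[of kappaE 0] by blast
  obtain C d where Cd: "\<And>B. T B \<le> C * (B + 1) ^ d" using T(1) by (auto simp: poly_bounded_def)
  let ?p = "Polynomial.smult (real C) ([:9, 2:] ^ d)"
  have "\<exists>m t. run (compile kappaE [] 0) w (\<lambda>_. 0) = return_spmf (m, t) \<and>
      m 0 = on_codes (\<lambda>(n, E, k). k) w \<and> real t \<le> poly ?p (real (length w))"
    if w: "w \<in> lists {0, 1, 2}" for w
  proof -
    let ?B = "2 * length w + 8"
    have tern: "ternary w" using w by (simp only: ternary_def)
    have "computes w (\<lambda>_. 0) (compile kappaE [] 0) (\<lambda>_. 0) (T ?B) 0 (kappa w)"
      using T(2)[of ?B w "\<lambda>_. 0" "[]" "\<lambda>_. 0" "[]"] fits_kappaE[OF tern] by (simp add: tern)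
    then obtain m t where mt: "run (compile kappaE [] 0) w (\<lambda>_. 0) = return_spmf (m, t)"
      "t \<le> T ?B" "m 0 = kappa w"
      unfolding computes_def run_def by (auto elim: achievesE)
    have "real t \<le> real (C * (?B + 1) ^ d)" using mt(2) Cd[of ?B] by linarith
    also have "\<dots> = poly ?p (real (length w))" by (simp add: poly_power algebra_simps)
    finally show ?thesis using mt w by (simp add: on_codes_kappa)
  qed
  then show ?thesis unfolding poly_time_computable_def by blast
qed

text \<open>
  The output is \<open>X * 2 ^ L / (N * k!)\<close> for \<open>X\<close> hits among \<open>N\<close> samples of \<open>L\<close> bits.  As the number
  to be approximated is \<open>p * 2 ^ L / k!\<close>, its relative error is that of \<open>X / N\<close> as an estimate of \<open>p\<close>.
\<close>

lemma is_FPTRAS_sampler: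
  assumes F: "\<And>w. w \<in> lists {0, 1, 2} \<Longrightarrow> F w = count_code q w"
  shows "is_FPTRAS (sampler bitsE (numE q) denE) ({0, 1, 2}, F, on_codes (\<lambda>(n, E, k). k))"
proof -
  let ?c = "sampler bitsE (numE q) denE" and ?\<kappa> = "on_codes (\<lambda>(n, E, k). k)"
  obtain T where T: "poly_bounded T"
    "\<And>w r B M. M = eval w r bitsE [] \<Longrightarrow> M \<le> B \<Longrightarrow> fits B w r bitsE [] \<Longrightarrow>
        (\<forall>R<2 ^ M. fits B w r (numE q) [R] \<and> fits B w r denE [R]) \<Longrightarrow>
        map_spmf (\<lambda>(m, t). (m 0, m 1)) (run ?c w r) =
          map_spmf (\<lambda>R. (eval w r (numE q) [R], eval w r denE [R])) (spmf_of_set {..<2 ^ M}) \<and>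
        (\<forall>(m, t) \<in> set_spmf (run ?c w r). t \<le> T B)"
    using sampler_correct[of bitsE "numE q" denE] by blast
  obtain C d where Cd: "\<And>B. T B \<le> C * (B + 1) ^ d" using T(1) by (auto simp: poly_bounded_def)
  define f where "f k = real C * (9 + 8 * (2 * real k) ^ (2 * k) * (2 + real k)) ^ d" for k
  define g :: "real \<Rightarrow> real \<Rightarrow> real \<Rightarrow> real" where "g x y z = ((1 + x) * (1 + y) * (1 + z)) ^ (5 * d)" for x y z
  have g: "trivariate_polynomial g"
    unfolding g_def by (rule trivariate_polynomial_power)
  have main: "lossless_spmf (run ?c w r) \<and>
      (\<forall>(m, t) \<in> set_spmf (run ?c w r). m 1 \<noteq> 0 \<and>
         real t \<le> f (?\<kappa> w) * g (real (length w)) (1 / \<epsilon>) (log 2 (1 / \<delta>))) \<and>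
      measure (measure_spmf (run ?c w r))
         {(m, t). (1 - \<epsilon>) * real (F w) \<le> of_rat (output_value m) \<and>
                  of_rat (output_value m) \<le> (1 + \<epsilon>) * real (F w)} \<ge> 1 - \<delta>"
    if w: "w \<in> lists {0, 1, 2}" and \<epsilon>: "0 < \<epsilon>" and \<delta>: "0 < \<delta>" "\<delta> < 1"
      and r: "r = (\<lambda>i. if i = 0 then \<epsilon> else \<delta>)" for w r and \<epsilon> \<delta> :: real
  proof -
    let ?D = "run ?c w r"
    define N L B where "N = samples w r" and "L = tuple_bits w" and "B = word_bound w r"
    have tern: "ternary w" using w by (simp only: ternary_def)
    have pos: "0 < r 0" "0 < r 1" using \<epsilon> \<delta> by (simp_all add: r)
    have B: "2 * length w + 8 \<le> B" "2 * samples w r + samples w r * tuple_bits w + 8 \<le> B"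
      by (simp_all add: B_def word_bound_def)
    have M: "N * L \<le> B" "N * L = eval w r bitsE []"
      using B(2) by (simp_all add: tern N_def L_def)
    have fits: "fits B w r (numE q) [R] \<and> fits B w r denE [R]" if "R < 2 ^ (N * L)" for R
    proof -
      have "(2::nat) ^ (N * L) \<le> 2 ^ B" using M(1) by (intro power_increasing) auto
      then have "R < 2 ^ B" using that by (rule less_le_trans[rotated])
      then show ?thesis using fits_numE[OF tern B(1) pos B(2)] fits_denE[OF tern B(1) pos B(2)] by simp
    qed
    have sampled: "map_spmf (\<lambda>(m, t). (m 0, m 1)) ?D =
        map_spmf (\<lambda>R. (of_bool (wellformed w) * (hits q w N R * 2 ^ L), N * fact (kappa w)))
          (spmf_of_set {..<2 ^ (N * L)})"
      and time: "\<And>m t. (m, t) \<in> set_spmf ?D \<Longrightarrow> t \<le> T B"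
      using T(2)[OF M(2,1) fits_bitsE[OF tern B(1) pos B(2)]] fits
      by (auto simp: tern N_def[symmetric] L_def[symmetric])
    have "lossless_spmf (map_spmf (\<lambda>(m, t). (m 0, m 1)) ?D)"
      unfolding sampled lossless_map_spmf by (auto simp: lessThan_empty_iff)
    then have lossless: "lossless_spmf ?D" by simp
    have den: "m 1 = N * fact (kappa w)" if "(m, t) \<in> set_spmf ?D" for m t
    proof -
      have "(m 0, m 1) \<in> set_spmf (map_spmf (\<lambda>(m, t). (m 0, m 1)) ?D)" using that by force
      then show ?thesis unfolding sampled by auto
    qed
    have N: "0 < N" by (simp add: N_def samples_pos)
    have bound: "real t \<le> f (?\<kappa> w) * g (real (length w)) (1 / \<epsilon>) (log 2 (1 / \<delta>))"
      if "(m, t) \<in> set_spmf ?D" for m t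
    proof -
      let ?a = "9 + 8 * (2 * real (kappa w)) ^ (2 * kappa w) * (2 + real (kappa w))"
      let ?G = "(1 + real (length w)) * (1 + 1 / \<epsilon>) * (1 + log 2 (1 / \<delta>))"
      have "real B + 1 \<le> ?a * ?G ^ 5"
        using word_bound_le[of r w] pos \<delta> by (simp add: B_def r)
      then have "(real B + 1) ^ d \<le> (?a * ?G ^ 5) ^ d" by (intro power_mono) auto
      then have "real C * (real B + 1) ^ d \<le> real C * (?a * ?G ^ 5) ^ d"
        by (intro mult_left_mono) auto
      moreover have "real t \<le> real (C * (B + 1) ^ d)"
        using time[OF that] Cd[of B] by linarith
      ultimately have "real t \<le> real C * (?a * ?G ^ 5) ^ d" by (simp add: add.commute)
      also have "\<dots> = f (kappa w) * g (real (length w)) (1 / \<epsilon>) (log 2 (1 / \<delta>))"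
        by (simp only: f_def g_def power_mult_distrib power_mult mult.assoc)
      finally show ?thesis using w by (simp only: on_codes_kappa)
    qed
    have accurate: "1 - \<delta> \<le> measure (measure_spmf ?D)
         {(m, t). (1 - \<epsilon>) * real (F w) \<le> of_rat (output_value m) \<and>
                  of_rat (output_value m) \<le> (1 + \<epsilon>) * real (F w)}"
    proof -
      let ?ok = "\<lambda>(a, b). (1 - \<epsilon>) * real (F w) \<le> real a / real b \<and> real a / real b \<le> (1 + \<epsilon>) * real (F w)"
      have "measure (measure_spmf ?D)
         {(m, t). (1 - \<epsilon>) * real (F w) \<le> of_rat (output_value m) \<and>
                  of_rat (output_value m) \<le> (1 + \<epsilon>) * real (F w)} =
        measure (measure_spmf (map_spmf (\<lambda>(m, t). (m 0, m 1)) ?D)) {x. ?ok x}"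
        unfolding measure_map_spmf
        by (intro arg_cong[where f = "measure _"]) (auto simp: output_value_def of_rat_divide)
      also have "\<dots> = measure (measure_spmf (spmf_of_set {..<2 ^ (N * L)}))
         {R. ?ok (of_bool (wellformed w) * (hits q w N R * 2 ^ L), N * fact (kappa w))}"
        unfolding sampled measure_map_spmf by (simp add: vimage_def)
      also have "\<dots> \<ge> 1 - \<delta>"
      \<comment> \<open>On a word that is not a code, the output and the number to be approximated are both 0.\<close>
      proof (cases "wellformed w")
        case False
        then have "F w = 0" using F[OF w] by (simp add: count_code_def)
        have "measure (measure_spmf (spmf_of_set {..<2 ^ (N * L)} :: nat spmf)) UNIV = 1"
          by (simp add: weight_spmf_def[symmetric] lessThan_empty_iff)
        then show ?thesis using False \<open>F w = 0\<close> \<delta> by simp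
      next
        case True
        define p where "p = hit_probability q w"
        have Fw: "real (F w) = p * 2 ^ L / fact (kappa w)"
          using True F[OF w] card_hits[OF True, of q]
          by (simp add: count_code_def p_def hit_probability_def L_def tuple_bits_def)
        have ok: "?ok (X * 2 ^ L, N * fact (kappa w)) \<longleftrightarrow>
            (1 - \<epsilon>) * p \<le> real X / real N \<and> real X / real N \<le> (1 + \<epsilon>) * p" for X
        proof -
          define s :: real where "s = 2 ^ L / fact (kappa w)"
          have s: "0 < s" by (simp add: s_def)
          have 1: "real (F w) = p * s" by (simp add: Fw s_def)
          have 2: "real (X * 2 ^ L) / real (N * fact (kappa w)) = real X / real N * s"
            by (simp add: s_def)
          show ?thesis
            unfolding prod.case 1 2 mult.assoc[symmetric] mult_le_cancel_right_pos[OF s] ..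
        qed
        have "map_spmf (hits q w N) (spmf_of_set {..<2 ^ (N * L)}) = spmf_of_pmf (binomial_pmf N p)"
          using map_spmf_count_blocks[of "2 ^ L" N "hit q w"]
          by (simp add: hits_def[abs_def] block_def p_def hit_probability_def L_def tuple_bits_def
              mult.commute flip: power_mult)
        then have "measure (measure_spmf (spmf_of_set {..<2 ^ (N * L)})) (hits q w N -` {X. ?ok (X * 2 ^ L, N * fact (kappa w))}) =
            measure_pmf.prob (binomial_pmf N p) {X. (1 - \<epsilon>) * p \<le> X / N \<and> X / N \<le> (1 + \<epsilon>) * p}"
          unfolding measure_map_spmf[symmetric] ok by (simp add: measure_spmf_spmf_of_pmf)
        also have "\<dots> \<ge> 1 - \<delta>"
          using samples_suffice[OF True pos, of q] hit_probability_range[of q w] N \<epsilon> \<delta>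
          by (intro binomial_relative_error) (auto simp: p_def N_def r)
        finally show ?thesis using True by (simp add: vimage_def)
      qed
      finally show ?thesis .
    qed
    have "\<forall>(m, t) \<in> set_spmf ?D. m 1 \<noteq> 0 \<and>
         real t \<le> f (?\<kappa> w) * g (real (length w)) (1 / \<epsilon>) (log 2 (1 / \<delta>))"
    proof (rule ballI)
      fix x assume x: "x \<in> set_spmf ?D"
      obtain m t where mt: "x = (m, t)" by (cases x)
      have "m 1 \<noteq> 0" using den[OF x[unfolded mt]] N by simp
      then show "case x of (m, t) \<Rightarrow> m 1 \<noteq> 0 \<and>
         real t \<le> f (?\<kappa> w) * g (real (length w)) (1 / \<epsilon>) (log 2 (1 / \<delta>))"
        unfolding mt prod.case using bound[OF x[unfolded mt]] by (rule conjI)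
    qed
    then show ?thesis by (intro conjI lossless accurate)
  qed
  show ?thesis
    unfolding is_FPTRAS.simps Let_def
  proof (intro conjI exI[of _ f] exI[of _ g])
    show "param_counting_problem ({0, 1, 2}, F, ?\<kappa>)" using kappa_poly_time by simp
    show "trivariate_polynomial g" by (rule g)
  qed (intro ballI allI impI main refl)
qed

theorem theorem3p14:
  shows "(\<exists>c. is_FPTRAS c p_even_subgraph) \<and> (\<exists>c. is_FPTRAS c p_odd_subgraph)"
proof
  show "\<exists>c. is_FPTRAS c p_even_subgraph"
    unfolding p_even_subgraph_def
    using is_FPTRAS_sampler[OF on_codes_even] by blast
  show "\<exists>c. is_FPTRAS c p_odd_subgraph"
    unfolding p_odd_subgraph_def
    using is_FPTRAS_sampler[OF on_codes_odd] by blast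
qed

end
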